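(* Consider either (a) the $\mathbb Z$-valued $p$-SOS model ($p>0$) on $\mathcal T^d$ with $d\ge d(p,M,d_{\max})$ as in Theorem 1, ground-state class $\mathcal G^0(d_{\max},d,M)$; or (b) the $\mathbb Z_q$-valued finite-spin model on $\mathcal T^d$ satisfying $(d-1)u>d_{\max}(U+u)$ as in Theorem 2, ground-state class $\mathcal G^0_q(d_{\max},d)$; in either case perturbed by single-site potentials $\Psi_v:\Omega_0\to\mathbb R$, i.e. with Hamiltonian $\sum_{v\sim w}\Phi(\omega_v,\omega_w)+\sum_v\Psi_v(\omega_v)$. Then there is a threshold $\epsilon^*>0$ such that for every family $(\Psi_v)_{v\in V}$ with $$\sup_{v\in V}\sup_{k,l\in\Omega_0}|\Psi_v(k)-\Psi_v(l)|\le\epsilon^*,$$ and all $\beta$ sufficiently large, there is a family of Gibbs measures $(\mu^{\omega^0}_\beta[\Psi])$ indexed by the respective ground-state class, which are extremal, pairwise distinct for distinct $\omega^0$, and concentrated around $\omega^0$: in case (a) $\mu^{\omega^0}_\beta[\Psi](\sigma_v-\omega^0_v=k)\le Ce^{-c\beta|k|^p}$ for all $v,k$, and in case (b) $\mu^{\omega^0}_\beta[\Psi](\sigma_v=\omega^0_v)\ge1-Ce^{-c\beta}$ for all $v$, for some constants $c,C>0$.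
   Context: $\mathcal T^d=(V,E)$ is the Cayley tree of order $d$ (every vertex has $d+1$ neighbours). $\Omega_0=\mathbb Z$ with $\Phi(a,b)=|a-b|^p$ in case (a); $\Omega_0=\mathbb Z_q$ with $\Phi(a,b)=u_{a,b}$, $u_{k,\ell}\ge0$, $u_{k,k}=0$, $u=\min_{k\ne\ell}u_{k,\ell}$, $U=\max u_{k,\ell}$ in case (b). For $D\subset E$, $d_D$ is the maximal number of edges of $D$ at a vertex. $\mathcal G^0(d_{\max},d,M)$: $\omega^0\in\mathbb Z^V$ with broken-edge set $D$ satisfying $d_D\le d_{\max}$ and $\max_{v\sim w}|\omega^0_v-\omega^0_w|\le M$; $\mathcal G^0_q(d_{\max},d)$: $\omega^0\in\mathbb Z_q^V$ with $d_D\le d_{\max}$. With $c_p=\min\{2^{1-p},1\}$, $d(p,M,d_{\max})=1+\lfloor c_p^{-2}+(c_p^{-1}+c_p^{-2})d_{\max}M^p\rfloor$. Gibbs measures: DLR-consistent with $\gamma_\Lambda(\omega_\Lambda\mid\tau)\propto e^{-\beta H_\Lambda(\omega_\Lambda\tau_{\Lambda^c})}$, $H_\Lambda$ containing edge terms touching $\Lambda$ and single-site terms in $\Lambda$. *)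

theory Defs
  imports "HOL-Probability.Probability"
begin

definition cayley_tree :: "nat \<Rightarrow> ('v \<Rightarrow> 'v \<Rightarrow> bool) \<Rightarrow> bool" where
  "cayley_tree d adj \<longleftrightarrow>
     (\<forall>v w. adj v w \<longrightarrow> adj w v) \<and> (\<forall>v. \<not> adj v v) \<and>
     (\<forall>v. finite {w. adj v w} \<and> card {w. adj v w} = Suc d) \<and>
     (\<forall>v w. adj\<^sup>*\<^sup>* v w) \<and>
     \<not> (\<exists>xs. 3 \<le> length xs \<and> distinct xs \<and>
            (\<forall>i. Suc i < length xs \<longrightarrow> adj (xs ! i) (xs ! Suc i)) \<and>
            adj (last xs) (hd xs))"

definition cfg_space :: "'a set \<Rightarrow> ('v \<Rightarrow> 'a) measure" where
  "cfg_space S = PiM UNIV (\<lambda>_. count_space S)"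

text \<open>H_Lambda: edge terms of all edges touching Lambda (each unordered edge appears
  as two ordered pairs, hence the factor 1/2) plus single-site terms in Lambda.\<close>
definition hamiltonian ::
  "('v \<Rightarrow> 'v \<Rightarrow> bool) \<Rightarrow> ('a \<Rightarrow> 'a \<Rightarrow> real) \<Rightarrow> ('v \<Rightarrow> 'a \<Rightarrow> real)
    \<Rightarrow> 'v set \<Rightarrow> ('v \<Rightarrow> 'a) \<Rightarrow> real" where
  "hamiltonian adj \<Phi> \<Psi> \<Lambda> \<omega> =
     (\<Sum>(v, w) \<in> {(v, w). adj v w \<and> (v \<in> \<Lambda> \<or> w \<in> \<Lambda>)}. \<Phi> (\<omega> v) (\<omega> w)) / 2
     + (\<Sum>v\<in>\<Lambda>. \<Psi> v (\<omega> v))"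

definition gibbs_spec ::
  "'a set \<Rightarrow> ('v \<Rightarrow> 'v \<Rightarrow> bool) \<Rightarrow> ('a \<Rightarrow> 'a \<Rightarrow> real) \<Rightarrow> ('v \<Rightarrow> 'a \<Rightarrow> real)
    \<Rightarrow> real \<Rightarrow> 'v set \<Rightarrow> ('v \<Rightarrow> 'a) set \<Rightarrow> ('v \<Rightarrow> 'a) \<Rightarrow> real" where
  "gibbs_spec S adj \<Phi> \<Psi> \<beta> \<Lambda> A \<tau> =
     (let C = {\<omega> \<in> space (cfg_space S). \<forall>v. v \<notin> \<Lambda> \<longrightarrow> \<omega> v = \<tau> v} in
      infsum (\<lambda>\<omega>. indicator A \<omega> * exp (- \<beta> * hamiltonian adj \<Phi> \<Psi> \<Lambda> \<omega>)) C
      / infsum (\<lambda>\<omega>. exp (- \<beta> * hamiltonian adj \<Phi> \<Psi> \<Lambda> \<omega>)) C)"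

definition is_gibbs ::
  "'a set \<Rightarrow> ('v \<Rightarrow> 'v \<Rightarrow> bool) \<Rightarrow> ('a \<Rightarrow> 'a \<Rightarrow> real) \<Rightarrow> ('v \<Rightarrow> 'a \<Rightarrow> real)
    \<Rightarrow> real \<Rightarrow> ('v \<Rightarrow> 'a) measure \<Rightarrow> bool" where
  "is_gibbs S adj \<Phi> \<Psi> \<beta> \<mu> \<longleftrightarrow>
     sets \<mu> = sets (cfg_space S) \<and> prob_space \<mu> \<and>
     (\<forall>\<Lambda>. finite \<Lambda> \<longrightarrow>
        (\<forall>A \<in> sets \<mu>. measure \<mu> A = (\<integral>\<tau>. gibbs_spec S adj \<Phi> \<Psi> \<beta> \<Lambda> A \<tau> \<partial>\<mu>)))"

definition extremal_gibbs ::
  "'a set \<Rightarrow> ('v \<Rightarrow> 'v \<Rightarrow> bool) \<Rightarrow> ('a \<Rightarrow> 'a \<Rightarrow> real) \<Rightarrow> ('v \<Rightarrow> 'a \<Rightarrow> real)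
    \<Rightarrow> real \<Rightarrow> ('v \<Rightarrow> 'a) measure \<Rightarrow> bool" where
  "extremal_gibbs S adj \<Phi> \<Psi> \<beta> \<mu> \<longleftrightarrow>
     is_gibbs S adj \<Phi> \<Psi> \<beta> \<mu> \<and>
     (\<forall>\<mu>1 \<mu>2 t. 0 < t \<and> t < 1 \<and> is_gibbs S adj \<Phi> \<Psi> \<beta> \<mu>1 \<and> is_gibbs S adj \<Phi> \<Psi> \<beta> \<mu>2 \<and>
        (\<forall>A \<in> sets \<mu>. measure \<mu> A = t * measure \<mu>1 A + (1 - t) * measure \<mu>2 A)
        \<longrightarrow> (\<forall>A \<in> sets \<mu>. measure \<mu>1 A = measure \<mu>2 A))"

definition broken_deg :: "('v \<Rightarrow> 'v \<Rightarrow> bool) \<Rightarrow> ('v \<Rightarrow> 'a) \<Rightarrow> 'v \<Rightarrow> nat" where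
  "broken_deg adj \<omega> v = card {w. adj v w \<and> \<omega> v \<noteq> \<omega> w}"

definition gs_sos :: "('v \<Rightarrow> 'v \<Rightarrow> bool) \<Rightarrow> nat \<Rightarrow> nat \<Rightarrow> ('v \<Rightarrow> int) set" where
  "gs_sos adj dmax M = {\<omega>0. (\<forall>v. broken_deg adj \<omega>0 v \<le> dmax) \<and>
                             (\<forall>v w. adj v w \<longrightarrow> \<bar>\<omega>0 v - \<omega>0 w\<bar> \<le> int M)}"

definition gs_q :: "('v \<Rightarrow> 'v \<Rightarrow> bool) \<Rightarrow> nat \<Rightarrow> nat \<Rightarrow> ('v \<Rightarrow> nat) set" where
  "gs_q adj q dmax = {\<omega>0. (\<forall>v. \<omega>0 v < q) \<and> (\<forall>v. broken_deg adj \<omega>0 v \<le> dmax)}"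

definition c_p :: "real \<Rightarrow> real" where
  "c_p p = min (2 powr (1 - p)) 1"

definition d_bound :: "real \<Rightarrow> nat \<Rightarrow> nat \<Rightarrow> int" where
  "d_bound p M dmax = 1 + \<lfloor>1 / c_p p ^ 2 + (1 / c_p p + 1 / c_p p ^ 2) * real dmax * real M powr p\<rfloor>"

end

theory Submission
  imports Defs
begin

text \<open>
  Root the tree and sum out the leaves of a finite volume with boundary condition \<open>\<omega>0\<close> one by one.
  Relative to \<open>\<omega>0\<close>, the message of a vertex stays below \<open>exp (- \<beta> R e)\<close>, where \<open>e\<close> is the excess
  energy of its spin: \<open>d\<close> incoming messages gain more than the at most \<open>dmax\<close> broken edges and the
  field cost, and this is what the assumption on \<open>d\<close> provides. Along a path, where only \<open>d - 1\<close>
  messages enter each vertex, there is still a gain, so the law of the spins on a path is dominated by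
  a product of weights concentrated at \<open>\<omega>0\<close>, uniformly in the volume. This yields concentration, and
  tightness for the infinite-volume limit \<open>\<mu>\<close>.

  For extremality, let \<open>\<mu> = t \<mu>1 + (1 - t) \<mu>2\<close>. Both \<open>\<mu>1\<close> and \<open>\<mu>2\<close> are dominated by multiples of
  \<open>\<mu>\<close>, so two independent samples of them almost surely have no infinite path on which at each vertex
  one of them differs from \<open>\<omega>0\<close>. Exchanging the two samples inside a surface on which both equal
  \<open>\<omega>0\<close> preserves their joint law, hence \<open>\<mu>1 = \<mu>2\<close>.
\<close>

section \<open>Rooted trees\<close>

text \<open>In a message, the energy of the edge is added to the bound for the sender, so
  \<open>R\<close> is chosen such that one triangle inequality handles the sum: \<open>R = 1\<close>
  for p-SOS, \<open>R = um\<close> for finite spins. For p-SOS a second triangle inequality, through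
  the ground-state edge, leaves a gain close to \<open>(c_p p)\<^sup>2\<close> per unit of excess
  and costs \<open>(1 + c_p p) * M powr p\<close> per broken edge. That \<open>d\<close> gains
  exceed \<open>R\<close> plus the cost of \<open>dmax\<close> broken edges is then exactly the
  assumption on \<open>d\<close>. In both models the gain of one edge is at most \<open>R\<close>,
  so losing one more message on a path is covered by the same assumption.

  Concentration at single sites would not give extremality: a component of a mixture is known only
  through domination by the mixture, need not be a limit of finite-volume laws with boundary
  condition \<open>\<omega>0\<close>, and there is no monotonicity to exploit. A product bound on
  whole paths survives domination up to a constant, and at low temperature it beats the number of
  paths, at most (d + 1)^n up to distance n.\<close>

locale cayley =
  fixes adj :: "'v \<Rightarrow> 'v \<Rightarrow> bool" and d :: nat
  assumes tree: "cayley_tree d adj" and d_pos: "1 \<le> d"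
begin

definition nbr :: "'v \<Rightarrow> 'v set" where "nbr v = {w. adj v w}"

definition lev :: "'v \<Rightarrow> 'v \<Rightarrow> nat" where "lev r v = (LEAST n. (adj ^^ n) r v)"

definition par :: "'v \<Rightarrow> 'v \<Rightarrow> 'v" where
  "par r v = (if v = r then r else SOME w. adj v w \<and> lev r v = Suc (lev r w))"

definition ball :: "'v \<Rightarrow> nat \<Rightarrow> 'v set" where "ball r n = {v. lev r v \<le> n}"

text \<open>Since \<open>par r r = r\<close>, the iterates past the root add nothing, and no bound
  on \<open>i\<close> is needed.\<close>

definition anc :: "'v \<Rightarrow> 'v \<Rightarrow> 'v set" where "anc r u = {(par r ^^ i) u | i. True}"

lemma adj_sym: "adj v w \<Longrightarrow> adj w v"
  using tree by (auto simp: cayley_tree_def)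

lemma adj_irrefl: "\<not> adj v v"
  using tree by (auto simp: cayley_tree_def)

lemma finite_nbr [simp]: "finite (nbr v)"
  using tree by (auto simp: cayley_tree_def nbr_def)

lemma card_nbr: "card (nbr v) = Suc d"
  using tree by (auto simp: cayley_tree_def nbr_def)

lemma mem_nbr [simp]: "w \<in> nbr v \<longleftrightarrow> adj v w"
  by (simp add: nbr_def)

lemma no_cycle:
  assumes "3 \<le> length xs" "distinct xs" "\<And>i. Suc i < length xs \<Longrightarrow> adj (xs ! i) (xs ! Suc i)"
    "adj (last xs) (hd xs)"
  shows False
  using tree assms unfolding cayley_tree_def by blast

lemma relpowp_lev: "(adj ^^ lev r v) r v"
proof -
  have "adj\<^sup>*\<^sup>* r v"
    using tree by (auto simp: cayley_tree_def)
  then obtain n where "(adj ^^ n) r v"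
    by (auto simp: rtranclp_power)
  then show ?thesis
    unfolding lev_def by (rule LeastI)
qed

lemma lev_le: "(adj ^^ n) r v \<Longrightarrow> lev r v \<le> n"
  unfolding lev_def by (rule Least_le)

lemma lev_self [simp]: "lev r r = 0"
  using lev_le[of 0 r r] by simp

lemma lev_eq_0_iff [simp]: "lev r v = 0 \<longleftrightarrow> v = r"
  using relpowp_lev[of r v] by auto

lemma lev_adj_le: "adj v w \<Longrightarrow> lev r w \<le> Suc (lev r v)"
  using relpowp_lev[of r v] by (intro lev_le) auto

lemma lower_nbr_ex: "v \<noteq> r \<Longrightarrow> \<exists>w. adj v w \<and> lev r v = Suc (lev r w)"
proof -
  assume "v \<noteq> r"
  then obtain n where n: "lev r v = Suc n"
    by (metis lev_eq_0_iff not0_implies_Suc)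
  then obtain w where w: "(adj ^^ n) r w" "adj w v"
    using relpowp_lev[of r v] by auto
  have "lev r w \<le> n"
    using w by (intro lev_le)
  moreover have "lev r v \<le> Suc (lev r w)"
    using w by (intro lev_adj_le)
  ultimately show ?thesis
    using n w adj_sym by (intro exI[of _ w]) auto
qed

text \<open>Two distinct vertices of the same level are joined below that level; closing such a path
  by an edge, or by a common upper neighbour, gives a cycle.\<close>
lemma lower_path:
  assumes "x \<noteq> y" "lev r x = n" "lev r y = n"
  shows "\<exists>xs. 3 \<le> length xs \<and> distinct xs \<and> (\<forall>i. Suc i < length xs \<longrightarrow> adj (xs ! i) (xs ! Suc i)) \<and>
     hd xs = x \<and> last xs = y \<and> (\<forall>z \<in> set xs. lev r z \<le> n)"
  using assms
proof (induction n arbitrary: x y)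
  case 0
  then show ?case by auto
next
  case (Suc n)
  then have "x \<noteq> r" "y \<noteq> r" by auto
  then obtain x' y' where x': "adj x x'" "lev r x' = n" and y': "adj y y'" "lev r y' = n"
    using lower_nbr_ex[of x r] lower_nbr_ex[of y r] Suc.prems by auto
  show ?case
  proof (cases "x' = y'")
    case True
    show ?thesis
      using x' y' True Suc.prems adj_sym[of y y']
      by (intro exI[of _ "[x, x', y]"]) (auto simp: nth_Cons split: nat.splits)
  next
    case False
    then obtain xs where xs: "3 \<le> length xs" "distinct xs"
      "\<forall>i. Suc i < length xs \<longrightarrow> adj (xs ! i) (xs ! Suc i)"
      "hd xs = x'" "last xs = y'" "\<forall>z \<in> set xs. lev r z \<le> n"
      using Suc.IH x' y' by blast
    have ne: "xs \<noteq> []" using xs(1) by auto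
    have "adj ((x # xs @ [y]) ! i) ((x # xs @ [y]) ! Suc i)" if "Suc i < length (x # xs @ [y])" for i
    proof (cases i)
      case 0
      then show ?thesis using x' xs(4) ne by (cases xs) auto
    next
      case (Suc j)
      show ?thesis
      proof (cases "Suc j < length xs")
        case True
        then show ?thesis using xs(3) Suc by (auto simp: nth_append)
      next
        case False
        then have "Suc j = length xs" using that Suc by auto
        then have "xs ! j = y'" using xs(5) ne by (metis last_conv_nth diff_Suc_1)
        then have "(xs @ [y]) ! j = y'" "(xs @ [y]) ! Suc j = y"
          using \<open>Suc j = length xs\<close> by (auto simp: nth_append)
        then show ?thesis
          using Suc adj_sym[OF y'(1)] by simp
      qed
    qed
    moreover have "distinct (x # xs @ [y])"
    proof -
      have "x \<notin> set xs" "y \<notin> set xs" using xs(6) Suc.prems by fastforce+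
      then show ?thesis using xs(2) Suc.prems(1) by auto
    qed
    moreover have "\<forall>z \<in> set (x # xs @ [y]). lev r z \<le> Suc n"
      using xs(6) Suc.prems by auto
    ultimately show ?thesis
      using xs(1) by (intro exI[of _ "x # xs @ [y]"]) auto
  qed
qed

text \<open>The edge would close the path of \<open>lower_path\<close> to a cycle. Hence the level
  changes by exactly one along every edge.\<close>

lemma lev_adj_neq: "adj x y \<Longrightarrow> lev r x \<noteq> lev r y"
proof
  assume a: "adj x y" "lev r x = lev r y"
  then have "x \<noteq> y" using adj_irrefl by auto
  then obtain xs where "3 \<le> length xs" "distinct xs"
      "\<forall>i. Suc i < length xs \<longrightarrow> adj (xs ! i) (xs ! Suc i)" "hd xs = x" "last xs = y"
    using lower_path[OF _ refl a(2)[symmetric]] by blast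
  then show False
    using no_cycle[of xs] adj_sym[OF a(1)] by blast
qed

lemma lev_adj: "adj x y \<Longrightarrow> lev r y = Suc (lev r x) \<or> lev r x = Suc (lev r y)"
  using lev_adj_le[of x y r] lev_adj_le[of y x r] lev_adj_neq[of x y r] adj_sym[of x y] by linarith

text \<open>Two lower neighbours would be joined by a path that stays below the level of
  \<open>v\<close>, and \<open>v\<close> would close it to a cycle. This makes the choice in
  \<open>par\<close> canonical.\<close>

lemma lower_nbr_unique:
  assumes "adj v x" "adj v y" "lev r v = Suc (lev r x)" "lev r v = Suc (lev r y)"
  shows "x = y"
proof (rule ccontr)
  assume "x \<noteq> y"
  then obtain xs where xs: "3 \<le> length xs" "distinct xs"
      "\<forall>i. Suc i < length xs \<longrightarrow> adj (xs ! i) (xs ! Suc i)" "hd xs = x" "last xs = y"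
      "\<forall>z \<in> set xs. lev r z \<le> lev r x"
    using lower_path[of x y r "lev r x"] assms by auto
  have ne: "xs \<noteq> []" using xs(1) by auto
  have "adj ((xs @ [v]) ! i) ((xs @ [v]) ! Suc i)" if "Suc i < length (xs @ [v])" for i
  proof (cases "Suc i < length xs")
    case True
    then show ?thesis using xs(3) by (auto simp: nth_append)
  next
    case False
    then have "Suc i = length xs" using that by auto
    then have "xs ! i = y" using xs(5) ne by (metis last_conv_nth diff_Suc_1)
    then show ?thesis
      using \<open>Suc i = length xs\<close> assms adj_sym by (auto simp: nth_append)
  qed
  moreover have "distinct (xs @ [v])"
    using xs assms by auto
  ultimately show False
    using no_cycle[of "xs @ [v]"] xs ne assms by auto
qed

lemma par_root [simp]: "par r r = r"
  by (simp add: par_def)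

lemma par:
  assumes "v \<noteq> r"
  shows "adj v (par r v)" "lev r v = Suc (lev r (par r v))"
  using someI_ex[OF lower_nbr_ex[OF assms]] assms by (auto simp: par_def)

lemma par_eqI: "adj v w \<Longrightarrow> lev r v = Suc (lev r w) \<Longrightarrow> par r v = w"
  using par[of v r] lower_nbr_unique[of v w "par r v" r] by (cases "v = r") auto

lemma adj_cases:
  assumes "adj v w"
  obtains "v \<noteq> r" "w = par r v" "lev r v = Suc (lev r w)"
    | "w \<noteq> r" "v = par r w" "lev r w = Suc (lev r v)"
proof (cases "lev r v = Suc (lev r w)")
  case True
  then have "v \<noteq> r" by auto
  then show ?thesis using True that par_eqI[OF assms True] by auto
next
  case False
  then have *: "lev r w = Suc (lev r v)" using lev_adj[OF assms, of r] by auto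
  then have "w \<noteq> r" by auto
  then show ?thesis using * that par_eqI[OF adj_sym[OF assms] *] by auto
qed

lemma lev_par: "lev r (par r v) = lev r v - 1"
  using par[of v r] by (cases "v = r") auto

lemma ex_upper_nbr: "\<exists>w. adj v w \<and> lev r w = Suc (lev r v)"
proof (rule ccontr)
  assume "\<nexists>w. adj v w \<and> lev r w = Suc (lev r v)"
  then have "nbr v \<subseteq> {par r v}"
    using adj_cases[of v _ r] by (metis insertCI mem_nbr subsetI)
  then have "card (nbr v) \<le> 1"
    by (metis card_mono card.empty card.insert empty_iff finite.emptyI finite.insertI One_nat_def)
  then show False using card_nbr[of v] d_pos by auto
qed

lemma sphere_card: "finite {v. lev r v = n} \<and> card {v. lev r v = n} \<le> Suc d ^ n"
proof (induction n)
  case 0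
  then show ?case by simp
next
  case (Suc n)
  have sub: "{v. lev r v = Suc n} \<subseteq> (\<Union>v\<in>{v. lev r v = n}. nbr v)"
  proof
    fix v assume "v \<in> {v. lev r v = Suc n}"
    then have "v \<noteq> r" "lev r v = Suc n" by auto
    then show "v \<in> (\<Union>v\<in>{v. lev r v = n}. nbr v)"
      using par[of v r] adj_sym by auto
  qed
  have fin: "finite (\<Union>v\<in>{v. lev r v = n}. nbr v)" using Suc by auto
  have "card {v. lev r v = Suc n} \<le> card (\<Union>v\<in>{v. lev r v = n}. nbr v)"
    by (intro card_mono fin sub)
  also have "\<dots> \<le> (\<Sum>v\<in>{v. lev r v = n}. card (nbr v))"
    using Suc by (intro card_UN_le) auto
  also have "\<dots> = card {v. lev r v = n} * Suc d"
    by (simp add: card_nbr)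
  also have "\<dots> \<le> Suc d ^ n * Suc d"
    using Suc by (intro mult_right_mono) auto
  finally show ?case using finite_subset[OF sub fin] by (simp add: mult.commute)
qed

lemma finite_ball [simp]: "finite (ball r n)"
proof -
  have "ball r n = (\<Union>k\<le>n. {v. lev r v = k})" by (auto simp: ball_def)
  then show ?thesis using sphere_card by auto
qed

lemma finite_subset_ball:
  assumes "finite K"
  shows "\<exists>n. K \<subseteq> ball r n"
  using assms by (intro exI[of _ "Max (lev r ` K)"]) (auto simp: ball_def)

lemma ball_mono: "m \<le> n \<Longrightarrow> ball r m \<subseteq> ball r n"
  by (auto simp: ball_def)

text \<open>A vertex of \<open>K\<close> of largest level has an upper neighbour, which is too far
  from the root to lie in \<open>K\<close>. Finite volumes can thus be dismantled so that each
  removed vertex has an edge to the fixed exterior.\<close>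

lemma ex_boundary_vertex:
  assumes "finite K" "K \<noteq> {}"
  shows "\<exists>u\<in>K. \<exists>x. adj u x \<and> x \<notin> K"
proof -
  fix r :: 'v
  have "finite (lev r ` K)" "lev r ` K \<noteq> {}" using assms by auto
  then have "Max (lev r ` K) \<in> lev r ` K" by (rule Max_in)
  then obtain u where u: "u \<in> K" "lev r u = Max (lev r ` K)" by auto
  obtain x where x: "adj u x" "lev r x = Suc (lev r u)" using ex_upper_nbr by blast
  then have "x \<notin> K"
    using u Max_ge[OF \<open>finite (lev r ` K)\<close>, of "lev r x"] by (metis Suc_n_not_le_n imageI)
  then show ?thesis using u x by auto
qed

text \<open>A walk towards the root \<open>r\<close> does not backtrack, so once it steps away from \<open>s\<close> it keeps
  doing so.\<close>
lemma par_away: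
  assumes "lev r w = n" "w \<noteq> r" "lev s (par r w) = Suc (lev s w)"
  shows "lev s (par r w) \<le> lev s r"
  using assms
proof (induction n arbitrary: w)
  case 0
  then show ?case by auto
next
  case (Suc n)
  let ?c = "par r w"
  show ?case
  proof (cases "?c = r")
    case True
    then show ?thesis by simp
  next
    case False
    have lc: "lev r ?c = n" using par[OF Suc.prems(2)] Suc.prems by simp
    have "par s ?c = w"
      using Suc.prems par[OF Suc.prems(2)] adj_sym by (intro par_eqI) auto
    moreover have "par r ?c \<noteq> w"
      using par[OF False] Suc.prems par(2)[OF Suc.prems(2)] by auto
    ultimately have "lev s (par r ?c) = Suc (lev s ?c)"
      using adj_cases[OF par(1)[OF False], of s] by metis
    then show ?thesis using Suc.IH[OF lc False] by simp
  qed
qed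

text \<open>Convexity of balls: by \<open>par_away\<close>, a step towards \<open>r\<close> either
  does not move away from \<open>s\<close> or stays within the distance of \<open>r\<close> from
  \<open>s\<close>. A ball around one vertex can therefore be summed out with the tree rooted at
  another one, which the single-site estimate needs.\<close>

lemma ball_par_closed:
  assumes "r \<in> ball s n" "w \<in> ball s n"
  shows "par r w \<in> ball s n"
proof (cases "w = r")
  case False
  show ?thesis
  proof (cases "lev s (par r w) = Suc (lev s w)")
    case True
    then show ?thesis using par_away[OF refl False True] assms by (auto simp: ball_def)
  next
    case f: False
    then have "lev s (par r w) \<le> lev s w"
      using lev_adj[OF par(1)[OF False], of s] by auto
    then show ?thesis using assms by (auto simp: ball_def)
  qed
qed (use assms in auto)

section \<open>Ancestor lines and their levels\<close>

lemma lev_par_pow: "lev r ((par r ^^ i) u) = lev r u - i"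
  by (induction i) (auto simp: lev_par)

lemma anc_self [simp]: "u \<in> anc r u"
  unfolding anc_def by (auto intro: exI[of _ 0])

lemma anc_iff: "v \<in> anc r u \<longleftrightarrow> (\<exists>i. v = (par r ^^ i) u)"
  by (auto simp: anc_def)

lemma anc_par: "v \<in> anc r u \<Longrightarrow> par r v \<in> anc r u"
  unfolding anc_iff by (metis comp_apply funpow.simps(2))

lemma anc_unfold: "anc r u = insert u (anc r (par r u))"
proof -
  have 1: "(par r ^^ i) (par r u) = (par r ^^ Suc i) u" for i
    by (simp add: funpow_swap1)
  have "v = u \<or> (\<exists>i. v = (par r ^^ Suc i) u)" if "v = (par r ^^ i) u" for v i
    using that by (cases i) (simp_all add: exI)
  then have "v \<in> anc r u \<longleftrightarrow> v \<in> insert u (anc r (par r u))" for v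
    unfolding insert_iff anc_iff 1 by (metis funpow_0)
  then show ?thesis by blast
qed

lemma anc_root: "r \<in> anc r u"
proof -
  have "lev r ((par r ^^ lev r u) u) = 0" by (simp add: lev_par_pow)
  then show ?thesis unfolding anc_iff lev_eq_0_iff by metis
qed

lemma anc_lev_le: "v \<in> anc r u \<Longrightarrow> lev r v \<le> lev r u"
  by (auto simp: anc_def lev_par_pow)

lemma anc_inj_lev: "inj_on (lev r) (anc r u)"
proof (rule inj_onI)
  fix x y assume "x \<in> anc r u" "y \<in> anc r u" "lev r x = lev r y"
  then obtain i j where ij: "x = (par r ^^ i) u" "y = (par r ^^ j) u" by (auto simp: anc_def)
  then have "lev r u - i = lev r u - j" using \<open>lev r x = lev r y\<close> by (simp add: lev_par_pow)
  then have "i = j \<or> (lev r x = 0 \<and> lev r y = 0)"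
    using ij by (auto simp: lev_par_pow simp del: lev_eq_0_iff)
  then show "x = y" using ij by auto
qed

lemma finite_anc [simp]: "finite (anc r u)"
  by (rule finite_subset[OF _ finite_ball[of r "lev r u"]]) (auto simp: ball_def dest: anc_lev_le)

lemma anc_lev_image: "lev r ` anc r u = {..lev r u}"
proof -
  have "k \<in> lev r ` anc r u" if "k \<le> lev r u" for k
  proof -
    have "lev r ((par r ^^ (lev r u - k)) u) = k" using that by (simp add: lev_par_pow)
    then show ?thesis using anc_iff by (metis image_eqI)
  qed
  then show ?thesis using anc_lev_le by auto
qed

text \<open>Neighbours of \<open>v\<close> lie one level above or below it, and \<open>B\<close> has
  at most one vertex on each level. This is the origin of the number 2 in the assumption
  \<open>chain\<close> below.\<close>

lemma card_nbr_chain: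
  assumes "inj_on (lev r) B"
  shows "card (nbr v \<inter> B) \<le> 2"
proof -
  have "lev r ` (nbr v \<inter> B) \<subseteq> {lev r v - 1, Suc (lev r v)}"
    using lev_adj[of v _ r] by fastforce
  then have "card (lev r ` (nbr v \<inter> B)) \<le> card {lev r v - 1, Suc (lev r v)}"
    by (intro card_mono) auto
  moreover have "card (lev r ` (nbr v \<inter> B)) = card (nbr v \<inter> B)"
    by (intro card_image inj_on_subset[OF assms]) auto
  ultimately show ?thesis by (simp add: card_insert_if split: if_splits)
qed

text \<open>Every edge is \<open>{w, par r w}\<close> for a unique \<open>w \<noteq> r\<close>.\<close>
lemma adj_pairs_eq:
  assumes "\<And>v w. P v w \<longleftrightarrow> P w v"
  shows "{(v, w). adj v w \<and> P v w} =
    (\<lambda>w. (w, par r w)) ` {w. w \<noteq> r \<and> P w (par r w)} \<union>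
    (\<lambda>w. (par r w, w)) ` {w. w \<noteq> r \<and> P w (par r w)}" (is "?L = ?A \<union> ?B")
    "(\<lambda>w. (w, par r w)) ` {w. w \<noteq> r \<and> P w (par r w)} \<inter>
    (\<lambda>w. (par r w, w)) ` {w. w \<noteq> r \<and> P w (par r w)} = {}"
proof -
  show "?L = ?A \<union> ?B"
  proof (intro set_eqI iffI)
    fix e assume "e \<in> ?L"
    then obtain v w where e: "e = (v, w)" "adj v w" "P v w" by auto
    from e(2) show "e \<in> ?A \<union> ?B"
      by (rule adj_cases[of _ _ r]) (use e(1,3) assms[of v w] in blast)+
  next
    fix e assume "e \<in> ?A \<union> ?B"
    then obtain w where w: "w \<noteq> r" "P w (par r w)" "e = (w, par r w) \<or> e = (par r w, w)"
      by blast
    then show "e \<in> ?L" using par(1)[OF w(1)] adj_sym[OF par(1)[OF w(1)]] assms by blast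
  qed
  show "?A \<inter> ?B = {}"
  proof (rule ccontr)
    assume "?A \<inter> ?B \<noteq> {}"
    then obtain e where e: "e \<in> ?A" "e \<in> ?B" by blast
    from e(1) obtain v where v: "v \<noteq> r" "e = (v, par r v)" by blast
    from e(2) obtain w where w: "w \<noteq> r" "e = (par r w, w)" by blast
    have vw: "v \<noteq> r" "w \<noteq> r" "v = par r w" "w = par r v"
      using v w by (metis Pair_inject)+
    have "lev r v = Suc (lev r w)" by (subst vw(4)) (rule par(2)[OF vw(1)])
    moreover have "lev r w = Suc (lev r v)" by (subst vw(3)) (rule par(2)[OF vw(2)])
    ultimately show False by simp
  qed
qed

end

section \<open>Finite-volume Gibbs distributions\<close>

text \<open>The kernel is defined through \<open>infsum\<close>, while all sums below are
  nonnegative integrals over counting measures, where rearrangements are free. Finiteness is the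
  bridge between the two.\<close>

lemma infsum_eq_nn_integral:
  fixes f :: "'b \<Rightarrow> real"
  assumes "\<And>x. x \<in> A \<Longrightarrow> 0 \<le> f x" "(\<integral>\<^sup>+x. ennreal (f x) \<partial>count_space A) < \<infinity>"
  shows "infsum f A = enn2real (\<integral>\<^sup>+x. ennreal (f x) \<partial>count_space A)"
proof -
  have "integrable (count_space A) f"
    using assms by (intro integrableI_nonneg) (auto simp: AE_count_space)
  then have "infsum f A = integral\<^sup>L (count_space A) f"
    using infsetsum_infsum[of f A] by (simp add: abs_summable_on_def infsetsum_def)
  also have "\<dots> = enn2real (\<integral>\<^sup>+x. ennreal (f x) \<partial>count_space A)"
    using assms by (intro integral_eq_nn_integral) (auto simp: AE_count_space)
  finally show ?thesis .
qed

text \<open>Configurations form an uncountable type, on which counting measure is not sigma-finite.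
  The exchange goes through counting measure on pairs instead of a product measure.\<close>

lemma nn_integral_count_space_swap:
  "(\<integral>\<^sup>+x. \<integral>\<^sup>+y. f x y \<partial>count_space UNIV \<partial>count_space UNIV) =
   (\<integral>\<^sup>+y. \<integral>\<^sup>+x. f x y \<partial>count_space UNIV \<partial>count_space UNIV)"
  using nn_integral_fst_count_space[of "\<lambda>(x, y). f x y"] nn_integral_snd_count_space[of "\<lambda>(x, y). f x y"]
  by simp

lemma nn_integral_count_space_mem_le:
  assumes "x \<in> A"
  shows "f x \<le> (\<integral>\<^sup>+y. f y \<partial>count_space A)"
proof -
  have "f x = (\<integral>\<^sup>+y. f x * indicator {x} y \<partial>count_space A)"
    using assms by (simp add: nn_integral_cmult_indicator)
  also have "\<dots> \<le> (\<integral>\<^sup>+y. f y \<partial>count_space A)"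
    by (intro nn_integral_mono) (auto split: split_indicator)
  finally show ?thesis .
qed

section \<open>Configurations with prescribed exterior\<close>

definition cfgs :: "'a set \<Rightarrow> 'v set \<Rightarrow> ('v \<Rightarrow> 'a) \<Rightarrow> ('v \<Rightarrow> 'a) set" where
  "cfgs S K \<tau> = {\<omega>. (\<forall>v\<in>K. \<omega> v \<in> S) \<and> (\<forall>v. v \<notin> K \<longrightarrow> \<omega> v = \<tau> v)}"

lemma cfgs_empty [simp]: "cfgs S {} \<tau> = {\<tau>}"
  by (auto simp: cfgs_def)

lemma cfgs_single: "cfgs S {w} \<tau> = (\<lambda>b. \<tau>(w := b)) ` S"
proof (intro set_eqI iffI)
  fix \<omega> assume "\<omega> \<in> cfgs S {w} \<tau>"
  then have "\<omega> = \<tau>(w := \<omega> w)" "\<omega> w \<in> S" by (auto simp: cfgs_def)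
  then show "\<omega> \<in> (\<lambda>b. \<tau>(w := b)) ` S" by blast
qed (auto simp: cfgs_def)

lemma cfgs_Un:
  assumes "K \<inter> L = {}"
  shows "\<eta> \<in> cfgs S (K \<union> L) \<tau> \<longleftrightarrow>
    (\<lambda>v. if v \<in> L then \<tau> v else \<eta> v) \<in> cfgs S K \<tau> \<and> \<eta> \<in> cfgs S L (\<lambda>v. if v \<in> L then \<tau> v else \<eta> v)"
  using assms by (auto simp: cfgs_def)

lemma cfgs_Un_unique:
  assumes "K \<inter> L = {}" "\<omega> \<in> cfgs S K \<tau>" "\<eta> \<in> cfgs S L \<omega>"
  shows "\<omega> = (\<lambda>v. if v \<in> L then \<tau> v else \<eta> v)"
  using assms by (fastforce simp: cfgs_def)

text \<open>Each \<open>\<eta>\<close> arises from exactly one intermediate configuration, namely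
  \<open>\<eta>\<close> reset to \<open>\<tau>\<close> on \<open>L\<close>. After the exchange of
  the two sums, the sum over \<open>\<omega>\<close> therefore has a single nonzero term.\<close>

lemma nn_integral_cfgs_Un:
  assumes "K \<inter> L = {}"
  shows "(\<integral>\<^sup>+\<eta>. f \<eta> \<partial>count_space (cfgs S (K \<union> L) \<tau>)) =
    (\<integral>\<^sup>+\<omega>. (\<integral>\<^sup>+\<eta>. f \<eta> \<partial>count_space (cfgs S L \<omega>)) \<partial>count_space (cfgs S K \<tau>))"
proof -
  let ?p = "\<lambda>\<eta> v. if v \<in> L then \<tau> v else \<eta> v"
  have eq: "indicator (cfgs S K \<tau>) \<omega> * indicator (cfgs S L \<omega>) \<eta> =
      (indicator (cfgs S (K \<union> L) \<tau>) \<eta> * indicator {?p \<eta>} \<omega> :: ennreal)" for \<omega> \<eta>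
  proof -
    have "(\<omega> \<in> cfgs S K \<tau> \<and> \<eta> \<in> cfgs S L \<omega>) = (\<eta> \<in> cfgs S (K \<union> L) \<tau> \<and> \<omega> = ?p \<eta>)"
      unfolding cfgs_Un[OF assms] using cfgs_Un_unique[OF assms, of \<omega> S \<tau> \<eta>] by blast
    then show ?thesis unfolding indicator_def by auto
  qed
  have "(\<integral>\<^sup>+\<omega>. (\<integral>\<^sup>+\<eta>. f \<eta> \<partial>count_space (cfgs S L \<omega>)) \<partial>count_space (cfgs S K \<tau>)) =
     (\<integral>\<^sup>+\<omega>. (\<integral>\<^sup>+\<eta>. f \<eta> * (indicator (cfgs S K \<tau>) \<omega> * indicator (cfgs S L \<omega>) \<eta>) \<partial>count_space UNIV) \<partial>count_space UNIV)"
  proof -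
    have "(\<integral>\<^sup>+\<eta>. f \<eta> \<partial>count_space (cfgs S L \<omega>)) * indicator (cfgs S K \<tau>) \<omega> =
       (\<integral>\<^sup>+\<eta>. f \<eta> * (indicator (cfgs S K \<tau>) \<omega> * indicator (cfgs S L \<omega>) \<eta>) \<partial>count_space UNIV)" for \<omega>
      unfolding nn_integral_count_space_indicator[of "cfgs S L \<omega>", unfolded NO_MATCH_def, OF TrueI]
      by (subst nn_integral_multc[symmetric]) (auto intro!: nn_integral_cong simp: mult_ac)
    then show ?thesis
      by (subst nn_integral_count_space_indicator) simp_all
  qed
  also have "\<dots> = (\<integral>\<^sup>+\<omega>. (\<integral>\<^sup>+\<eta>. f \<eta> * indicator (cfgs S (K \<union> L) \<tau>) \<eta> * indicator {?p \<eta>} \<omega> \<partial>count_space UNIV) \<partial>count_space UNIV)"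
    by (simp only: eq mult.assoc)
  also have "\<dots> = (\<integral>\<^sup>+\<eta>. (\<integral>\<^sup>+\<omega>. f \<eta> * indicator (cfgs S (K \<union> L) \<tau>) \<eta> * indicator {?p \<eta>} \<omega> \<partial>count_space UNIV) \<partial>count_space UNIV)"
    by (rule nn_integral_count_space_swap)
  also have "\<dots> = (\<integral>\<^sup>+\<eta>. f \<eta> * indicator (cfgs S (K \<union> L) \<tau>) \<eta> \<partial>count_space UNIV)"
    by (simp add: nn_integral_cmult)
  finally show ?thesis
    by (simp add: nn_integral_count_space_indicator)
qed

lemma nn_integral_cfgs_single:
  "(\<integral>\<^sup>+\<eta>. f \<eta> \<partial>count_space (cfgs S {w} \<tau>)) = (\<integral>\<^sup>+b. f (\<tau>(w := b)) \<partial>count_space S)"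
proof -
  have "inj_on (\<lambda>b. \<tau>(w := b)) S"
    by (auto simp: inj_on_def dest: fun_upd_eqD)
  then have "bij_betw (\<lambda>b. \<tau>(w := b)) S (cfgs S {w} \<tau>)"
    by (simp add: cfgs_single bij_betw_def)
  then show ?thesis by (rule nn_integral_bij_count_space[symmetric])
qed

lemma nn_integral_cfgs_insert:
  assumes "w \<notin> K"
  shows "(\<integral>\<^sup>+\<eta>. f \<eta> \<partial>count_space (cfgs S (insert w K) \<tau>)) =
    (\<integral>\<^sup>+\<omega>. (\<integral>\<^sup>+b. f ((fun_upd \<omega> w b)) \<partial>count_space S) \<partial>count_space (cfgs S K \<tau>))"
  using nn_integral_cfgs_Un[of K "{w}" S \<tau> f] assms by (simp add: nn_integral_cfgs_single)

lemma nn_integral_cfgs_insert':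
  assumes "w \<notin> K"
  shows "(\<integral>\<^sup>+\<eta>. f \<eta> \<partial>count_space (cfgs S (insert w K) \<tau>)) =
    (\<integral>\<^sup>+b. (\<integral>\<^sup>+\<eta>. f \<eta> \<partial>count_space (cfgs S K (\<tau>(w := b)))) \<partial>count_space S)"
  using nn_integral_cfgs_Un[of "{w}" K S \<tau> f] assms by (simp add: nn_integral_cfgs_single)

lemma nn_integral_cfgs_prod:
  fixes f :: "'v \<Rightarrow> 'a \<Rightarrow> ennreal"
  assumes "finite B"
  shows "(\<integral>\<^sup>+\<alpha>. (\<Prod>v\<in>B. f v (\<alpha> v)) \<partial>count_space (cfgs S B \<tau>)) = (\<Prod>v\<in>B. \<integral>\<^sup>+b. f v b \<partial>count_space S)"
  using assms
proof (induction B)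
  case empty
  then show ?case by (simp add: nn_integral_count_space_finite)
next
  case (insert w B)
  have "(\<Prod>v\<in>insert w B. f v ((\<alpha>(w := b)) v)) = f w b * (\<Prod>v\<in>B. f v (\<alpha> v))" for \<alpha> b
    using insert by (auto intro!: prod.cong arg_cong2[where f = "(*)"])
  then show ?case
    using insert by (simp add: nn_integral_cfgs_insert nn_integral_multc nn_integral_cmult)
qed

lemma countable_cfgs:
  assumes "countable S" "finite K"
  shows "countable (cfgs S K \<tau>)"
  using assms(2)
proof (induction K)
  case (insert w K)
  have "cfgs S (insert w K) \<tau> \<subseteq> (\<lambda>(\<omega>, b). (fun_upd \<omega> w b)) ` (cfgs S K \<tau> \<times> S)"
  proof
    fix \<eta> assume "\<eta> \<in> cfgs S (insert w K) \<tau>"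
    then show "\<eta> \<in> (\<lambda>(\<omega>, b). (fun_upd \<omega> w b)) ` (cfgs S K \<tau> \<times> S)"
      using insert by (intro image_eqI[of _ _ "(\<eta>(w := \<tau> w), \<eta> w)"]) (auto simp: cfgs_def)
  qed
  then show ?case
    using insert assms(1) by (meson countable_SIGMA countable_image countable_subset)
qed simp

text \<open>\<open>\<Phi>\<close> need not be symmetric, but \<open>hamiltonian\<close> runs over
  ordered pairs with a factor 1/2, so an edge enters through the mean of its two values. The bound
  \<open>one_site_bound\<close> is uniform in the neighbouring spin \<open>c\<close>: a single edge
  to a fixed vertex tames the sum over a spin, which keeps partition functions finite on an infinite
  spin space.\<close>

locale spin = cayley adj d for adj :: "'v \<Rightarrow> 'v \<Rightarrow> bool" and d +
  fixes S :: "'a set" and \<Phi> :: "'a \<Rightarrow> 'a \<Rightarrow> real" and \<Psi> :: "'v \<Rightarrow> 'a \<Rightarrow> real" and \<beta> :: real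
  assumes countable_S: "countable S"
    and \<Phi>_nonneg: "\<And>a b. a \<in> S \<Longrightarrow> b \<in> S \<Longrightarrow> 0 \<le> \<Phi> a b"
    and \<beta>_nonneg: "0 \<le> \<beta>"
    and one_site_bound: "\<And>u. \<exists>K<\<infinity>. \<forall>c\<in>S.
      (\<integral>\<^sup>+b. ennreal (exp (- \<beta> * ((\<Phi> b c + \<Phi> c b) / 2)) * exp (- \<beta> * \<Psi> u b)) \<partial>count_space S) \<le> K"
begin

definition Om :: "('v \<Rightarrow> 'a) set" where "Om = {\<omega>. \<forall>v. \<omega> v \<in> S}"

definition Q :: "'a \<Rightarrow> 'a \<Rightarrow> real" where "Q a b = exp (- \<beta> * ((\<Phi> a b + \<Phi> b a) / 2))"

definition psi :: "'v \<Rightarrow> 'a \<Rightarrow> real" where "psi v a = exp (- \<beta> * \<Psi> v a)"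

abbreviation H :: "'v set \<Rightarrow> ('v \<Rightarrow> 'a) \<Rightarrow> real" where "H \<equiv> hamiltonian adj \<Phi> \<Psi>"

definition wt :: "'v set \<Rightarrow> ('v \<Rightarrow> 'a) \<Rightarrow> real" where "wt \<Lambda> \<omega> = exp (- \<beta> * H \<Lambda> \<omega>)"

definition clos :: "'v set \<Rightarrow> 'v set" where "clos \<Lambda> = \<Lambda> \<union> (\<Union>v\<in>\<Lambda>. nbr v)"

definition prs :: "'v set \<Rightarrow> ('v \<times> 'v) set" where
  "prs \<Lambda> = {(v, w). adj v w \<and> (v \<in> \<Lambda> \<or> w \<in> \<Lambda>)}"

lemma finite_clos [simp]: "finite \<Lambda> \<Longrightarrow> finite (clos \<Lambda>)"
  by (auto simp: clos_def)

lemma prs_subset: "prs \<Lambda> \<subseteq> clos \<Lambda> \<times> clos \<Lambda>"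
  using adj_sym by (auto simp: prs_def clos_def)

lemma finite_prs [simp]: "finite \<Lambda> \<Longrightarrow> finite (prs \<Lambda>)"
  using finite_subset[OF prs_subset] by auto

lemma H_eq: "H \<Lambda> \<omega> = (\<Sum>(v, w)\<in>prs \<Lambda>. \<Phi> (\<omega> v) (\<omega> w)) / 2 + (\<Sum>v\<in>\<Lambda>. \<Psi> v (\<omega> v))"
  by (simp add: hamiltonian_def prs_def)

lemma wt_pos [simp]: "0 < wt \<Lambda> \<omega>" and wt_nonneg [simp]: "0 \<le> wt \<Lambda> \<omega>"
  by (simp_all add: wt_def)

lemma Q_pos [simp]: "0 < Q a b" and Q_nonneg [simp]: "0 \<le> Q a b"
  by (simp_all add: Q_def)

lemma psi_pos [simp]: "0 < psi v a" and psi_nonneg [simp]: "0 \<le> psi v a" and psi_neq_0 [simp]: "psi v a \<noteq> 0"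
  by (simp_all add: psi_def)

lemma Q_sym: "Q a b = Q b a"
  by (simp add: Q_def add.commute)

lemma Q_le_1: "a \<in> S \<Longrightarrow> b \<in> S \<Longrightarrow> Q a b \<le> 1"
  using \<Phi>_nonneg[of a b] \<Phi>_nonneg[of b a] \<beta>_nonneg by (simp add: Q_def)

lemma Om_mem: "\<omega> \<in> Om \<Longrightarrow> \<omega> v \<in> S"
  by (simp add: Om_def)

lemma cfgs_Om: "\<tau> \<in> Om \<Longrightarrow> cfgs S K \<tau> \<subseteq> Om"
  unfolding cfgs_def Om_def by (auto 0 3)

lemma cfgs_eq: "\<tau> \<in> Om \<Longrightarrow> cfgs S K \<tau> = {\<omega> \<in> Om. \<forall>v. v \<notin> K \<longrightarrow> \<omega> v = \<tau> v}"
  using cfgs_Om[of \<tau> K] by (auto simp: cfgs_def Om_def)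

lemma space_cfg [simp]: "space (cfg_space S :: ('v \<Rightarrow> 'a) measure) = Om"
  by (auto simp: cfg_space_def space_PiM Om_def PiE_def Pi_def)

lemma H_local: "(\<And>v. v \<in> clos \<Lambda> \<Longrightarrow> \<omega> v = \<omega>' v) \<Longrightarrow> H \<Lambda> \<omega> = H \<Lambda> \<omega>'"
  unfolding H_eq using prs_subset[of \<Lambda>]
  by (intro arg_cong2[where f = "(+)"] arg_cong2[where f = "(/)"] sum.cong refl)
    (fastforce, simp add: clos_def)

lemma wt_local: "(\<And>v. v \<in> clos \<Lambda> \<Longrightarrow> \<omega> v = \<omega>' v) \<Longrightarrow> wt \<Lambda> \<omega> = wt \<Lambda> \<omega>'"
  using H_local[of \<Lambda> \<omega> \<omega>'] by (simp add: wt_def)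

lemma H_diff:
  assumes "finite \<Lambda>" "G \<subseteq> \<Lambda>" "\<And>v. v \<notin> G \<Longrightarrow> \<omega> v = \<omega>' v"
  shows "H \<Lambda> \<omega> - H G \<omega> = H \<Lambda> \<omega>' - H G \<omega>'"
proof -
  have sub: "prs G \<subseteq> prs \<Lambda>" using assms(2) by (auto simp: prs_def)
  have *: "H \<Lambda> \<eta> - H G \<eta> = (\<Sum>(v, w)\<in>prs \<Lambda> - prs G. \<Phi> (\<eta> v) (\<eta> w)) / 2 + (\<Sum>v\<in>\<Lambda> - G. \<Psi> v (\<eta> v))" for \<eta>
    unfolding H_eq using assms(1,2) sub
    by (simp add: sum_diff finite_subset[OF assms(2)] diff_divide_distrib)
  show ?thesis
    unfolding * using assms(3) by (intro arg_cong2[where f = "(+)"] arg_cong2[where f = "(/)"] sum.cong refl)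
      (clarsimp simp: prs_def, metis, simp)
qed

text \<open>The terms of \<open>H \<Lambda>\<close> that do not touch \<open>G\<close> agree for the
  two configurations, so the ratios of their weights coincide. This is why the kernels of nested
  volumes are consistent.\<close>

lemma wt_ratio:
  assumes "finite \<Lambda>" "G \<subseteq> \<Lambda>" "\<And>v. v \<notin> G \<Longrightarrow> \<omega> v = \<omega>' v"
  shows "wt \<Lambda> \<omega> * wt G \<omega>' = wt \<Lambda> \<omega>' * wt G \<omega>"
proof -
  have "H \<Lambda> \<omega> + H G \<omega>' = H \<Lambda> \<omega>' + H G \<omega>" using H_diff[of \<Lambda> G \<omega> \<omega>'] assms by simp
  then have "exp (- \<beta> * (H \<Lambda> \<omega> + H G \<omega>')) = exp (- \<beta> * (H \<Lambda> \<omega>' + H G \<omega>))" by (simp only:)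
  then show ?thesis by (simp add: wt_def exp_add[symmetric] algebra_simps)
qed

definition Zn :: "'v set \<Rightarrow> ('v \<Rightarrow> 'a) \<Rightarrow> ennreal" where
  "Zn \<Lambda> \<tau> = (\<integral>\<^sup>+\<omega>. ennreal (wt \<Lambda> \<omega>) \<partial>count_space (cfgs S \<Lambda> \<tau>))"

text \<open>Of the new edges at \<open>u\<close>, only the one to the exterior vertex
  \<open>x\<close> is kept; the others have nonnegative energy and are dropped. What remains is a
  factor for the spin at \<open>u\<close> alone, once the spin at \<open>x\<close> is fixed.\<close>

lemma wt_insert_le:
  assumes "finite \<Lambda>" "u \<notin> \<Lambda>" "adj u x" "x \<notin> insert u \<Lambda>" "\<omega> \<in> Om"
  shows "wt (insert u \<Lambda>) \<omega> \<le> wt \<Lambda> \<omega> * (Q (\<omega> u) (\<omega> x) * psi u (\<omega> u))"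
proof -
  have ux: "u \<noteq> x" using assms(4) by auto
  have "(\<Sum>(v, w)\<in>prs \<Lambda> \<union> {(u, x), (x, u)}. \<Phi> (\<omega> v) (\<omega> w)) =
      (\<Sum>(v, w)\<in>prs \<Lambda>. \<Phi> (\<omega> v) (\<omega> w)) + (\<Phi> (\<omega> u) (\<omega> x) + \<Phi> (\<omega> x) (\<omega> u))"
    using assms ux finite_prs[OF assms(1)] by (subst sum.union_disjoint) (simp_all, auto simp: prs_def)
  moreover have "(\<Sum>(v, w)\<in>prs \<Lambda> \<union> {(u, x), (x, u)}. \<Phi> (\<omega> v) (\<omega> w)) \<le> (\<Sum>(v, w)\<in>prs (insert u \<Lambda>). \<Phi> (\<omega> v) (\<omega> w))"
    using assms(1,3,5) adj_sym
    by (intro sum_mono2) (simp, auto simp: prs_def intro!: \<Phi>_nonneg Om_mem)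
  ultimately have "H \<Lambda> \<omega> + (\<Phi> (\<omega> u) (\<omega> x) + \<Phi> (\<omega> x) (\<omega> u)) / 2 + \<Psi> u (\<omega> u) \<le> H (insert u \<Lambda>) \<omega>"
    using assms(1,2) unfolding H_eq sum.insert[OF assms(1,2)] by argo
  then have "- \<beta> * H (insert u \<Lambda>) \<omega> \<le> - \<beta> * (H \<Lambda> \<omega> + (\<Phi> (\<omega> u) (\<omega> x) + \<Phi> (\<omega> x) (\<omega> u)) / 2 + \<Psi> u (\<omega> u))"
    using \<beta>_nonneg by (intro mult_left_mono_neg) auto
  then show ?thesis
    by (simp add: wt_def Q_def psi_def mult_exp_exp algebra_simps)
qed

text \<open>The bound has to be uniform in \<open>\<tau>\<close>, because in the induction the spin
  of the removed vertex \<open>u\<close> becomes part of the boundary condition of the smaller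
  volume.\<close>

lemma Zn_bounded:
  assumes "finite \<Lambda>"
  shows "\<exists>K<\<infinity>. \<forall>\<tau>\<in>Om. Zn \<Lambda> \<tau> \<le> K"
  using assms
proof (induction "card \<Lambda>" arbitrary: \<Lambda>)
  case 0
  then show ?case by (intro exI[of _ 1]) (auto simp: Zn_def nn_integral_count_space_finite wt_def H_eq prs_def)
next
  case (Suc n)
  then have "\<Lambda> \<noteq> {}" by auto
  then obtain u x where ux: "u \<in> \<Lambda>" "adj u x" "x \<notin> \<Lambda>"
    using ex_boundary_vertex[OF Suc.prems] by blast
  define L where "L = \<Lambda> - {u}"
  have L: "\<Lambda> = insert u L" "u \<notin> L" "finite L" "card L = n"
    using ux Suc by (auto simp: L_def)
  obtain K where K: "K < \<infinity>" "\<And>\<tau>. \<tau> \<in> Om \<Longrightarrow> Zn L \<tau> \<le> K"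
    using Suc.hyps(1)[of L] L by auto
  obtain K1 where K1: "K1 < \<infinity>" "\<And>c. c \<in> S \<Longrightarrow> (\<integral>\<^sup>+b. ennreal (Q b c * psi u b) \<partial>count_space S) \<le> K1"
    using one_site_bound[of u] by (auto simp: Q_def psi_def)
  have "Zn \<Lambda> \<tau> \<le> K * K1" if \<tau>: "\<tau> \<in> Om" for \<tau>
  proof -
    have "Zn \<Lambda> \<tau> = (\<integral>\<^sup>+b. (\<integral>\<^sup>+\<eta>. ennreal (wt \<Lambda> \<eta>) \<partial>count_space (cfgs S L (\<tau>(u := b)))) \<partial>count_space S)"
      unfolding Zn_def L(1) by (rule nn_integral_cfgs_insert'[OF L(2)])
    also have "\<dots> \<le> (\<integral>\<^sup>+b. K * ennreal (Q b (\<tau> x) * psi u b) \<partial>count_space S)"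
    proof (intro nn_integral_mono)
      fix b assume "b \<in> space (count_space S)"
      then have b: "\<tau>(u := b) \<in> Om" using \<tau> by (auto simp: Om_def)
      have "(\<integral>\<^sup>+\<eta>. ennreal (wt \<Lambda> \<eta>) \<partial>count_space (cfgs S L (\<tau>(u := b)))) \<le>
         (\<integral>\<^sup>+\<eta>. ennreal (wt L \<eta>) * ennreal (Q b (\<tau> x) * psi u b) \<partial>count_space (cfgs S L (\<tau>(u := b))))"
      proof (intro nn_integral_mono)
        fix \<eta> assume \<eta>: "\<eta> \<in> space (count_space (cfgs S L (\<tau>(u := b))))"
        then have "\<eta> \<in> Om" using cfgs_Om[OF b] by auto
        moreover have "\<eta> u = b" "\<eta> x = \<tau> x" using \<eta> L ux by (auto simp: cfgs_def)
        ultimately show "ennreal (wt \<Lambda> \<eta>) \<le> ennreal (wt L \<eta>) * ennreal (Q b (\<tau> x) * psi u b)"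
          using wt_insert_le[OF L(3,2) ux(2), of \<eta>] L(1) ux(3)
          by (simp add: ennreal_mult'[symmetric] ennreal_leI)
      qed
      also have "\<dots> = Zn L (\<tau>(u := b)) * ennreal (Q b (\<tau> x) * psi u b)"
        by (simp add: nn_integral_multc Zn_def)
      also have "\<dots> \<le> K * ennreal (Q b (\<tau> x) * psi u b)"
        using K(2)[OF b] by (intro mult_right_mono) auto
      finally show "(\<integral>\<^sup>+\<eta>. ennreal (wt \<Lambda> \<eta>) \<partial>count_space (cfgs S L (\<tau>(u := b)))) \<le> K * ennreal (Q b (\<tau> x) * psi u b)" .
    qed
    also have "\<dots> \<le> K * K1"
      using K1(2)[OF Om_mem[OF \<tau>]] by (simp add: nn_integral_cmult mult_left_mono)
    finally show ?thesis .
  qed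
  moreover have "K * K1 < \<infinity>" using K K1 by (simp add: ennreal_mult_less_top)
  ultimately show ?case by blast
qed

lemma Zn_finite: "finite \<Lambda> \<Longrightarrow> \<tau> \<in> Om \<Longrightarrow> Zn \<Lambda> \<tau> < \<infinity>"
  using Zn_bounded[of \<Lambda>] le_less_trans by blast

lemma mem_cfgs_self: "\<tau> \<in> Om \<Longrightarrow> \<tau> \<in> cfgs S \<Lambda> \<tau>"
  by (auto simp: cfgs_def Om_def)

lemma Zn_pos: "\<tau> \<in> Om \<Longrightarrow> 0 < Zn \<Lambda> \<tau>"
  using nn_integral_count_space_mem_le[OF mem_cfgs_self, of \<tau> "\<lambda>\<omega>. ennreal (wt \<Lambda> \<omega>)" \<Lambda>] wt_pos[of \<Lambda> \<tau>]
  unfolding Zn_def by (metis ennreal_less_zero_iff less_le_trans)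

definition Z :: "'v set \<Rightarrow> ('v \<Rightarrow> 'a) \<Rightarrow> real" where "Z \<Lambda> \<tau> = enn2real (Zn \<Lambda> \<tau>)"

lemma ennreal_Z: "finite \<Lambda> \<Longrightarrow> \<tau> \<in> Om \<Longrightarrow> ennreal (Z \<Lambda> \<tau>) = Zn \<Lambda> \<tau>"
  using Zn_finite[of \<Lambda> \<tau>] by (simp add: Z_def)

lemma Z_pos: "finite \<Lambda> \<Longrightarrow> \<tau> \<in> Om \<Longrightarrow> 0 < Z \<Lambda> \<tau>"
  using Zn_finite[of \<Lambda> \<tau>] Zn_pos[of \<tau> \<Lambda>] by (simp add: Z_def enn2real_positive_iff)

lemma Zn_local:
  assumes "\<And>v. v \<in> clos \<Lambda> - \<Lambda> \<Longrightarrow> \<tau> v = \<tau>' v"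
  shows "Zn \<Lambda> \<tau> = Zn \<Lambda> \<tau>'"
proof -
  let ?g = "\<lambda>\<omega> v. if v \<in> \<Lambda> then \<omega> v else \<tau>' v"
  have bij: "bij_betw ?g (cfgs S \<Lambda> \<tau>) (cfgs S \<Lambda> \<tau>')"
    by (rule bij_betw_byWitness[where f' = "\<lambda>\<omega> v. if v \<in> \<Lambda> then \<omega> v else \<tau> v"]) (auto simp: cfgs_def)
  have "Zn \<Lambda> \<tau> = (\<integral>\<^sup>+\<omega>. ennreal (wt \<Lambda> (?g \<omega>)) \<partial>count_space (cfgs S \<Lambda> \<tau>))"
    unfolding Zn_def
  proof (intro nn_integral_cong arg_cong[where f = ennreal] wt_local)
    fix \<omega> v assume "\<omega> \<in> space (count_space (cfgs S \<Lambda> \<tau>))" "v \<in> clos \<Lambda>"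
    then show "\<omega> v = (if v \<in> \<Lambda> then \<omega> v else \<tau>' v)" using assms[of v] by (auto simp: cfgs_def)
  qed
  also have "\<dots> = Zn \<Lambda> \<tau>'"
    unfolding Zn_def by (rule nn_integral_bij_count_space[OF bij])
  finally show ?thesis .
qed

text \<open>The conditional probability of \<open>a\<close> on \<open>G\<close> given \<open>a\<close> off \<open>G\<close>.\<close>
definition cond :: "'v set \<Rightarrow> ('v \<Rightarrow> 'a) \<Rightarrow> real" where "cond G a = wt G a / Z G a"

lemma cond_nonneg: "0 \<le> cond G a"
  by (simp add: cond_def Z_def)

lemma cond_local: "(\<And>v. v \<in> clos G \<Longrightarrow> a v = a' v) \<Longrightarrow> cond G a = cond G a'"
  using wt_local[of G a a'] Zn_local[of G a a'] by (simp add: cond_def Z_def)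

text \<open>A finite volume with countably many spin values has countably many configurations for a
  given exterior. A \<open>pmf\<close> assigns a probability to every set of configurations, so
  measurability plays no part in finite volume.\<close>

definition gam :: "'v set \<Rightarrow> ('v \<Rightarrow> 'a) \<Rightarrow> ('v \<Rightarrow> 'a) pmf" where
  "gam \<Lambda> \<tau> = embed_pmf (\<lambda>\<omega>. if \<omega> \<in> cfgs S \<Lambda> \<tau> then wt \<Lambda> \<omega> / Z \<Lambda> \<tau> else 0)"

lemma nn_integral_wt_div:
  assumes "finite \<Lambda>" "\<tau> \<in> Om" "X \<subseteq> cfgs S \<Lambda> \<tau>"
  shows "(\<integral>\<^sup>+\<omega>. ennreal (wt \<Lambda> \<omega> / Z \<Lambda> \<tau>) \<partial>count_space X) =
    (\<integral>\<^sup>+\<omega>. ennreal (wt \<Lambda> \<omega>) \<partial>count_space X) / Zn \<Lambda> \<tau>"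
  using Z_pos[OF assms(1,2)] ennreal_Z[OF assms(1,2)]
  by (simp add: divide_ennreal[symmetric] nn_integral_divide)

lemma pmf_gam:
  assumes "finite \<Lambda>" "\<tau> \<in> Om"
  shows "pmf (gam \<Lambda> \<tau>) \<omega> = (if \<omega> \<in> cfgs S \<Lambda> \<tau> then wt \<Lambda> \<omega> / Z \<Lambda> \<tau> else 0)"
  unfolding gam_def
proof (rule pmf_embed_pmf)
  have "(\<integral>\<^sup>+\<omega>. ennreal (if \<omega> \<in> cfgs S \<Lambda> \<tau> then wt \<Lambda> \<omega> / Z \<Lambda> \<tau> else 0) \<partial>count_space UNIV) =
     (\<integral>\<^sup>+\<omega>. ennreal (wt \<Lambda> \<omega> / Z \<Lambda> \<tau>) \<partial>count_space (cfgs S \<Lambda> \<tau>))"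
    by (auto simp: nn_integral_count_space_indicator intro!: nn_integral_cong split: split_indicator)
  also have "\<dots> = 1"
    using Zn_pos[OF assms(2), of \<Lambda>] Zn_finite[OF assms]
    by (subst nn_integral_wt_div[OF assms]) (auto simp: Zn_def[symmetric])
  finally show "(\<integral>\<^sup>+\<omega>. ennreal (if \<omega> \<in> cfgs S \<Lambda> \<tau> then wt \<Lambda> \<omega> / Z \<Lambda> \<tau> else 0) \<partial>count_space UNIV) = 1" .
qed (auto simp: Z_def)

lemma emeasure_gam:
  assumes "finite \<Lambda>" "\<tau> \<in> Om"
  shows "emeasure (gam \<Lambda> \<tau>) A = (\<integral>\<^sup>+\<omega>. ennreal (wt \<Lambda> \<omega>) \<partial>count_space (A \<inter> cfgs S \<Lambda> \<tau>)) / Zn \<Lambda> \<tau>"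
proof -
  have "emeasure (gam \<Lambda> \<tau>) A = (\<integral>\<^sup>+\<omega>. ennreal (wt \<Lambda> \<omega> / Z \<Lambda> \<tau>) \<partial>count_space (A \<inter> cfgs S \<Lambda> \<tau>))"
    unfolding nn_integral_pmf[symmetric] pmf_gam[OF assms]
    by (auto simp: nn_integral_count_space_indicator intro!: nn_integral_cong split: split_indicator)
  then show ?thesis by (simp add: nn_integral_wt_div[OF assms])
qed

lemma gibbs_spec_eq:
  assumes "finite \<Lambda>" "\<tau> \<in> Om"
  shows "gibbs_spec S adj \<Phi> \<Psi> \<beta> \<Lambda> A \<tau> = measure (gam \<Lambda> \<tau>) A"
proof -
  have C: "{\<omega> \<in> Om. \<forall>v. v \<notin> \<Lambda> \<longrightarrow> \<omega> v = \<tau> v} = cfgs S \<Lambda> \<tau>"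
    using cfgs_eq[OF assms(2)] by simp
  have fin: "(\<integral>\<^sup>+\<omega>. ennreal (indicator A \<omega> * wt \<Lambda> \<omega>) \<partial>count_space (cfgs S \<Lambda> \<tau>)) \<le> Zn \<Lambda> \<tau>"
    unfolding Zn_def by (intro nn_integral_mono) (auto split: split_indicator)
  have "infsum (\<lambda>\<omega>. indicator A \<omega> * wt \<Lambda> \<omega>) (cfgs S \<Lambda> \<tau>) =
     enn2real (\<integral>\<^sup>+\<omega>. ennreal (indicator A \<omega> * wt \<Lambda> \<omega>) \<partial>count_space (cfgs S \<Lambda> \<tau>))"
    using le_less_trans[OF fin Zn_finite[OF assms]] by (intro infsum_eq_nn_integral) auto
  also have "(\<integral>\<^sup>+\<omega>. ennreal (indicator A \<omega> * wt \<Lambda> \<omega>) \<partial>count_space (cfgs S \<Lambda> \<tau>)) =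
     (\<integral>\<^sup>+\<omega>. ennreal (wt \<Lambda> \<omega>) \<partial>count_space (A \<inter> cfgs S \<Lambda> \<tau>))"
    by (auto simp: nn_integral_count_space_indicator intro!: nn_integral_cong split: split_indicator)
  finally have 1: "infsum (\<lambda>\<omega>. indicator A \<omega> * wt \<Lambda> \<omega>) (cfgs S \<Lambda> \<tau>) =
     enn2real (\<integral>\<^sup>+\<omega>. ennreal (wt \<Lambda> \<omega>) \<partial>count_space (A \<inter> cfgs S \<Lambda> \<tau>))" .
  have 2: "infsum (\<lambda>\<omega>. wt \<Lambda> \<omega>) (cfgs S \<Lambda> \<tau>) = Z \<Lambda> \<tau>"
    using Zn_finite[OF assms] by (subst infsum_eq_nn_integral) (auto simp: Zn_def Z_def)
  have "gibbs_spec S adj \<Phi> \<Psi> \<beta> \<Lambda> A \<tau> =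
     infsum (\<lambda>\<omega>. indicator A \<omega> * wt \<Lambda> \<omega>) (cfgs S \<Lambda> \<tau>) / infsum (\<lambda>\<omega>. wt \<Lambda> \<omega>) (cfgs S \<Lambda> \<tau>)"
    unfolding gibbs_spec_def Let_def space_cfg C wt_def ..
  also have "\<dots> = enn2real (emeasure (gam \<Lambda> \<tau>) A)"
    unfolding 1 2 emeasure_gam[OF assms] ennreal_Z[OF assms, symmetric]
    by (cases "\<integral>\<^sup>+\<omega>. ennreal (wt \<Lambda> \<omega>) \<partial>count_space (A \<inter> cfgs S \<Lambda> \<tau>)")
      (use Z_pos[OF assms] in \<open>simp_all add: divide_ennreal ennreal_top_divide\<close>)
  finally show ?thesis by (simp add: measure_def)
qed

definition agree :: "'v set \<Rightarrow> ('v \<Rightarrow> 'a) \<Rightarrow> ('v \<Rightarrow> 'a) set" where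
  "agree W a = {\<sigma>. \<forall>v\<in>W. \<sigma> v = a v}"

text \<open>A window that contains \<open>clos \<Lambda>\<close> fixes everything the kernel depends
  on. The DLR integral of such an event thus collapses to a constant times a probability.\<close>

lemma measure_gam_agree:
  assumes "finite \<Lambda>" "\<tau> \<in> Om" "a \<in> Om" "clos \<Lambda> \<subseteq> W"
  shows "measure (gam \<Lambda> \<tau>) (agree W a) = cond \<Lambda> a * indicator (agree (W - \<Lambda>) a) \<tau>"
proof (cases "\<tau> \<in> agree (W - \<Lambda>) a")
  case True
  define \<omega> where "\<omega> = (\<lambda>v. if v \<in> \<Lambda> then a v else \<tau> v)"
  have "agree W a \<inter> cfgs S \<Lambda> \<tau> = {\<omega>}"
  proof (intro equalityI subsetI)
    fix x assume "x \<in> agree W a \<inter> cfgs S \<Lambda> \<tau>"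
    then have "x v = \<omega> v" for v
      using assms(4) by (auto simp: agree_def cfgs_def \<omega>_def clos_def)
    then show "x \<in> {\<omega>}" by auto
  qed (use assms(3) True in \<open>auto simp: agree_def cfgs_def \<omega>_def Om_def\<close>)
  moreover have "wt \<Lambda> \<omega> = wt \<Lambda> a" "Zn \<Lambda> \<tau> = Zn \<Lambda> a"
    using True assms(4) by (auto intro!: wt_local Zn_local simp: \<omega>_def agree_def)
  ultimately have "emeasure (gam \<Lambda> \<tau>) (agree W a) = ennreal (cond \<Lambda> a)"
    using ennreal_Z[OF assms(1,3)] Z_pos[OF assms(1,3)]
    by (simp add: emeasure_gam[OF assms(1,2)] nn_integral_count_space_finite cond_def divide_ennreal[symmetric])
  then show ?thesis using True by (simp add: measure_def cond_nonneg)
next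
  case False
  then have "agree W a \<inter> cfgs S \<Lambda> \<tau> = {}"
    by (auto simp: agree_def cfgs_def)
  then have "emeasure (gam \<Lambda> \<tau>) (agree W a) = 0"
    by (simp add: emeasure_gam[OF assms(1,2)] nn_integral_count_space_finite)
  then show ?thesis using False by (simp add: measure_def)
qed

text \<open>Consistency of the kernels, tested on window events. Both sides are sums over the
  configurations off \<open>G\<close>, and on the fibre over each of them \<open>wt_ratio\<close>
  compares the weights.\<close>

lemma gam_consistent:
  assumes "finite \<Lambda>" "\<tau> \<in> Om" "a \<in> Om" "G \<subseteq> \<Lambda>" "clos G \<subseteq> W"
  shows "measure (gam \<Lambda> \<tau>) (agree W a) = cond G a * measure (gam \<Lambda> \<tau>) (agree (W - G) a)"
proof -
  have finG: "finite G" using assms finite_subset by auto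
  have \<Lambda>: "\<Lambda> = (\<Lambda> - G) \<union> G" "(\<Lambda> - G) \<inter> G = {}" using assms(4) by auto
  have split: "(\<integral>\<^sup>+\<omega>. ennreal (wt \<Lambda> \<omega>) \<partial>count_space (A \<inter> cfgs S \<Lambda> \<tau>)) =
      (\<integral>\<^sup>+\<omega>. (\<integral>\<^sup>+\<eta>. ennreal (wt \<Lambda> \<eta>) * indicator A \<eta> \<partial>count_space (cfgs S G \<omega>)) \<partial>count_space (cfgs S (\<Lambda> - G) \<tau>))" for A
  proof -
    have "(\<integral>\<^sup>+\<omega>. ennreal (wt \<Lambda> \<omega>) \<partial>count_space (A \<inter> cfgs S \<Lambda> \<tau>)) =
       (\<integral>\<^sup>+\<omega>. ennreal (wt \<Lambda> \<omega>) * indicator A \<omega> \<partial>count_space (cfgs S ((\<Lambda> - G) \<union> G) \<tau>))"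
      unfolding \<Lambda>(1)[symmetric]
      by (auto simp: nn_integral_count_space_indicator intro!: nn_integral_cong split: split_indicator)
    then show ?thesis by (simp only: nn_integral_cfgs_Un[OF \<Lambda>(2)])
  qed
  \<comment> \<open>The identity on one fibre, cross-multiplied so that no quotient of extended
    reals occurs. If \<open>\<omega>\<close> agrees with \<open>a\<close> on \<open>W - G\<close>,
    then exactly one configuration of the fibre, \<open>\<omega>'\<close> below, lies in
    \<open>agree W a\<close>.\<close>
  have inner: "(\<integral>\<^sup>+\<eta>. ennreal (wt \<Lambda> \<eta>) * indicator (agree (W - G) a) \<eta> \<partial>count_space (cfgs S G \<omega>)) * ennreal (wt G a) =
     (\<integral>\<^sup>+\<eta>. ennreal (wt \<Lambda> \<eta>) * indicator (agree W a) \<eta> \<partial>count_space (cfgs S G \<omega>)) * Zn G a" for \<omega>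
  proof (cases "\<omega> \<in> agree (W - G) a")
    case True
    define \<omega>' where "\<omega>' = (\<lambda>v. if v \<in> G then a v else \<omega> v)"
    have wa: "wt G \<omega>' = wt G a"
      using True assms(5) by (intro wt_local) (auto simp: \<omega>'_def agree_def)
    have za: "Zn G \<omega> = Zn G a"
      using True assms(5) by (intro Zn_local) (auto simp: agree_def)
    have "(\<integral>\<^sup>+\<eta>. ennreal (wt \<Lambda> \<eta>) * indicator (agree (W - G) a) \<eta> \<partial>count_space (cfgs S G \<omega>)) * ennreal (wt G a) =
       (\<integral>\<^sup>+\<eta>. ennreal (wt \<Lambda> \<eta>) * indicator (agree (W - G) a) \<eta> * ennreal (wt G a) \<partial>count_space (cfgs S G \<omega>))"
      by (simp add: nn_integral_multc)
    also have "\<dots> = (\<integral>\<^sup>+\<eta>. ennreal (wt \<Lambda> \<omega>') * ennreal (wt G \<eta>) \<partial>count_space (cfgs S G \<omega>))"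
    proof (intro nn_integral_cong)
      fix \<eta> assume \<eta>: "\<eta> \<in> space (count_space (cfgs S G \<omega>))"
      then have "\<eta> \<in> agree (W - G) a" using True by (auto simp: agree_def cfgs_def)
      moreover have "wt \<Lambda> \<eta> * wt G \<omega>' = wt \<Lambda> \<omega>' * wt G \<eta>"
        using \<eta> assms(1,4) by (intro wt_ratio) (auto simp: \<omega>'_def cfgs_def)
      ultimately show "ennreal (wt \<Lambda> \<eta>) * indicator (agree (W - G) a) \<eta> * ennreal (wt G a) = ennreal (wt \<Lambda> \<omega>') * ennreal (wt G \<eta>)"
        by (simp add: ennreal_mult'[symmetric] wa)
    qed
    also have "\<dots> = ennreal (wt \<Lambda> \<omega>') * Zn G a"
      by (simp add: nn_integral_cmult Zn_def[symmetric] za)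
    also have "ennreal (wt \<Lambda> \<omega>') = (\<integral>\<^sup>+\<eta>. ennreal (wt \<Lambda> \<eta>) * indicator (agree W a) \<eta> \<partial>count_space (cfgs S G \<omega>))"
    proof -
      have mem: "\<omega>' \<in> cfgs S G \<omega>" "\<omega>' \<in> agree W a"
        using assms(3) True by (auto simp: \<omega>'_def cfgs_def agree_def Om_def)
      have zero: "x \<notin> agree W a" if "x \<in> cfgs S G \<omega>" "x \<notin> {\<omega>'}" for x
      proof
        assume "x \<in> agree W a"
        then have "x v = \<omega>' v" for v
          using that(1) assms(5) by (auto simp: \<omega>'_def cfgs_def agree_def clos_def)
        then show False using that(2) by auto
      qed
      have "(\<integral>\<^sup>+\<eta>. ennreal (wt \<Lambda> \<eta>) * indicator (agree W a) \<eta> \<partial>count_space (cfgs S G \<omega>)) =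
          (\<Sum>\<eta>\<in>{\<omega>'}. ennreal (wt \<Lambda> \<eta>) * indicator (agree W a) \<eta>)"
        using zero mem by (intro nn_integral_count_space') simp_all
      then show ?thesis using mem by simp
    qed
    finally show ?thesis .
  next
    case False
    then have 1: "\<eta> \<notin> agree (W - G) a" if "\<eta> \<in> cfgs S G \<omega>" for \<eta>
      using that by (auto simp: agree_def cfgs_def)
    moreover have "\<eta> \<notin> agree W a" if "\<eta> \<in> cfgs S G \<omega>" for \<eta>
      using 1[OF that] by (auto simp: agree_def)
    ultimately have "(\<integral>\<^sup>+\<eta>. ennreal (wt \<Lambda> \<eta>) * indicator (agree (W - G) a) \<eta> \<partial>count_space (cfgs S G \<omega>)) = 0"
      "(\<integral>\<^sup>+\<eta>. ennreal (wt \<Lambda> \<eta>) * indicator (agree W a) \<eta> \<partial>count_space (cfgs S G \<omega>)) = 0"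
      by (subst nn_integral_0_iff_AE; simp add: AE_count_space)+
    then show ?thesis by simp
  qed
  have *: "(\<integral>\<^sup>+\<omega>. ennreal (wt \<Lambda> \<omega>) \<partial>count_space (agree (W - G) a \<inter> cfgs S \<Lambda> \<tau>)) * ennreal (wt G a) =
     (\<integral>\<^sup>+\<omega>. ennreal (wt \<Lambda> \<omega>) \<partial>count_space (agree W a \<inter> cfgs S \<Lambda> \<tau>)) * Zn G a"
    unfolding split by (simp add: nn_integral_multc[symmetric] inner del: nn_integral_multc)
  have "emeasure (gam \<Lambda> \<tau>) (agree (W - G) a) * ennreal (wt G a) = emeasure (gam \<Lambda> \<tau>) (agree W a) * ennreal (Z G a)"
    unfolding emeasure_gam[OF assms(1,2)] ennreal_Z[OF finG assms(3)] divide_ennreal_def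
    using arg_cong[OF *, of "\<lambda>x. x * inverse (Zn \<Lambda> \<tau>)"] by (simp add: mult_ac)
  then have "measure (gam \<Lambda> \<tau>) (agree (W - G) a) * wt G a = measure (gam \<Lambda> \<tau>) (agree W a) * Z G a"
    using Z_pos[OF finG assms(3)]
    by (simp add: measure_pmf.emeasure_eq_measure ennreal_mult'[symmetric])
  then show ?thesis
    using Z_pos[OF finG assms(3)] by (simp add: cond_def field_simps)
qed

end

section \<open>Summing out leaves\<close>

context cayley
begin

definition ch :: "'v \<Rightarrow> 'v \<Rightarrow> 'v set" where "ch r v = {x. x \<noteq> r \<and> par r x = v}"

lemma ch_subset_nbr: "ch r v \<subseteq> nbr v"
  using par(1)[of _ r] adj_sym by (auto simp: ch_def)

lemma finite_ch [simp]: "finite (ch r v)"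
  using finite_subset[OF ch_subset_nbr] by auto

lemma nbr_eq: "nbr v = (if v = r then ch r v else insert (par r v) (ch r v))"
proof (intro equalityI subsetI)
  fix x assume "x \<in> nbr v"
  then have "adj v x" by simp
  then show "x \<in> (if v = r then ch r v else insert (par r v) (ch r v))"
    by (rule adj_cases[of _ _ r]) (auto simp: ch_def)
next
  fix x assume "x \<in> (if v = r then ch r v else insert (par r v) (ch r v))"
  then show "x \<in> nbr v"
    using ch_subset_nbr[of r v] par(1)[of v r] by (auto split: if_splits)
qed

lemma par_not_ch: "v \<noteq> r \<Longrightarrow> par r v \<notin> ch r v"
proof
  assume "v \<noteq> r" "par r v \<in> ch r v"
  then have "lev r (par r v) = Suc (lev r v)" "lev r v = Suc (lev r (par r v))"
    using par(2)[of v r] par(2)[of "par r v" r] by (simp_all add: ch_def)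
  then show False by simp
qed

end

context spin
begin

text \<open>Each edge is named by its end \<open>w\<close> farther from the root, so that summing
  out a leaf removes exactly one factor.\<close>

lemma H_rooted:
  assumes "finite \<Lambda>"
  shows "H \<Lambda> \<omega> = (\<Sum>w | w \<noteq> r \<and> (w \<in> \<Lambda> \<or> par r w \<in> \<Lambda>). (\<Phi> (\<omega> w) (\<omega> (par r w)) + \<Phi> (\<omega> (par r w)) (\<omega> w)) / 2)
     + (\<Sum>v\<in>\<Lambda>. \<Psi> v (\<omega> v))"
proof -
  let ?E = "{w. w \<noteq> r \<and> (w \<in> \<Lambda> \<or> par r w \<in> \<Lambda>)}"
  have "?E \<subseteq> \<Lambda> \<union> (\<Union>v\<in>\<Lambda>. ch r v)" by (auto simp: ch_def)
  then have fin: "finite ?E" by (rule finite_subset) (use assms in auto)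
  have prs: "prs \<Lambda> = (\<lambda>w. (w, par r w)) ` ?E \<union> (\<lambda>w. (par r w, w)) ` ?E"
     "(\<lambda>w. (w, par r w)) ` ?E \<inter> (\<lambda>w. (par r w, w)) ` ?E = {}"
    unfolding prs_def by (rule adj_pairs_eq; auto)+
  have "(\<Sum>(v, w)\<in>prs \<Lambda>. \<Phi> (\<omega> v) (\<omega> w)) =
      (\<Sum>w\<in>?E. \<Phi> (\<omega> w) (\<omega> (par r w))) + (\<Sum>w\<in>?E. \<Phi> (\<omega> (par r w)) (\<omega> w))"
    unfolding prs(1) using fin prs(2)
    by (subst sum.union_disjoint) (auto simp: sum.reindex inj_on_def)
  then show ?thesis
    unfolding H_eq by (simp add: sum.distrib[symmetric] sum_divide_distrib[symmetric])
qed

lemma wt_rooted: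
  assumes "finite \<Lambda>"
  shows "wt \<Lambda> \<omega> = (\<Prod>w | w \<noteq> r \<and> (w \<in> \<Lambda> \<or> par r w \<in> \<Lambda>). Q (\<omega> w) (\<omega> (par r w))) * (\<Prod>v\<in>\<Lambda>. psi v (\<omega> v))"
proof -
  let ?E = "{w. w \<noteq> r \<and> (w \<in> \<Lambda> \<or> par r w \<in> \<Lambda>)}"
  have "?E \<subseteq> \<Lambda> \<union> (\<Union>v\<in>\<Lambda>. ch r v)" by (auto simp: ch_def)
  then have fin: "finite ?E" by (rule finite_subset) (use assms in auto)
  show ?thesis
    unfolding wt_def H_rooted[OF assms, of _ r] Q_def psi_def
    using fin assms by (simp only: distrib_left exp_add sum_distrib_left exp_sum)
qed

end

text \<open>All bounds are relative to the ground state \<open>gs\<close>. \<open>rr v a\<close>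
  bounds the weight of the branch at \<open>v\<close> with spin \<open>a\<close>, and
  \<open>g v w c\<close> the message that \<open>w\<close> sends to \<open>v\<close> when
  \<open>v\<close> has spin \<open>c\<close>. The recursion closes because \<open>branch\<close>
  turns \<open>d\<close> messages into \<open>rr\<close>, and \<open>g_bound\<close> turns
  \<open>rr\<close> and an edge into a message. In \<open>chain\<close> up to two neighbours
  \<open>X\<close> lie on a path and send no message; their factors \<open>Q (gs v) (gs x)\<close>
  are set aside for the ground-state energy of the path edges. \<open>h\<close> is the resulting
  weight on a path and \<open>\<delta>\<close> bounds its mass off the ground state.
  \<open>\<delta>_small\<close> is the condition of the final union bound: at most
  \<open>Suc d ^ n\<close> paths, with \<open>\<delta> * (2 + \<delta>)\<close>, that is
  \<open>(1 + \<delta>)\<^sup>2 - 1\<close>, for each vertex where one of two copies is off the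
  ground state.\<close>

locale ground = spin adj d S \<Phi> \<Psi> \<beta>
  for adj :: "'v \<Rightarrow> 'v \<Rightarrow> bool" and d and S :: "'a set" and \<Phi> \<Psi> \<beta> +
  fixes gs :: "'v \<Rightarrow> 'a" and rr :: "'v \<Rightarrow> 'a \<Rightarrow> real" and g :: "'v \<Rightarrow> 'v \<Rightarrow> 'a \<Rightarrow> real"
    and h :: "'v \<Rightarrow> 'a \<Rightarrow> real" and \<delta> :: real
  assumes gs_mem: "\<And>v. gs v \<in> S"
    and rr_nonneg: "\<And>v a. a \<in> S \<Longrightarrow> 0 \<le> rr v a"
    and rr_ground: "\<And>v. rr v (gs v) = 1"
    and g_nonneg: "\<And>v w a. adj v w \<Longrightarrow> a \<in> S \<Longrightarrow> 0 \<le> g v w a"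
    and g_bound: "\<And>v w c. adj v w \<Longrightarrow> c \<in> S \<Longrightarrow>
      (\<integral>\<^sup>+b. ennreal (Q c b * rr w b) \<partial>count_space S) \<le> ennreal (g v w c * Q (gs v) (gs w))"
    and branch: "\<And>v a x. a \<in> S \<Longrightarrow> a \<noteq> gs v \<Longrightarrow> adj v x \<Longrightarrow>
      psi v a / psi v (gs v) * (\<Prod>w\<in>nbr v - {x}. g v w a) \<le> rr v a"
    and chain: "\<And>v a X. a \<in> S \<Longrightarrow> a \<noteq> gs v \<Longrightarrow> X \<subseteq> nbr v \<Longrightarrow> card X \<le> 2 \<Longrightarrow>
      psi v a / psi v (gs v) * (\<Prod>w\<in>nbr v - X. g v w a) \<le> h v a * (\<Prod>x\<in>X. Q (gs v) (gs x))"
    and h_nonneg: "\<And>v a. 0 \<le> h v a"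
    and h_ground: "\<And>v. h v (gs v) = 1"
    and \<delta>_nonneg: "0 \<le> \<delta>"
    and h_sum: "\<And>v. (\<integral>\<^sup>+b. ennreal (h v b) \<partial>count_space (S - {gs v})) \<le> ennreal \<delta>"
    and \<delta>_small: "real (Suc d) * (\<delta> * (2 + \<delta>)) < 1"
begin

lemma gs_Om [simp]: "gs \<in> Om"
  using gs_mem by (simp add: Om_def)

text \<open>A partial partition function: the spins on \<open>B\<close> are frozen at
  \<open>a\<close> and those on \<open>V - B\<close> are summed. The fields \<open>F\<close> carry
  whatever has been summed out before.\<close>

definition U :: "'v \<Rightarrow> 'v set \<Rightarrow> ('v \<Rightarrow> 'a \<Rightarrow> ennreal) \<Rightarrow> 'v set \<Rightarrow> ('v \<Rightarrow> 'a) \<Rightarrow> ennreal" where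
  "U r V F B a = (\<integral>\<^sup>+\<omega>. (\<Prod>v\<in>V. F v (\<omega> v)) * (\<Prod>w\<in>V - {r}. ennreal (Q (\<omega> w) (\<omega> (par r w))))
     \<partial>count_space (cfgs S (V - B) a))"

text \<open>The product runs over the children outside \<open>V\<close>: those already summed out
  and those beyond the volume. Only ratios to the ground state are controlled, so normalisations
  never enter.\<close>

definition field_inv :: "'v \<Rightarrow> 'v set \<Rightarrow> ('v \<Rightarrow> 'a \<Rightarrow> ennreal) \<Rightarrow> bool" where
  "field_inv r V F \<longleftrightarrow> (\<forall>v\<in>V. \<forall>b\<in>S. b \<noteq> gs v \<longrightarrow>
     F v b \<le> F v (gs v) * ennreal (psi v b / psi v (gs v) * (\<Prod>x\<in>ch r v - V. g v x b)))"

lemma prod_g_nonneg: "b \<in> S \<Longrightarrow> X \<subseteq> nbr v \<Longrightarrow> 0 \<le> (\<Prod>x\<in>X. g v x b)"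
  by (intro prod_nonneg) (auto intro!: g_nonneg simp flip: mem_nbr)

text \<open>Summing out a leaf \<open>w\<close> of \<open>V\<close> multiplies the field at its parent by a message which, by
  \<open>branch\<close> and \<open>g_bound\<close>, is dominated by \<open>g\<close>.\<close>
lemma peel_step:
  assumes V: "V = insert w V'" "w \<notin> V'" "finite V'" and w: "w \<notin> B" "w \<noteq> r" "par r w \<in> V'"
    and leaf: "ch r w \<inter> V = {}" and BV: "B \<subseteq> V'" and inv: "field_inv r V F"
  defines "F' \<equiv> F(par r w := \<lambda>c. F (par r w) c * (\<integral>\<^sup>+b. ennreal (Q b c) * F w b \<partial>count_space S))"
  shows "field_inv r V' F'" "U r V F B a = U r V' F' B a"
proof -
  let ?p = "par r w"
  define M where "M c = (\<integral>\<^sup>+b. ennreal (Q b c) * F w b \<partial>count_space S)" for c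
  have F'_p: "F' ?p = (\<lambda>c. F ?p c * M c)" and F'_o: "\<And>v. v \<noteq> ?p \<Longrightarrow> F' v = F v"
    by (auto simp: F'_def M_def)
  have adj_pw: "adj ?p w" "adj w ?p" using par(1)[OF w(2)] adj_sym by auto
  have chw: "ch r w = nbr w - {?p}" using nbr_eq[of w r] par_not_ch[OF w(2)] w(2) by auto
  \<comment> \<open>Since \<open>w\<close> is a leaf of \<open>V\<close>, all its \<open>d\<close>
    children have been absorbed into its field, and \<open>branch\<close> applies with the parent as
    the neighbour left out.\<close>
  have Fw: "F w b \<le> F w (gs w) * ennreal (rr w b)" if b: "b \<in> S" for b
  proof (cases "b = gs w")
    case True
    then show ?thesis by (simp add: rr_ground)
  next
    case False
    have "ch r w - V = nbr w - {?p}" using leaf chw by auto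
    then have "F w b \<le> F w (gs w) * ennreal (psi w b / psi w (gs w) * (\<Prod>x\<in>nbr w - {?p}. g w x b))"
      using inv b False V unfolding field_inv_def by (metis insertI1)
    also have "\<dots> \<le> F w (gs w) * ennreal (rr w b)"
      using branch[OF b False adj_pw(2)] by (intro mult_left_mono ennreal_leI) auto
    finally show ?thesis .
  qed
  \<comment> \<open>The ground-state term alone bounds the message from below at
    \<open>gs ?p\<close>. This turns a bound on messages into a bound on their ratios.\<close>
  have M_gs: "ennreal (Q (gs w) (gs ?p)) * F w (gs w) \<le> M (gs ?p)"
    unfolding M_def by (rule nn_integral_count_space_mem_le[OF gs_mem])
  have M_le: "M c \<le> M (gs ?p) * ennreal (g ?p w c)" if c: "c \<in> S" for c
  proof -
    have "M c \<le> (\<integral>\<^sup>+b. F w (gs w) * ennreal (Q c b * rr w b) \<partial>count_space S)"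
      unfolding M_def
    proof (intro nn_integral_mono)
      fix b assume b: "b \<in> space (count_space S)"
      have "ennreal (Q b c) * F w b \<le> ennreal (Q b c) * (F w (gs w) * ennreal (rr w b))"
        using Fw[of b] b by (intro mult_left_mono) auto
      also have "\<dots> = F w (gs w) * ennreal (Q c b * rr w b)"
        using rr_nonneg[of b w] b by (simp add: ennreal_mult Q_sym[of b c] mult_ac)
      finally show "ennreal (Q b c) * F w b \<le> F w (gs w) * ennreal (Q c b * rr w b)" .
    qed
    also have "\<dots> = F w (gs w) * (\<integral>\<^sup>+b. ennreal (Q c b * rr w b) \<partial>count_space S)"
      by (simp add: nn_integral_cmult)
    also have "\<dots> \<le> F w (gs w) * ennreal (g ?p w c * Q (gs ?p) (gs w))"
      using g_bound[OF adj_pw(1) c] by (intro mult_left_mono) auto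
    also have "\<dots> = ennreal (Q (gs w) (gs ?p)) * F w (gs w) * ennreal (g ?p w c)"
      using g_nonneg[OF adj_pw(1) c] by (simp add: ennreal_mult Q_sym[of "gs w"] mult_ac)
    also have "\<dots> \<le> M (gs ?p) * ennreal (g ?p w c)"
      using M_gs by (intro mult_right_mono) auto
    finally show ?thesis .
  qed
  show "field_inv r V' F'"
    unfolding field_inv_def
  proof (intro ballI impI)
    fix v b assume v: "v \<in> V'" and b: "b \<in> S" "b \<noteq> gs v"
    have old: "F v b \<le> F v (gs v) * ennreal (psi v b / psi v (gs v) * (\<Prod>x\<in>ch r v - V. g v x b))"
      using inv v b V unfolding field_inv_def by auto
    show "F' v b \<le> F' v (gs v) * ennreal (psi v b / psi v (gs v) * (\<Prod>x\<in>ch r v - V'. g v x b))"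
    proof (cases "v = ?p")
      case True
      have chV: "ch r ?p - V' = insert w (ch r ?p - V)" "w \<notin> ch r ?p - V" using V w by (auto simp: ch_def)
      have pr: "(\<Prod>x\<in>ch r ?p - V'. g ?p x b) = g ?p w b * (\<Prod>x\<in>ch r ?p - V. g ?p x b)"
        unfolding chV(1) by (rule prod.insert[OF finite_Diff[OF finite_ch] chV(2)])
      have nn: "0 \<le> (\<Prod>x\<in>ch r ?p - V. g ?p x b)"
        using b ch_subset_nbr[of r ?p] by (intro prod_g_nonneg) auto
      have "F' v b = F ?p b * M b" by (simp add: True F'_p)
      also have "\<dots> \<le> (F ?p (gs ?p) * ennreal (psi ?p b / psi ?p (gs ?p) * (\<Prod>x\<in>ch r ?p - V. g ?p x b))) *
          (M (gs ?p) * ennreal (g ?p w b))"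
        using old M_le[OF b(1)] True by (intro mult_mono) auto
      also have "\<dots> = F' ?p (gs ?p) * ennreal (psi ?p b / psi ?p (gs ?p) * (\<Prod>x\<in>ch r ?p - V'. g ?p x b))"
        unfolding F'_p pr using nn g_nonneg[OF adj_pw(1) b(1)]
        by (simp add: ennreal_mult[symmetric] mult_ac)
      finally show ?thesis by (simp add: True)
    next
      case False
      then have "ch r v - V' = ch r v - V" using V by (auto simp: ch_def)
      then show ?thesis using old False by (simp add: F'_o)
    qed
  qed
  have VB: "V - B = insert w (V' - B)" "w \<notin> V' - B" using V w by auto
  have par_ne: "par r x \<noteq> w" if "x \<in> V'" "x \<noteq> r" for x using that leaf V by (auto simp: ch_def)
  have wr: "V - {r} = insert w (V' - {r})" using V w by auto
  have "U r V F B a = (\<integral>\<^sup>+\<omega>. (\<integral>\<^sup>+b. (\<Prod>v\<in>V. F v ((fun_upd \<omega> w b) v)) *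
      (\<Prod>x\<in>V - {r}. ennreal (Q ((fun_upd \<omega> w b) x) ((fun_upd \<omega> w b) (par r x)))) \<partial>count_space S) \<partial>count_space (cfgs S (V' - B) a))"
    unfolding U_def VB(1) by (rule nn_integral_cfgs_insert[OF VB(2)])
  also have "\<dots> = (\<integral>\<^sup>+\<omega>. (\<integral>\<^sup>+b. (\<Prod>v\<in>V'. F v (\<omega> v)) * (\<Prod>x\<in>V' - {r}. ennreal (Q (\<omega> x) (\<omega> (par r x)))) *
       (ennreal (Q b (\<omega> ?p)) * F w b) \<partial>count_space S) \<partial>count_space (cfgs S (V' - B) a))"
  proof (intro nn_integral_cong)
    fix \<omega> b
    have "(\<Prod>v\<in>V. F v ((fun_upd \<omega> w b) v)) = F w b * (\<Prod>v\<in>V'. F v (\<omega> v))"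
      using V by (auto intro!: arg_cong2[where f = "(*)"] prod.cong)
    moreover have "?p \<noteq> w" using w V by auto
    then have "(\<Prod>x\<in>V - {r}. ennreal (Q ((fun_upd \<omega> w b) x) ((fun_upd \<omega> w b) (par r x)))) =
       ennreal (Q b (\<omega> ?p)) * (\<Prod>x\<in>V' - {r}. ennreal (Q (\<omega> x) (\<omega> (par r x))))"
    proof -
      have "x \<noteq> w" if "x \<in> V'" for x using that V by auto
      then show ?thesis
        unfolding wr using V \<open>?p \<noteq> w\<close> par_ne by (auto intro!: arg_cong2[where f = "(*)"] prod.cong)
    qed
    ultimately show "(\<Prod>v\<in>V. F v ((fun_upd \<omega> w b) v)) *
      (\<Prod>x\<in>V - {r}. ennreal (Q ((fun_upd \<omega> w b) x) ((fun_upd \<omega> w b) (par r x)))) =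
      (\<Prod>v\<in>V'. F v (\<omega> v)) * (\<Prod>x\<in>V' - {r}. ennreal (Q (\<omega> x) (\<omega> (par r x)))) *
       (ennreal (Q b (\<omega> ?p)) * F w b)"
      by (simp add: mult_ac)
  qed
  also have "\<dots> = (\<integral>\<^sup>+\<omega>. (\<Prod>v\<in>V'. F v (\<omega> v)) * (\<Prod>x\<in>V' - {r}. ennreal (Q (\<omega> x) (\<omega> (par r x)))) * M (\<omega> ?p)
       \<partial>count_space (cfgs S (V' - B) a))"
    unfolding M_def by (simp add: nn_integral_cmult)
  also have "\<dots> = U r V' F' B a"
    unfolding U_def
  proof (intro nn_integral_cong)
    fix \<omega>
    have "(\<Prod>v\<in>V'. F' v (\<omega> v)) = (\<Prod>v\<in>V'. F v (\<omega> v)) * M (\<omega> ?p)"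
      using V(3) w(3) by (simp add: prod.remove[of V' ?p] F'_p F'_o mult_ac)
    then show "(\<Prod>v\<in>V'. F v (\<omega> v)) * (\<Prod>x\<in>V' - {r}. ennreal (Q (\<omega> x) (\<omega> (par r x)))) * M (\<omega> ?p) =
       (\<Prod>v\<in>V'. F' v (\<omega> v)) * (\<Prod>w\<in>V' - {r}. ennreal (Q (\<omega> w) (\<omega> (par r w))))"
      by (simp add: mult_ac)
  qed
  finally show "U r V F B a = U r V' F' B a" .
qed

text \<open>A vertex of \<open>V - B\<close> of largest level is a leaf of \<open>V\<close>: a child
  in \<open>V\<close> would be on a larger level and outside \<open>B\<close>, as \<open>B\<close>
  is closed under parents. The new field does not depend on \<open>a\<close>, so the sums for
  \<open>a\<close> and for the ground state can be compared afterwards.\<close>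

lemma peel:
  assumes "finite V" "r \<in> B" "B \<subseteq> V" "\<And>v. v \<in> V \<Longrightarrow> par r v \<in> V" "\<And>v. v \<in> B \<Longrightarrow> par r v \<in> B"
    "field_inv r V F"
  shows "\<exists>F'. field_inv r B F' \<and> (\<forall>a. U r V F B a = U r B F' B a)"
  using assms
proof (induction "card (V - B)" arbitrary: V F)
  case 0
  then have "V = B" by auto
  then show ?case using 0 by auto
next
  case (Suc n)
  have fin: "finite (lev r ` (V - B))" and ne: "V - B \<noteq> {}" using Suc by auto
  then have "Max (lev r ` (V - B)) \<in> lev r ` (V - B)" by (intro Max_in) auto
  then obtain w where w: "w \<in> V - B" "lev r w = Max (lev r ` (V - B))" by auto
  have max: "lev r x \<le> lev r w" if "x \<in> V - B" for x
    using Max_ge[OF fin, of "lev r x"] that w by auto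
  define V' where "V' = V - {w}"
  have wr: "w \<noteq> r" using w Suc by auto
  have leaf: "ch r w \<inter> V = {}"
  proof (rule ccontr)
    assume "ch r w \<inter> V \<noteq> {}"
    then obtain x where x: "x \<noteq> r" "par r x = w" "x \<in> V" by (auto simp: ch_def)
    then have "x \<notin> B" using Suc.prems(5) w by auto
    then show False using max[of x] x par(2)[of x r] by auto
  qed
  have pV: "par r v \<in> V'" if "v \<in> V'" for v
    using that Suc.prems(4)[of v] leaf w wr by (cases "v = r") (auto simp: V'_def ch_def)
  have pw: "par r w \<in> V'"
    using Suc.prems(4)[of w] w par(1)[OF wr] adj_irrefl by (auto simp: V'_def)
  have VV: "V = insert w V'" "w \<notin> V'" "finite V'" "B \<subseteq> V'" using w Suc by (auto simp: V'_def)
  have card: "n = card (V' - B)"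
  proof -
    have "V' - B = (V - B) - {w}" by (auto simp: V'_def)
    then show ?thesis using Suc.hyps(2) w by auto
  qed
  have "w \<notin> B" using w by auto
  note st = peel_step[OF VV(1-3) \<open>w \<notin> B\<close> wr pw leaf VV(4) Suc.prems(6)]
  show ?case
    using Suc.hyps(1)[OF card VV(3) Suc.prems(2) VV(4) pV Suc.prems(5) st(1)] st(2) by auto
qed

text \<open>An off-ground vertex \<open>v\<close> of \<open>B\<close> obtains from
  \<open>chain\<close> the factor \<open>t v\<close>, the ground-state weights of its edges inside
  \<open>B\<close>. An edge with both ends in the ground state already has its ground-state weight.
  Any other edge has weight at most 1, and an off-ground end supplies the ground-state
  weight.\<close>

lemma U_end_bound:
  assumes "finite B" "r \<in> B" "\<And>v. v \<in> B \<Longrightarrow> par r v \<in> B" "inj_on (lev r) B" "field_inv r B F" "a \<in> Om"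
  shows "U r B F B a \<le> U r B F B gs * ennreal (\<Prod>v\<in>B. h v (a v))"
proof -
  define q where "q v x = (if a v = gs v then 1 else Q (gs v) (gs x))" for v x
  define t where "t v = (\<Prod>x\<in>nbr v \<inter> B. q v x)" for v
  have q_nn: "0 \<le> q v x" "q v x \<le> 1" for v x
    using Q_le_1[OF gs_mem gs_mem] by (auto simp: q_def)
  have t_nn: "0 \<le> t v" for v unfolding t_def using q_nn by (intro prod_nonneg) auto
  have Fb: "F v (a v) \<le> F v (gs v) * ennreal (h v (a v) * t v)" if v: "v \<in> B" for v
  proof (cases "a v = gs v")
    case True
    then show ?thesis by (simp add: t_def q_def h_ground)
  next
    case False
    have "nbr v - (nbr v \<inter> B) = ch r v - B"
      using assms(3)[OF v] v by (auto simp: nbr_eq[of v r] split: if_splits)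
    then have "psi v (a v) / psi v (gs v) * (\<Prod>x\<in>ch r v - B. g v x (a v)) \<le> h v (a v) * t v"
      using chain[OF Om_mem[OF assms(6)] False, of "nbr v \<inter> B"] card_nbr_chain[OF assms(4), of v] False
      by (simp add: t_def q_def)
    then have "F v (gs v) * ennreal (psi v (a v) / psi v (gs v) * (\<Prod>x\<in>ch r v - B. g v x (a v))) \<le> F v (gs v) * ennreal (h v (a v) * t v)"
      by (intro mult_left_mono ennreal_leI) auto
    then show ?thesis
      using assms(5) v False Om_mem[OF assms(6)] unfolding field_inv_def by (meson order_trans)
  qed
  have "(\<Prod>v\<in>B. t v) * (\<Prod>w\<in>B - {r}. Q (a w) (a (par r w))) \<le> (\<Prod>w\<in>B - {r}. Q (gs w) (gs (par r w)))"
  proof -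
    let ?E = "{w. w \<noteq> r \<and> (w \<in> B \<and> par r w \<in> B)}"
    have E: "?E = B - {r}" using assms(3) by auto
    have prs: "{(v, w). adj v w \<and> (v \<in> B \<and> w \<in> B)} = (\<lambda>w. (w, par r w)) ` ?E \<union> (\<lambda>w. (par r w, w)) ` ?E"
      "(\<lambda>w. (w, par r w)) ` ?E \<inter> (\<lambda>w. (par r w, w)) ` ?E = {}"
      by (rule adj_pairs_eq; auto)+
    \<comment> \<open>Every edge inside \<open>B\<close> occurs twice in the product of the
      \<open>t v\<close>, once from each end.\<close>
    have "(\<Prod>v\<in>B. t v) = (\<Prod>(v, x)\<in>(SIGMA v:B. nbr v \<inter> B). q v x)"
      unfolding t_def using assms(1) by (intro prod.Sigma) auto
    also have "(SIGMA v:B. nbr v \<inter> B) = {(v, w). adj v w \<and> (v \<in> B \<and> w \<in> B)}" by auto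
    also have "(\<Prod>(v, x)\<in>\<dots>. q v x) = (\<Prod>w\<in>B - {r}. q w (par r w)) * (\<Prod>w\<in>B - {r}. q (par r w) w)"
      unfolding prs(1) using assms(1) prs(2) unfolding E
      by (subst prod.union_disjoint) (auto simp: prod.reindex inj_on_def)
    finally have "(\<Prod>v\<in>B. t v) * (\<Prod>w\<in>B - {r}. Q (a w) (a (par r w))) =
       (\<Prod>w\<in>B - {r}. q w (par r w) * q (par r w) w * Q (a w) (a (par r w)))"
      by (simp add: prod.distrib)
    also have "\<dots> \<le> (\<Prod>w\<in>B - {r}. Q (gs w) (gs (par r w)))"
    proof (intro prod_mono conjI)
      fix w
      let ?p = "par r w"
      have Qa: "Q (a w) (a ?p) \<le> 1" using Q_le_1 Om_mem[OF assms(6)] by blast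
      have Qg: "Q (gs w) (gs ?p) \<le> 1" using Q_le_1 gs_mem by blast
      show "0 \<le> q w ?p * q ?p w * Q (a w) (a ?p)" using q_nn by (intro mult_nonneg_nonneg) auto
      consider "a w = gs w" "a ?p = gs ?p" | "a w \<noteq> gs w" | "a ?p \<noteq> gs ?p" by blast
      then show "q w ?p * q ?p w * Q (a w) (a ?p) \<le> Q (gs w) (gs ?p)"
      proof cases
        case 1
        then show ?thesis by (simp add: q_def)
      next
        case 2
        then have "q w ?p * (q ?p w * Q (a w) (a ?p)) \<le> Q (gs w) (gs ?p) * 1"
          using q_nn[of ?p w] Qa by (intro mult_mono mult_le_one) (auto simp: q_def)
        then show ?thesis by (simp add: mult.assoc)
      next
        case 3
        then have "q ?p w * (q w ?p * Q (a w) (a ?p)) \<le> Q (gs w) (gs ?p) * 1"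
          using q_nn[of w ?p] Qa by (intro mult_mono mult_le_one) (auto simp: q_def Q_sym[of "gs ?p"])
        then show ?thesis by (simp add: mult_ac)
      qed
    qed
    finally show ?thesis .
  qed
  then have key: "ennreal (\<Prod>v\<in>B. t v) * (\<Prod>w\<in>B - {r}. ennreal (Q (a w) (a (par r w)))) \<le> (\<Prod>w\<in>B - {r}. ennreal (Q (gs w) (gs (par r w))))"
    using t_nn by (simp add: prod_ennreal ennreal_mult[symmetric] prod_nonneg ennreal_leI)
  have "U r B F B a = (\<Prod>v\<in>B. F v (a v)) * (\<Prod>w\<in>B - {r}. ennreal (Q (a w) (a (par r w))))"
    by (simp add: U_def nn_integral_count_space_finite)
  also have "\<dots> \<le> (\<Prod>v\<in>B. F v (gs v) * ennreal (h v (a v) * t v)) * (\<Prod>w\<in>B - {r}. ennreal (Q (a w) (a (par r w))))"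
    using Fb by (intro mult_right_mono prod_mono_ennreal) auto
  also have "\<dots> = (\<Prod>v\<in>B. F v (gs v)) * ennreal (\<Prod>v\<in>B. h v (a v)) * (ennreal (\<Prod>v\<in>B. t v) * (\<Prod>w\<in>B - {r}. ennreal (Q (a w) (a (par r w)))))"
    using t_nn h_nonneg by (simp add: prod.distrib prod_ennreal[symmetric] ennreal_mult mult_ac)
  also have "\<dots> \<le> (\<Prod>v\<in>B. F v (gs v)) * ennreal (\<Prod>v\<in>B. h v (a v)) * (\<Prod>w\<in>B - {r}. ennreal (Q (gs w) (gs (par r w))))"
    using key by (intro mult_left_mono) auto
  also have "\<dots> = U r B F B gs * ennreal (\<Prod>v\<in>B. h v (a v))"
    by (simp add: U_def nn_integral_count_space_finite mult_ac)
  finally show ?thesis .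
qed

text \<open>The peeling starts with fields made of the potential and the couplings to exterior
  children, which carry the ground state. After the comparison on \<open>B\<close>, the sum over
  configurations equal to the ground state on \<open>B\<close> is bounded by the full partition
  function and cancels.\<close>

lemma chain_bound:
  assumes "finite \<Lambda>" "r \<in> B" "B \<subseteq> \<Lambda>" "\<And>v. v \<in> \<Lambda> \<Longrightarrow> par r v \<in> \<Lambda>" "\<And>v. v \<in> B \<Longrightarrow> par r v \<in> B"
    "inj_on (lev r) B" "a \<in> Om"
  shows "measure (gam \<Lambda> gs) (agree B a) \<le> (\<Prod>v\<in>B. h v (a v))"
proof -
  define F where "F v b = ennreal (psi v b * (\<Prod>x\<in>ch r v - \<Lambda>. Q b (gs x)))" for v b
  have finB: "finite B" using assms(1,3) by (rule rev_finite_subset)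
  \<comment> \<open>A frozen exterior neighbour is dominated by a message: it is the single term
    \<open>gs x\<close> of the sum in \<open>g_bound\<close>, where \<open>rr\<close> equals
    1.\<close>
  have Qg: "Q b (gs x) \<le> Q (gs v) (gs x) * g v x b" if "adj v x" "b \<in> S" for v x b
  proof -
    have "ennreal (Q b (gs x) * rr x (gs x)) \<le> ennreal (g v x b * Q (gs v) (gs x))"
      using nn_integral_count_space_mem_le[OF gs_mem[of x], of "\<lambda>c. ennreal (Q b c * rr x c)"] g_bound[OF that]
      by (rule order_trans)
    then show ?thesis
      using g_nonneg[OF that] by (simp add: rr_ground mult.commute)
  qed
  have inv: "field_inv r \<Lambda> F"
    unfolding field_inv_def
  proof (intro ballI impI)
    fix v b assume "v \<in> \<Lambda>" and b: "b \<in> S" "b \<noteq> gs v"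
    have sub: "x \<in> ch r v - \<Lambda> \<Longrightarrow> adj v x" for x using ch_subset_nbr[of r v] by auto
    have "(\<Prod>x\<in>ch r v - \<Lambda>. Q b (gs x)) \<le> (\<Prod>x\<in>ch r v - \<Lambda>. Q (gs v) (gs x) * g v x b)"
      using Qg[OF sub b(1)] by (intro prod_mono) auto
    then have "psi v b * (\<Prod>x\<in>ch r v - \<Lambda>. Q b (gs x)) \<le> psi v b * (\<Prod>x\<in>ch r v - \<Lambda>. Q (gs v) (gs x) * g v x b)"
      by (intro mult_left_mono) auto
    also have "\<dots> = (psi v (gs v) * (\<Prod>x\<in>ch r v - \<Lambda>. Q (gs v) (gs x))) * (psi v b / psi v (gs v) * (\<Prod>x\<in>ch r v - \<Lambda>. g v x b))"
      by (simp add: prod.distrib field_simps)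
    finally show "F v b \<le> F v (gs v) * ennreal (psi v b / psi v (gs v) * (\<Prod>x\<in>ch r v - \<Lambda>. g v x b))"
      unfolding F_def by (subst ennreal_mult'[symmetric]) (auto intro!: ennreal_leI mult_nonneg_nonneg prod_nonneg)
  qed
  have U_wt: "U r \<Lambda> F B b = (\<integral>\<^sup>+\<omega>. ennreal (wt \<Lambda> \<omega>) \<partial>count_space (cfgs S (\<Lambda> - B) b))"
    if b: "b \<in> cfgs S B gs" for b
    unfolding U_def
  proof (intro nn_integral_cong)
    fix \<omega> assume \<omega>: "\<omega> \<in> space (count_space (cfgs S (\<Lambda> - B) b))"
    have off: "\<omega> v = gs v" if "v \<notin> \<Lambda>" for v using that \<omega> b assms(3) by (auto simp: cfgs_def)
    let ?D = "SIGMA v:\<Lambda>. ch r v - \<Lambda>"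
    let ?E = "{w. w \<noteq> r \<and> (w \<in> \<Lambda> \<or> par r w \<in> \<Lambda>)}"
    have E: "?E = (\<Lambda> - {r}) \<union> snd ` ?D"
      using assms(4) by (force simp: ch_def image_iff)
    have inj: "inj_on snd ?D" by (auto simp: inj_on_def ch_def)
    have finD: "finite ?D" using assms(1) by auto
    have "(\<Prod>w\<in>?E. Q (\<omega> w) (\<omega> (par r w))) = (\<Prod>w\<in>\<Lambda> - {r}. Q (\<omega> w) (\<omega> (par r w))) * (\<Prod>w\<in>snd ` ?D. Q (\<omega> w) (\<omega> (par r w)))"
      unfolding E using assms(1) finD by (intro prod.union_disjoint) auto
    also have "(\<Prod>w\<in>snd ` ?D. Q (\<omega> w) (\<omega> (par r w))) = (\<Prod>(v, x)\<in>?D. Q (\<omega> v) (gs x))"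
      unfolding prod.reindex[OF inj] by (intro prod.cong) (auto simp: ch_def off Q_sym)
    also have "\<dots> = (\<Prod>v\<in>\<Lambda>. \<Prod>x\<in>ch r v - \<Lambda>. Q (\<omega> v) (gs x))"
      using assms(1) by (intro prod.Sigma[symmetric]) auto
    finally have "wt \<Lambda> \<omega> = (\<Prod>v\<in>\<Lambda>. psi v (\<omega> v) * (\<Prod>x\<in>ch r v - \<Lambda>. Q (\<omega> v) (gs x))) * (\<Prod>w\<in>\<Lambda> - {r}. Q (\<omega> w) (\<omega> (par r w)))"
      unfolding wt_rooted[OF assms(1), of _ r] by (simp add: prod.distrib)
    moreover have "(\<Prod>v\<in>\<Lambda>. F v (\<omega> v)) = ennreal (\<Prod>v\<in>\<Lambda>. psi v (\<omega> v) * (\<Prod>x\<in>ch r v - \<Lambda>. Q (\<omega> v) (gs x)))"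
      unfolding F_def by (rule prod_ennreal) (auto intro!: mult_nonneg_nonneg prod_nonneg)
    ultimately show "(\<Prod>v\<in>\<Lambda>. F v (\<omega> v)) * (\<Prod>w\<in>\<Lambda> - {r}. ennreal (Q (\<omega> w) (\<omega> (par r w)))) = ennreal (wt \<Lambda> \<omega>)"
      by (simp only: prod_ennreal Q_nonneg) (simp add: ennreal_mult prod_nonneg)
  qed
  obtain F' where F': "field_inv r B F'" "\<And>b. U r \<Lambda> F B b = U r B F' B b"
    using peel[OF assms(1-5) inv] by auto
  define a' where "a' = (\<lambda>v. if v \<in> B then a v else gs v)"
  have a': "a' \<in> cfgs S B gs" "a' \<in> Om" using assms(7) gs_mem by (auto simp: a'_def cfgs_def Om_def)
  have eq: "agree B a \<inter> cfgs S \<Lambda> gs = cfgs S (\<Lambda> - B) a'"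
    using assms(3,7) by (fastforce simp: agree_def cfgs_def a'_def Om_def)
  have eqg: "cfgs S (\<Lambda> - B) gs \<subseteq> cfgs S \<Lambda> gs" using gs_mem by (auto simp: cfgs_def)
  have "(\<integral>\<^sup>+\<omega>. ennreal (wt \<Lambda> \<omega>) \<partial>count_space (cfgs S (\<Lambda> - B) a')) \<le>
      (\<integral>\<^sup>+\<omega>. ennreal (wt \<Lambda> \<omega>) \<partial>count_space (cfgs S (\<Lambda> - B) gs)) * ennreal (\<Prod>v\<in>B. h v (a' v))"
    using U_end_bound[OF finB assms(2,5,6) F'(1) a'(2)]
    by (simp add: F'(2)[symmetric] U_wt a' mem_cfgs_self)
  also have "\<dots> \<le> Zn \<Lambda> gs * ennreal (\<Prod>v\<in>B. h v (a' v))"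
  proof (intro mult_right_mono)
    show "(\<integral>\<^sup>+\<omega>. ennreal (wt \<Lambda> \<omega>) \<partial>count_space (cfgs S (\<Lambda> - B) gs)) \<le> Zn \<Lambda> gs"
      unfolding Zn_def nn_integral_count_space_indicator[of "cfgs S \<Lambda> gs", unfolded NO_MATCH_def, OF TrueI]
        nn_integral_count_space_indicator[of "cfgs S (\<Lambda> - B) gs", unfolded NO_MATCH_def, OF TrueI]
      using eqg by (intro nn_integral_mono mult_left_mono) (auto split: split_indicator)
  qed auto
  finally have "emeasure (gam \<Lambda> gs) (agree B a) \<le> Zn \<Lambda> gs * ennreal (\<Prod>v\<in>B. h v (a' v)) / Zn \<Lambda> gs"
    unfolding emeasure_gam[OF assms(1) gs_Om] eq by (rule divide_right_mono_ennreal)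
  also have "\<dots> = ennreal (\<Prod>v\<in>B. h v (a' v))"
    using Zn_pos[OF gs_Om, of \<Lambda>] Zn_finite[OF assms(1) gs_Om]
    by (simp add: ennreal_mult_divide_eq mult.commute[of "Zn \<Lambda> gs"])
  also have "(\<Prod>v\<in>B. h v (a' v)) = (\<Prod>v\<in>B. h v (a v))" by (simp add: a'_def)
  finally show ?thesis
    using h_nonneg by (simp add: measure_pmf.emeasure_eq_measure prod_nonneg)
qed

end

section \<open>Gibbs measures on finite windows\<close>

context spin
begin

definition res :: "'v set \<Rightarrow> ('v \<Rightarrow> 'a) \<Rightarrow> ('v \<Rightarrow> 'a) \<Rightarrow> ('v \<Rightarrow> 'a)" where
  "res W \<tau> \<sigma> = (\<lambda>v. if v \<in> W then \<sigma> v else \<tau> v)"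

lemma res_in_cfgs: "\<sigma> \<in> Om \<Longrightarrow> res W \<tau> \<sigma> \<in> cfgs S W \<tau>"
  by (auto simp: res_def cfgs_def Om_def)

lemma res_eq_iff: "a \<in> cfgs S W \<tau> \<Longrightarrow> res W \<tau> \<sigma> = a \<longleftrightarrow> \<sigma> \<in> agree W a"
  by (auto simp: res_def cfgs_def agree_def fun_eq_iff)

lemma sets_coord: "{\<sigma> \<in> Om. \<sigma> v = b} \<in> sets (cfg_space S)"
proof -
  have [measurable]: "(\<lambda>\<sigma>. \<sigma> v) \<in> measurable (cfg_space S) (count_space S)"
    unfolding cfg_space_def by measurable
  have "{\<sigma> \<in> space (cfg_space S). \<sigma> v = b} = (\<lambda>\<sigma>. \<sigma> v) -` ({b} \<inter> S) \<inter> space (cfg_space S)"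
    by (auto simp: Om_def)
  also have "\<dots> \<in> sets (cfg_space S)"
    by (rule measurable_sets[of _ _ "count_space S"]) auto
  finally show ?thesis by simp
qed

lemma sets_Om: "Om \<in> sets (cfg_space S)"
  using sets.top[of "cfg_space S :: ('v \<Rightarrow> 'a) measure"] by simp

lemma sets_agree: "finite W \<Longrightarrow> Om \<inter> agree W a \<in> sets (cfg_space S)"
proof (induction W rule: finite_induct)
  case empty
  then show ?case by (simp add: agree_def sets_Om)
next
  case (insert w W)
  have "Om \<inter> agree (insert w W) a = {\<sigma> \<in> Om. \<sigma> w = a w} \<inter> (Om \<inter> agree W a)"
    by (auto simp: agree_def)
  then show ?case using insert sets_coord[of w "a w"] by auto
qed

lemma res_vimage_eq:
  "{\<sigma> \<in> Om. res W \<tau> \<sigma> \<in> A} = (\<Union>a\<in>A \<inter> cfgs S W \<tau>. Om \<inter> agree W a)"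
proof (intro equalityI subsetI)
  fix \<sigma> assume \<sigma>: "\<sigma> \<in> {\<sigma> \<in> Om. res W \<tau> \<sigma> \<in> A}"
  then have "res W \<tau> \<sigma> \<in> A \<inter> cfgs S W \<tau>" using res_in_cfgs by blast
  moreover have "\<sigma> \<in> Om \<inter> agree W (res W \<tau> \<sigma>)" using \<sigma> by (auto simp: agree_def res_def)
  ultimately show "\<sigma> \<in> (\<Union>a\<in>A \<inter> cfgs S W \<tau>. Om \<inter> agree W a)" by blast
next
  fix \<sigma> assume "\<sigma> \<in> (\<Union>a\<in>A \<inter> cfgs S W \<tau>. Om \<inter> agree W a)"
  then obtain a where "a \<in> A" "a \<in> cfgs S W \<tau>" "\<sigma> \<in> Om" "\<sigma> \<in> agree W a" by blast
  then show "\<sigma> \<in> {\<sigma> \<in> Om. res W \<tau> \<sigma> \<in> A}" using res_eq_iff[of a W \<tau> \<sigma>] by simp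
qed

lemma disjoint_agree: "disjoint_family_on (\<lambda>a. Om \<inter> agree W a) (A \<inter> cfgs S W \<tau>)"
  unfolding disjoint_family_on_def
proof (intro ballI impI)
  fix a b assume "a \<in> A \<inter> cfgs S W \<tau>" "b \<in> A \<inter> cfgs S W \<tau>" "a \<noteq> b"
  then show "(Om \<inter> agree W a) \<inter> (Om \<inter> agree W b) = {}"
    using res_eq_iff[of a W \<tau>] res_eq_iff[of b W \<tau>] by (metis IntD2 disjoint_iff)
qed

lemma emeasure_res:
  assumes "sets \<mu> = sets (cfg_space S)" "finite W"
  shows "emeasure \<mu> {\<sigma> \<in> Om. res W \<tau> \<sigma> \<in> A} = (\<integral>\<^sup>+a. emeasure \<mu> (Om \<inter> agree W a) \<partial>count_space (A \<inter> cfgs S W \<tau>))"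
  unfolding res_vimage_eq using assms(2)
  by (intro emeasure_UN_countable countable_Int2 countable_cfgs countable_S disjoint_agree)
    (simp_all add: assms(1) sets_agree)

text \<open>Filled up with \<open>\<tau>\<close> outside \<open>W\<close>, a configuration has
  countably many possible values, so this image of \<open>\<mu>\<close> is discrete. The exchange of
  two copies is carried out on such images.\<close>

lemma window_pmf:
  assumes "sets \<mu> = sets (cfg_space S)" "prob_space \<mu>" "finite W"
  shows "\<exists>p :: ('v \<Rightarrow> 'a) pmf. \<forall>A. measure p A = measure \<mu> {\<sigma> \<in> Om. res W \<tau> \<sigma> \<in> A}"
proof -
  interpret prob_space \<mu> by fact
  have sp: "space \<mu> = Om" using sets_eq_imp_space_eq[OF assms(1)] by simp
  define f where "f a = measure \<mu> (Om \<inter> agree W a) * indicator (cfgs S W \<tau>) a" for a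
  have f_eq: "(\<integral>\<^sup>+a. ennreal (f a) \<partial>count_space A) = emeasure \<mu> {\<sigma> \<in> Om. res W \<tau> \<sigma> \<in> A}" for A
    unfolding emeasure_res[OF assms(1,3)]
    by (auto simp: nn_integral_count_space_indicator f_def emeasure_eq_measure intro!: nn_integral_cong split: split_indicator)
  have "(\<integral>\<^sup>+a. ennreal (f a) \<partial>count_space UNIV) = 1"
    unfolding f_eq using emeasure_space_1 sp by simp
  then have "pmf (embed_pmf f) a = f a" for a
    by (intro pmf_embed_pmf) (auto simp: f_def)
  then have "emeasure (embed_pmf f) A = emeasure \<mu> {\<sigma> \<in> Om. res W \<tau> \<sigma> \<in> A}" for A
    unfolding nn_integral_pmf[symmetric] f_eq[symmetric] by simp
  then show ?thesis
    by (intro exI[of _ "embed_pmf f"]) (simp add: measure_def)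
qed

lemma set_gam: "finite \<Lambda> \<Longrightarrow> \<tau> \<in> Om \<Longrightarrow> set_pmf (gam \<Lambda> \<tau>) \<subseteq> Om"
  using cfgs_Om[of \<tau> \<Lambda>] by (auto simp: set_pmf_eq pmf_gam split: if_splits)

lemma measure_gam_Om:
  assumes "finite \<Lambda>" "\<tau> \<in> Om"
  shows "measure (gam \<Lambda> \<tau>) (Om \<inter> A) = measure (gam \<Lambda> \<tau>) A"
  using set_gam[OF assms] by (intro measure_pmf.finite_measure_eq_AE) (auto simp: AE_measure_pmf_iff)

section \<open>The DLR equations as identities between window probabilities\<close>

abbreviation "gibbs \<equiv> is_gibbs S adj \<Phi> \<Psi> \<beta>"

lemma gibbs_atom:
  assumes "gibbs \<mu>" "finite \<Lambda>" "finite W" "clos \<Lambda> \<subseteq> W" "a \<in> Om"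
  shows "measure \<mu> (Om \<inter> agree W a) = cond \<Lambda> a * measure \<mu> (Om \<inter> agree (W - \<Lambda>) a)"
proof -
  have sets: "sets \<mu> = sets (cfg_space S)" and "prob_space \<mu>"
    and dlr: "\<And>A. A \<in> sets \<mu> \<Longrightarrow> measure \<mu> A = (\<integral>\<tau>. gibbs_spec S adj \<Phi> \<Psi> \<beta> \<Lambda> A \<tau> \<partial>\<mu>)"
    using assms(1,2) by (auto simp: is_gibbs_def)
  interpret prob_space \<mu> by fact
  have sp: "space \<mu> = Om" using sets_eq_imp_space_eq[OF sets] by simp
  have "measure \<mu> (Om \<inter> agree W a) = (\<integral>\<tau>. gibbs_spec S adj \<Phi> \<Psi> \<beta> \<Lambda> (Om \<inter> agree W a) \<tau> \<partial>\<mu>)"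
    using sets_agree[OF assms(3)] sets by (intro dlr) simp
  also have "\<dots> = (\<integral>\<tau>. cond \<Lambda> a * indicator (Om \<inter> agree (W - \<Lambda>) a) \<tau> \<partial>\<mu>)"
    using assms sp
    by (intro Bochner_Integration.integral_cong refl)
      (simp add: gibbs_spec_eq measure_gam_Om measure_gam_agree split: split_indicator)
  also have "\<dots> = cond \<Lambda> a * measure \<mu> (Om \<inter> agree (W - \<Lambda>) a)"
    using sets_agree[of "W - \<Lambda>" a] assms(3) sets
    by (simp add: emeasure_eq_measure sp Int_absorb1 Int_commute[of _ Om] Int_left_absorb)
  finally show ?thesis .
qed

abbreviation "cyls \<equiv> prod_algebra UNIV (\<lambda>_ :: 'v. count_space S)"

lemma sets_cfg: "sets (cfg_space S :: ('v \<Rightarrow> 'a) measure) = sigma_sets Om cyls"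
proof -
  have "Om = (\<Pi>\<^sub>E i\<in>UNIV. space (count_space S))"
    by (auto simp: Om_def PiE_def Pi_def)
  then show ?thesis by (simp add: cfg_space_def sets_PiM)
qed

lemma cyls_subset: "cyls \<subseteq> Pow Om"
  using prod_algebra_sets_into_space[of UNIV "\<lambda>_. count_space S"] by (auto simp: Om_def PiE_def Pi_def)

lemma cylsE:
  assumes "B \<in> cyls"
  obtains J E where "finite J" "B = {\<sigma> \<in> Om. \<forall>j\<in>J. \<sigma> j \<in> E j}"
proof -
  from assms obtain J E where B: "B = prod_emb UNIV (\<lambda>_. count_space S) J (\<Pi>\<^sub>E j\<in>J. E j)"
    and J: "finite J" by (rule prod_algebraE)
  have "B = {\<sigma> \<in> Om. \<forall>j\<in>J. \<sigma> j \<in> E j}"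
    unfolding B prod_emb_def by (auto simp: Om_def PiE_def Pi_def extensional_def)
  with J show ?thesis by (rule that)
qed

lemma Om_in_cyls: "Om \<in> cyls"
proof -
  fix v :: 'v
  have "prod_emb UNIV (\<lambda>_. count_space S) {v} (\<Pi>\<^sub>E j\<in>{v}. S) \<in> cyls"
    by (rule prod_algebraI) auto
  moreover have "prod_emb UNIV (\<lambda>_. count_space S) {v} (\<Pi>\<^sub>E j\<in>{v}. S) = Om"
    unfolding prod_emb_def by (auto simp: Om_def PiE_def Pi_def extensional_def)
  ultimately show ?thesis by simp
qed

text \<open>Converse of \<open>gibbs_atom\<close>, by a Dynkin class argument: window atoms generate
  the cylinders through countable disjoint unions. The hypothesis \<open>atom\<close> involves only
  probabilities of window atoms and is therefore stable under limits in which these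
  converge.\<close>

lemma gibbsI:
  assumes sets: "sets \<mu> = sets (cfg_space S)" and "prob_space \<mu>"
    and atom: "\<And>\<Lambda> W a. finite \<Lambda> \<Longrightarrow> finite W \<Longrightarrow> clos \<Lambda> \<subseteq> W \<Longrightarrow> a \<in> Om \<Longrightarrow>
      measure \<mu> (Om \<inter> agree W a) = cond \<Lambda> a * measure \<mu> (Om \<inter> agree (W - \<Lambda>) a)"
  shows "gibbs \<mu>"
  unfolding is_gibbs_def
proof (intro conjI allI impI ballI sets)
  interpret prob_space \<mu> by fact
  show "prob_space \<mu>" by fact
  have sp: "space \<mu> = Om" using sets_eq_imp_space_eq[OF sets] by simp
  fix \<Lambda> :: "'v set" and A assume fin: "finite \<Lambda>" and A: "A \<in> sets \<mu>"
  let ?e = "\<lambda>A \<tau>. emeasure (measure_pmf (gam \<Lambda> \<tau>)) A"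
  \<comment> \<open>Measurability of the kernel in the boundary condition is carried along in the
    same induction as the identity.\<close>
  define P where "P A \<longleftrightarrow> A \<in> sets \<mu> \<and> ?e A \<in> borel_measurable \<mu> \<and> emeasure \<mu> A = (\<integral>\<^sup>+\<tau>. ?e A \<tau> \<partial>\<mu>)" for A
  have P_empty: "P {}" by (simp add: P_def)
  have P_compl: "P (Om - A)" if "P A" for A
  proof -
    have 1: "?e (Om - A) \<tau> = 1 - ?e A \<tau>" if "\<tau> \<in> Om" for \<tau>
    proof -
      have "measure (gam \<Lambda> \<tau>) (Om - A) = measure (gam \<Lambda> \<tau>) (Om \<inter> - A)" by (simp add: Diff_eq)
      also have "\<dots> = 1 - measure (gam \<Lambda> \<tau>) A"
        unfolding measure_gam_Om[OF fin that] using measure_pmf.prob_compl[of A "gam \<Lambda> \<tau>"]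
        by (simp add: Compl_eq_Diff_UNIV)
      finally show ?thesis
        by (simp add: measure_pmf.emeasure_eq_measure ennreal_minus[symmetric])
    qed
    have A: "A \<in> sets \<mu>" "?e A \<in> borel_measurable \<mu>" "emeasure \<mu> A = (\<integral>\<^sup>+\<tau>. ?e A \<tau> \<partial>\<mu>)"
      using that by (auto simp: P_def)
    have "(\<lambda>\<tau>. 1 - ?e A \<tau>) \<in> borel_measurable \<mu>" using A(2) by measurable
    then have m: "?e (Om - A) \<in> borel_measurable \<mu>"
      by (rule measurable_cong[THEN iffD2, rotated]) (use 1 sp in simp)
    have "(\<integral>\<^sup>+\<tau>. ?e (Om - A) \<tau> \<partial>\<mu>) = (\<integral>\<^sup>+\<tau>. 1 - ?e A \<tau> \<partial>\<mu>)"
      using 1 sp by (intro nn_integral_cong) simp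
    also have "\<dots> = (\<integral>\<^sup>+\<tau>. 1 \<partial>\<mu>) - (\<integral>\<^sup>+\<tau>. ?e A \<tau> \<partial>\<mu>)"
    proof (rule nn_integral_diff)
      show "(\<integral>\<^sup>+\<tau>. ?e A \<tau> \<partial>\<mu>) \<noteq> \<infinity>"
        unfolding A(3)[symmetric] by simp
    qed (simp_all add: measure_pmf.emeasure_le_1 A(2))
    also have "\<dots> = emeasure \<mu> (space \<mu>) - emeasure \<mu> A"
      unfolding A(3) by simp
    also have "\<dots> = emeasure \<mu> (Om - A)"
      using emeasure_compl[OF A(1)] sp by simp
    finally show ?thesis
      using m sets.compl_sets[OF A(1)] sp unfolding P_def by metis
  qed
  have P_union: "P (\<Union>n. X n)" if X: "\<And>n. P (X n)" "disjoint_family X" for X :: "nat \<Rightarrow> ('v \<Rightarrow> 'a) set"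
  proof -
    have 1: "?e (\<Union>n. X n) \<tau> = (\<Sum>n. ?e (X n) \<tau>)" for \<tau>
      using X(2) by (intro suminf_emeasure[symmetric]) auto
    have "emeasure \<mu> (\<Union>n. X n) = (\<Sum>n. emeasure \<mu> (X n))"
      using X unfolding P_def by (intro suminf_emeasure[symmetric]) auto
    also have "\<dots> = (\<Sum>n. \<integral>\<^sup>+\<tau>. ?e (X n) \<tau> \<partial>\<mu>)" using X(1) by (simp add: P_def)
    also have "\<dots> = (\<integral>\<^sup>+\<tau>. (\<Sum>n. ?e (X n) \<tau>) \<partial>\<mu>)"
      using X(1) unfolding P_def by (intro nn_integral_suminf[symmetric]) auto
    finally show ?thesis
      using X(1) unfolding P_def 1 by (auto intro!: borel_measurable_suminf_order)
  qed
  have P_atom: "P (Om \<inter> agree W a)" if W: "finite W" "clos \<Lambda> \<subseteq> W" "a \<in> Om" for W a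
  proof -
    have 1: "?e (Om \<inter> agree W a) \<tau> = ennreal (cond \<Lambda> a) * indicator (Om \<inter> agree (W - \<Lambda>) a) \<tau>" if "\<tau> \<in> Om" for \<tau>
    proof -
      have "measure (gam \<Lambda> \<tau>) (Om \<inter> agree W a) = cond \<Lambda> a * indicator (agree (W - \<Lambda>) a) \<tau>"
        using measure_gam_Om[OF fin that] measure_gam_agree[OF fin that W(3,2)] by simp
      then show ?thesis
        using that by (cases "\<tau> \<in> agree (W - \<Lambda>) a") (simp_all add: measure_pmf.emeasure_eq_measure)
    qed
    have m: "Om \<inter> agree (W - \<Lambda>) a \<in> sets \<mu>" "Om \<inter> agree W a \<in> sets \<mu>" using sets_agree sets W by auto
    have "(\<integral>\<^sup>+\<tau>. ?e (Om \<inter> agree W a) \<tau> \<partial>\<mu>) = (\<integral>\<^sup>+\<tau>. ennreal (cond \<Lambda> a) * indicator (Om \<inter> agree (W - \<Lambda>) a) \<tau> \<partial>\<mu>)"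
      using 1 sp by (intro nn_integral_cong) simp
    also have "\<dots> = emeasure \<mu> (Om \<inter> agree W a)"
      using m atom[OF fin W] by (simp add: nn_integral_cmult_indicator emeasure_eq_measure ennreal_mult cond_nonneg)
    finally have 2: "emeasure \<mu> (Om \<inter> agree W a) = (\<integral>\<^sup>+\<tau>. ?e (Om \<inter> agree W a) \<tau> \<partial>\<mu>)" by simp
    have "?e (Om \<inter> agree W a) \<in> borel_measurable \<mu> \<longleftrightarrow>
        (\<lambda>\<tau>. ennreal (cond \<Lambda> a) * indicator (Om \<inter> agree (W - \<Lambda>) a) \<tau>) \<in> borel_measurable \<mu>"
      using 1 sp by (intro measurable_cong) simp
    then show ?thesis using 2 m by (simp add: P_def)
  qed
  obtain \<tau>0 where \<tau>0: "\<tau>0 \<in> Om" using not_empty sp by auto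
  have P_basic: "P B" if "B \<in> cyls" for B
  proof -
    from that obtain J E where J: "finite J" and B: "B = {\<sigma> \<in> Om. \<forall>j\<in>J. \<sigma> j \<in> E j}"
      by (rule cylsE)
    \<comment> \<open>The base \<open>J\<close> of the cylinder is enlarged because
      \<open>P_atom\<close> requires a window that contains \<open>clos \<Lambda>\<close>.\<close>
    define W where "W = J \<union> clos \<Lambda>"
    define I where "I = {a \<in> cfgs S W \<tau>0. \<forall>j\<in>J. a j \<in> E j}"
    have W: "finite W" "clos \<Lambda> \<subseteq> W" using J fin by (auto simp: W_def)
    have "B = {\<sigma> \<in> Om. res W \<tau>0 \<sigma> \<in> {a. \<forall>j\<in>J. a j \<in> E j}}"
      unfolding B by (auto simp: res_def W_def)
    also have "\<dots> = (\<Union>a\<in>I. Om \<inter> agree W a)"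
      unfolding res_vimage_eq I_def by (intro arg_cong[where f = Union] image_cong) auto
    finally have B_eq: "B = (\<Union>a\<in>I. Om \<inter> agree W a)" .
    have cI: "countable I"
      using countable_cfgs[OF countable_S W(1)] by (rule countable_subset[rotated]) (auto simp: I_def)
    \<comment> \<open>The atoms in the order of \<open>to_nat_on I\<close>; an index that is not
      attained gives the empty set.\<close>
    define X where "X n = (\<Union>a\<in>{a \<in> I. to_nat_on I a = n}. Om \<inter> agree W a)" for n
    have I_sub: "I \<subseteq> cfgs S W \<tau>0" "I \<subseteq> Om"
      using cfgs_Om[OF \<tau>0, of W] unfolding I_def by blast+
    have "P (X n)" for n
    proof (cases "\<exists>a\<in>I. to_nat_on I a = n")
      case True
      then obtain a where a: "a \<in> I" "to_nat_on I a = n" by blast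
      then have "{a \<in> I. to_nat_on I a = n} = {a}"
        using to_nat_on_inj[OF cI] by blast
      then have "X n = Om \<inter> agree W a" by (simp add: X_def)
      then show ?thesis using P_atom[OF W, of a] a(1) I_sub(2) by auto
    next
      case False
      then have "X n = {}" by (auto simp: X_def)
      then show ?thesis using P_empty by simp
    qed
    moreover have "disjoint_family X"
      unfolding disjoint_family_on_def
    proof (intro ballI impI)
      fix m n :: nat assume "m \<noteq> n"
      show "X m \<inter> X n = {}"
      proof (rule ccontr)
        assume "X m \<inter> X n \<noteq> {}"
        then obtain \<sigma> where \<sigma>: "\<sigma> \<in> X m" "\<sigma> \<in> X n" by blast
        from \<sigma>(1) obtain a where a: "a \<in> I" "to_nat_on I a = m" "\<sigma> \<in> agree W a" unfolding X_def by blast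
        from \<sigma>(2) obtain b where b: "b \<in> I" "to_nat_on I b = n" "\<sigma> \<in> agree W b" unfolding X_def by blast
        have "a = b"
          using res_eq_iff[of a W \<tau>0 \<sigma>] res_eq_iff[of b W \<tau>0 \<sigma>] a b I_sub(1) by (metis subsetD)
        then show False using \<open>m \<noteq> n\<close> a(2) b(2) by simp
      qed
    qed
    moreover have "(\<Union>n. X n) = B"
      unfolding B_eq X_def by blast
    ultimately show ?thesis using P_union[of X] by simp
  qed
  have "A \<in> sigma_sets Om cyls"
    using A sets sets_cfg by simp
  then have "P A"
    using P_basic P_empty P_compl P_union
    by (intro sigma_sets_induct_disjoint[OF Int_stable_prod_algebra cyls_subset, of A P]) blast+
  then have "emeasure \<mu> A = (\<integral>\<^sup>+\<tau>. ennreal (measure (gam \<Lambda> \<tau>) A) \<partial>\<mu>)"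
    and m: "?e A \<in> borel_measurable \<mu>"
    by (auto simp: P_def measure_pmf.emeasure_eq_measure)
  moreover have "(\<lambda>\<tau>. measure (gam \<Lambda> \<tau>) A) \<in> borel_measurable \<mu>"
    using m unfolding measure_def by measurable
  ultimately have "measure \<mu> A = (\<integral>\<tau>. measure (gam \<Lambda> \<tau>) A \<partial>\<mu>)"
    by (subst integral_eq_nn_integral) (auto simp: measure_def)
  also have "\<dots> = (\<integral>\<tau>. gibbs_spec S adj \<Phi> \<Psi> \<beta> \<Lambda> A \<tau> \<partial>\<mu>)"
    using sp fin by (intro Bochner_Integration.integral_cong) (auto simp: gibbs_spec_eq)
  finally show "measure \<mu> A = (\<integral>\<tau>. gibbs_spec S adj \<Phi> \<Psi> \<beta> \<Lambda> A \<tau> \<partial>\<mu>)" .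
qed

end

section \<open>Disagreement percolation\<close>

context cayley
begin

text \<open>Connection to the exterior of \<open>\<Lambda>\<close> through bad vertices. The first
  vertex must be bad as well, unless it already lies outside.\<close>

inductive dis :: "('v \<Rightarrow> bool) \<Rightarrow> 'v set \<Rightarrow> 'v \<Rightarrow> bool" for bd \<Lambda> where
  out: "v \<notin> \<Lambda> \<Longrightarrow> dis bd \<Lambda> v"
| step: "bd v \<Longrightarrow> adj v x \<Longrightarrow> dis bd \<Lambda> x \<Longrightarrow> dis bd \<Lambda> v"

definition core :: "('v \<Rightarrow> bool) \<Rightarrow> 'v set \<Rightarrow> 'v set" where
  "core bd \<Lambda> = {v. \<not> dis bd \<Lambda> v \<and> (\<forall>x. adj v x \<longrightarrow> \<not> dis bd \<Lambda> x)}"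

lemma core_subset: "core bd \<Lambda> \<subseteq> \<Lambda>"
  using dis.out by (auto simp: core_def)

text \<open>Such an \<open>x\<close> is not connected to the exterior, but, lying outside the core,
  it has a neighbour that is. A bad \<open>x\<close> would extend this connection. For this reason
  \<open>core\<close> also demands that all neighbours be unconnected.\<close>

lemma core_boundary:
  assumes "v \<in> core bd \<Lambda>" "adj v x" "x \<notin> core bd \<Lambda>"
  shows "\<not> bd x"
proof
  assume "bd x"
  have nd: "\<not> dis bd \<Lambda> x" using assms by (auto simp: core_def)
  then obtain y where "adj x y" "dis bd \<Lambda> y" using assms(3) by (auto simp: core_def)
  then show False using dis.step[of bd x y \<Lambda>] \<open>bd x\<close> nd by blast
qed

text \<open>In a tree, a way out of the ball goes towards the root as far as some ancestor
  \<open>a\<close> of \<open>v\<close> and then straight outwards. Only the outward part is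
  recorded. Going back one step along the connection keeps \<open>a\<close>, except when
  \<open>v\<close> is the parent of \<open>a\<close>; then \<open>v\<close> is added to the
  segment.\<close>

lemma dis_chain:
  assumes "dis bd (ball r n) v" "v \<in> ball r n"
  shows "\<exists>a u. a \<in> anc r v \<and> lev r u = n \<and> a \<in> anc r u \<and> (\<forall>x\<in>anc r u. lev r a \<le> lev r x \<longrightarrow> bd x)"
  using assms
proof (induction rule: dis.induct)
  case (out v)
  then show ?case by auto
next
  case (step v x)
  show ?case
  proof (cases "x \<in> ball r n")
    case False
    then have lv: "lev r v = n"
      using lev_adj[OF step.hyps(2), of r] step.prems by (auto simp: ball_def)
    have "bd y" if "y \<in> anc r v" "lev r v \<le> lev r y" for y
    proof -
      have "lev r y = lev r v" using that anc_lev_le[of y r v] by auto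
      then have "y = v" using inj_onD[OF anc_inj_lev, of r y v v] that(1) by auto
      then show ?thesis using step.hyps(1) by simp
    qed
    then show ?thesis using lv by (intro exI[of _ v]) auto
  next
    case True
    then obtain a u where au: "a \<in> anc r x" "lev r u = n" "a \<in> anc r u"
        "\<forall>y\<in>anc r u. lev r a \<le> lev r y \<longrightarrow> bd y"
      using step.IH by blast
    from step.hyps(2) show ?thesis
    proof (rule adj_cases[of _ _ r])
      assume "x = par r v"
      then have "a \<in> anc r v" using au(1) anc_unfold[of r v] by auto
      then show ?thesis using au by blast
    next
      assume xv: "x \<noteq> r" "v = par r x" "lev r x = Suc (lev r v)"
      show ?thesis
      proof (cases "a = x")
        case False
        then have "a \<in> anc r v" using au(1) xv(2) anc_unfold[of r x] by auto
        then show ?thesis using au by blast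
      next
        case True
        then have vu: "v \<in> anc r u" using au(3) xv(2) anc_par by simp
        have "bd y" if y: "y \<in> anc r u" "lev r v \<le> lev r y" for y
        proof (cases "lev r y = lev r v")
          case True
          then have "y = v" using inj_onD[OF anc_inj_lev _ y(1) vu] by simp
          then show ?thesis using step.hyps(1) by simp
        next
          case False
          then have "lev r a \<le> lev r y" using y(2) \<open>a = x\<close> xv(3) by auto
          then show ?thesis using au(4) y(1) by blast
        qed
        then show ?thesis using vu au(2) by (intro exI[of _ v] exI[of _ u]) auto
      qed
    qed
  qed
qed

text \<open>A vertex of the small ball outside the core is connected to the exterior, or a neighbour
  of it is. The neighbour may cost one level, so the bad segment starts at level at most
  \<open>Suc m\<close> and covers all levels beyond \<open>m\<close>.\<close>

lemma not_core_chain: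
  assumes "\<not> ball r m \<subseteq> core bd (ball r n)" "m < n"
  shows "\<exists>u. lev r u = n \<and> (\<forall>x\<in>anc r u. m < lev r x \<longrightarrow> bd x)"
proof -
  obtain f where f: "f \<in> ball r m" "f \<notin> core bd (ball r n)" using assms by auto
  then obtain y where y: "dis bd (ball r n) y" "lev r y \<le> Suc m"
  proof (cases "dis bd (ball r n) f")
    case True
    then show ?thesis using that[of f] f by (auto simp: ball_def)
  next
    case False
    then obtain y where "adj f y" "dis bd (ball r n) y" using f by (auto simp: core_def)
    then show ?thesis using that[of y] lev_adj_le[of f y r] f by (auto simp: ball_def)
  qed
  then have "y \<in> ball r n" using assms(2) by (auto simp: ball_def)
  from dis_chain[OF y(1) this] obtain a u where au: "a \<in> anc r y" "lev r u = n"
      "\<forall>x\<in>anc r u. lev r a \<le> lev r x \<longrightarrow> bd x"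
    by blast
  have "lev r a \<le> Suc m" using anc_lev_le[OF au(1)] y(2) by simp
  then show ?thesis using au by (intro exI[of _ u]) auto
qed

end

context spin
begin

lemma clos_ball: "clos (ball r n) \<subseteq> ball r (Suc n)"
proof
  fix v assume "v \<in> clos (ball r n)"
  then consider "lev r v \<le> n" | w where "lev r w \<le> n" "adj w v" by (auto simp: clos_def ball_def)
  then show "v \<in> ball r (Suc n)"
    by cases (use lev_adj_le[of _ v r] in \<open>fastforce simp: ball_def\<close>)+
qed

lemma clos_mono: "A \<subseteq> B \<Longrightarrow> clos A \<subseteq> clos B"
  by (auto simp: clos_def)

lemma measure_eq_of_cyls:
  assumes "sets \<mu>1 = sets (cfg_space S)" "prob_space \<mu>1" "sets \<mu>2 = sets (cfg_space S)" "prob_space \<mu>2"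
    and eq: "\<And>B. B \<in> cyls \<Longrightarrow> measure \<mu>1 B = measure \<mu>2 B"
  shows "\<mu>1 = \<mu>2"
proof (rule measure_eqI_generator_eq[OF Int_stable_prod_algebra cyls_subset])
  interpret p1: prob_space \<mu>1 by fact
  interpret p2: prob_space \<mu>2 by fact
  fix B assume "B \<in> cyls"
  then show "emeasure \<mu>1 B = emeasure \<mu>2 B"
    using eq by (simp add: p1.emeasure_eq_measure p2.emeasure_eq_measure)
next
  interpret p1: prob_space \<mu>1 by fact
  show "emeasure \<mu>1 ((\<lambda>_ :: nat. Om) i) \<noteq> \<infinity>" for i by simp
qed (use assms sets_cfg Om_in_cyls in auto)

end

section \<open>Exchange of two copies and probability of bad paths\<close>

context ground
begin

definition bad :: "('v \<Rightarrow> 'a) \<times> ('v \<Rightarrow> 'a) \<Rightarrow> 'v \<Rightarrow> bool" where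
  "bad x v \<longleftrightarrow> fst x v \<noteq> gs v \<or> snd x v \<noteq> gs v"

text \<open>The core is computed from \<open>bad x\<close>, which treats the two copies alike. The
  exchange leaves it unchanged, and \<open>swap \<Lambda>\<close> is an involution although its
  region depends on \<open>x\<close>.\<close>

definition swap :: "'v set \<Rightarrow> ('v \<Rightarrow> 'a) \<times> ('v \<Rightarrow> 'a) \<Rightarrow> ('v \<Rightarrow> 'a) \<times> ('v \<Rightarrow> 'a)" where
  "swap \<Lambda> x = (\<lambda>v. if v \<in> core (bad x) \<Lambda> then snd x v else fst x v,
               \<lambda>v. if v \<in> core (bad x) \<Lambda> then fst x v else snd x v)"

lemma bad_swap [simp]: "bad (swap \<Lambda> x) = bad x"
  by (auto simp: bad_def swap_def fun_eq_iff)

lemma swap_swap [simp]: "swap \<Lambda> (swap \<Lambda> x) = x"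
proof -
  have "swap \<Lambda> (swap \<Lambda> x) = (\<lambda>v. if v \<in> core (bad x) \<Lambda> then snd (swap \<Lambda> x) v else fst (swap \<Lambda> x) v,
               \<lambda>v. if v \<in> core (bad x) \<Lambda> then fst (swap \<Lambda> x) v else snd (swap \<Lambda> x) v)"
    by (subst swap_def) simp
  also have "\<dots> = (fst x, snd x)" unfolding swap_def fst_conv snd_conv by (rule arg_cong2[where f = Pair]) auto
  finally show ?thesis by simp
qed

lemma swap_cfgs: "x \<in> cfgs S W gs \<times> cfgs S W gs \<Longrightarrow> swap \<Lambda> x \<in> cfgs S W gs \<times> cfgs S W gs"
  by (auto simp: swap_def cfgs_def)

lemma pmf_window:
  assumes "\<And>A. measure (measure_pmf p) A = measure \<mu> {\<sigma> \<in> Om. res W gs \<sigma> \<in> A}"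
  shows "pmf p a = (if a \<in> cfgs S W gs then measure \<mu> (Om \<inter> agree W a) else 0)"
proof -
  have "pmf p a = measure \<mu> {\<sigma> \<in> Om. res W gs \<sigma> \<in> {a}}"
    using assms[of "{a}"] by (simp add: measure_pmf_single)
  also have "{\<sigma> \<in> Om. res W gs \<sigma> \<in> {a}} = (if a \<in> cfgs S W gs then Om \<inter> agree W a else {})"
    unfolding res_vimage_eq by auto
  finally show ?thesis by simp
qed

text \<open>Both copies equal the ground state on the boundary of the core, so exchanging them inside
  the core preserves the product of two Gibbs measures.\<close>
lemma swap_invariant:
  assumes "gibbs \<mu>1" "gibbs \<mu>2" and W: "W = ball r (Suc n)"
    and p1: "\<And>A. measure (measure_pmf p1) A = measure \<mu>1 {\<sigma> \<in> Om. res W gs \<sigma> \<in> A}"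
    and p2: "\<And>A. measure (measure_pmf p2) A = measure \<mu>2 {\<sigma> \<in> Om. res W gs \<sigma> \<in> A}"
  shows "map_pmf (swap (ball r n)) (pair_pmf p1 p2) = pair_pmf p1 p2"
proof -
  let ?\<Lambda> = "ball r n" and ?PP = "pair_pmf p1 p2"
  have finW: "finite W" by (simp add: W)
  have inv: "pmf ?PP (swap ?\<Lambda> x) = pmf ?PP x" if x: "x \<in> cfgs S W gs \<times> cfgs S W gs" for x
  proof -
    obtain a b where ab: "x = (a, b)" by (cases x)
    define G where "G = core (bad x) ?\<Lambda>"
    obtain a' b' where ab': "swap ?\<Lambda> x = (a', b')" by (cases "swap ?\<Lambda> x")
    have a': "a' = (\<lambda>v. if v \<in> G then b v else a v)" and b': "b' = (\<lambda>v. if v \<in> G then a v else b v)"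
      using ab' by (auto simp: swap_def G_def ab)
    have GL: "G \<subseteq> ?\<Lambda>" unfolding G_def by (rule core_subset)
    then have finG: "finite G" by (rule finite_subset) simp
    have GW: "clos G \<subseteq> W" using clos_mono[OF GL] clos_ball[of r n] W by auto
    have mem: "a \<in> cfgs S W gs" "b \<in> cfgs S W gs" "a' \<in> cfgs S W gs" "b' \<in> cfgs S W gs"
      using x swap_cfgs[OF x, of ?\<Lambda>] unfolding ab' unfolding ab by auto
    then have Om: "a \<in> Om" "b \<in> Om" "a' \<in> Om" "b' \<in> Om" using cfgs_Om[OF gs_Om] by auto
    \<comment> \<open>A vertex that is not bad has the ground-state spin in both copies, so the two
      copies give the core the same boundary condition and their conditional weights can be
      exchanged.\<close>
    have bnd: "a v = b v" if "v \<in> clos G" "v \<notin> G" for v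
    proof -
      obtain w where "w \<in> G" "adj w v" using \<open>v \<in> clos G\<close> \<open>v \<notin> G\<close> by (auto simp: clos_def)
      then have "\<not> bad x v" using core_boundary[of w "bad x" ?\<Lambda> v] \<open>v \<notin> G\<close> by (auto simp: G_def)
      then show ?thesis by (simp add: bad_def ab)
    qed
    have c: "cond G a' = cond G b" "cond G b' = cond G a"
      by (rule cond_local; use bnd in \<open>auto simp: a' b'\<close>)+
    have ag: "agree (W - G) a' = agree (W - G) a" "agree (W - G) b' = agree (W - G) b"
      by (auto simp: agree_def a' b')
    note at1 = gibbs_atom[OF assms(1) finG finW GW] and at2 = gibbs_atom[OF assms(2) finG finW GW]
    have "pmf ?PP (swap ?\<Lambda> x) = measure \<mu>1 (Om \<inter> agree W a') * measure \<mu>2 (Om \<inter> agree W b')"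
      unfolding ab' pmf_pair pmf_window[OF p1] pmf_window[OF p2] using mem by simp
    also have "\<dots> = measure \<mu>1 (Om \<inter> agree W a) * measure \<mu>2 (Om \<inter> agree W b)"
      unfolding at1[OF Om(1)] at1[OF Om(3)] at2[OF Om(2)] at2[OF Om(4)] c ag by simp
    also have "\<dots> = pmf ?PP x"
      unfolding ab pmf_pair pmf_window[OF p1] pmf_window[OF p2] using mem by simp
    finally show ?thesis .
  qed
  have inv': "pmf ?PP (swap ?\<Lambda> x) = pmf ?PP x" for x
  proof (cases "x \<in> cfgs S W gs \<times> cfgs S W gs")
    case False
    then have "swap ?\<Lambda> x \<notin> cfgs S W gs \<times> cfgs S W gs"
      using swap_cfgs[of "swap ?\<Lambda> x" W ?\<Lambda>] by auto
    moreover have z: "pmf ?PP y = 0" if "y \<notin> cfgs S W gs \<times> cfgs S W gs" for y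
      using that by (cases y) (auto simp: pmf_pair pmf_window[OF p1] pmf_window[OF p2])
    ultimately show ?thesis using False z by simp
  qed (rule inv)
  have "inj (swap ?\<Lambda>)" by (rule inj_on_inverseI[of _ "swap ?\<Lambda>"]) simp
  then have "pmf (map_pmf (swap ?\<Lambda>) ?PP) (swap ?\<Lambda> x) = pmf ?PP x" for x
    by (rule pmf_map_inj')
  then show ?thesis
    using inv' by (intro pmf_eqI) (metis swap_swap)
qed

abbreviation "\<kappa> \<equiv> \<delta> * (2 + \<delta>)"

lemma h_total: "(\<integral>\<^sup>+b. ennreal (h v b) \<partial>count_space S) \<le> ennreal (1 + \<delta>)"
proof -
  have "(\<integral>\<^sup>+b. ennreal (h v b) \<partial>count_space S) =
    (\<integral>\<^sup>+b. ennreal (h v b) * indicator {gs v} b + ennreal (h v b) * indicator (S - {gs v}) b \<partial>count_space S)"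
    by (intro nn_integral_cong) (auto split: split_indicator)
  also have "\<dots> = (\<integral>\<^sup>+b. ennreal (h v b) * indicator {gs v} b \<partial>count_space S) +
     (\<integral>\<^sup>+b. ennreal (h v b) * indicator (S - {gs v}) b \<partial>count_space S)"
    by (rule nn_integral_add) auto
  also have "(\<integral>\<^sup>+b. ennreal (h v b) * indicator {gs v} b \<partial>count_space S) = 1"
    using gs_mem[of v] by (subst nn_integral_count_space'[of "{gs v}"]) (auto simp: h_ground)
  also have "(\<integral>\<^sup>+b. ennreal (h v b) * indicator (S - {gs v}) b \<partial>count_space S) =
     (\<integral>\<^sup>+b. ennreal (h v b) \<partial>count_space (S - {gs v}))"
    by (auto simp: nn_integral_count_space_indicator intro!: nn_integral_cong split: split_indicator)
  also have "1 + \<dots> \<le> ennreal 1 + ennreal \<delta>"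
    using h_sum[of v] by (intro add_mono) auto
  finally show ?thesis using \<delta>_nonneg by simp
qed

text \<open>The flag \<open>l\<close> marks the vertices at which at least one of the two copies has
  to be off the ground state.\<close>

definition pairw :: "bool \<Rightarrow> 'v \<Rightarrow> 'a \<Rightarrow> 'a \<Rightarrow> ennreal" where
  "pairw l v b c = ennreal (h v b) * ennreal (h v c) * (if l \<and> b = gs v \<and> c = gs v then 0 else 1)"

text \<open>Off-ground pairs are split by the first spin: either it is in the ground state and the
  second is not, mass at most \<open>\<delta>\<close>, or it is off the ground state and the second
  is free, mass at most \<open>\<delta> * (1 + \<delta>)\<close>. The sum of the two is
  \<open>\<kappa>\<close>.\<close>

lemma pairw_sum:
  "(\<integral>\<^sup>+b. \<integral>\<^sup>+c. pairw l v b c \<partial>count_space S \<partial>count_space S) \<le> ennreal (if l then \<kappa> else (1 + \<delta>)\<^sup>2)"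
proof (cases l)
  case False
  then have "(\<integral>\<^sup>+b. \<integral>\<^sup>+c. pairw l v b c \<partial>count_space S \<partial>count_space S) =
     (\<integral>\<^sup>+b. ennreal (h v b) \<partial>count_space S) * (\<integral>\<^sup>+b. ennreal (h v b) \<partial>count_space S)"
    by (simp add: pairw_def nn_integral_cmult nn_integral_multc)
  also have "\<dots> \<le> ennreal (1 + \<delta>) * ennreal (1 + \<delta>)"
    using h_total by (intro mult_mono) auto
  finally show ?thesis using False \<delta>_nonneg by (simp add: ennreal_mult[symmetric] power2_eq_square del: ennreal_plus)
next
  case True
  let ?T = "\<integral>\<^sup>+b. ennreal (h v b) \<partial>count_space S" and ?R = "\<integral>\<^sup>+b. ennreal (h v b) \<partial>count_space (S - {gs v})"
  have R: "(\<integral>\<^sup>+b. ennreal (h v b) * indicator (- {gs v}) b \<partial>count_space S) = ?R"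
    by (auto simp: nn_integral_count_space_indicator intro!: nn_integral_cong split: split_indicator)
  have O: "(\<integral>\<^sup>+b. ennreal (h v b) * indicator {gs v} b \<partial>count_space S) = 1"
    using gs_mem[of v] by (subst nn_integral_count_space'[of "{gs v}"]) (auto simp: h_ground)
  have "(\<integral>\<^sup>+b. \<integral>\<^sup>+c. pairw l v b c \<partial>count_space S \<partial>count_space S) =
    (\<integral>\<^sup>+b. ennreal (h v b) * indicator {gs v} b * ?R + ennreal (h v b) * indicator (- {gs v}) b * ?T \<partial>count_space S)"
  proof (intro nn_integral_cong)
    fix b
    show "(\<integral>\<^sup>+c. pairw l v b c \<partial>count_space S) =
      ennreal (h v b) * indicator {gs v} b * ?R + ennreal (h v b) * indicator (- {gs v}) b * ?T"
    proof (cases "b = gs v")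
      case b: True
      have "pairw l v b c = ennreal (h v b) * (ennreal (h v c) * indicator (- {gs v}) c)" for c
        using True b by (auto simp: pairw_def split: split_indicator)
      then show ?thesis using b R by (simp add: nn_integral_cmult)
    next
      case False
      then show ?thesis by (simp add: pairw_def nn_integral_cmult)
    qed
  qed
  also have "\<dots> = 1 * ?R + ?R * ?T"
    by (subst nn_integral_add) (simp_all add: nn_integral_multc R O)
  also have "\<dots> \<le> 1 * ennreal \<delta> + ennreal \<delta> * ennreal (1 + \<delta>)"
    using h_sum[of v] h_total[of v] by (intro add_mono mult_mono) auto
  also have "\<dots> = ennreal \<kappa>"
    using \<delta>_nonneg by (simp add: ennreal_mult[symmetric] ennreal_plus[symmetric] algebra_simps del: ennreal_plus)
  finally show ?thesis using True by simp
qed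

text \<open>The product bounds dominate the probability by a sum over pairs of path configurations
  that factorises over the vertices. The path meets each level up to \<open>n\<close> once: the
  \<open>Suc m\<close> levels near the root contribute \<open>(1 + \<delta>)\<^sup>2\<close> each,
  the remaining \<open>n - m\<close> contribute \<open>\<kappa>\<close>.\<close>

lemma bad_chain_prob:
  assumes B: "B = anc r u" "lev r u = n" "m < n"
    and q1: "\<And>a. pmf q1 a \<le> (if a \<in> cfgs S B gs then K1 * (\<Prod>v\<in>B. h v (a v)) else 0)"
    and q2: "\<And>a. pmf q2 a \<le> (if a \<in> cfgs S B gs then K2 * (\<Prod>v\<in>B. h v (a v)) else 0)"
    and K: "0 \<le> K1" "0 \<le> K2"
  shows "measure (pair_pmf q1 q2) {x. \<forall>v\<in>B. m < lev r v \<longrightarrow> bad x v} \<le> K1 * K2 * ((1 + \<delta>)\<^sup>2 ^ Suc m * \<kappa> ^ (n - m))"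
proof -
  let ?E = "{x. \<forall>v\<in>B. m < lev r v \<longrightarrow> bad x v}"
  let ?C = "cfgs S B gs"
  have finB: "finite B" by (simp add: B)
  have pw: "ennreal (\<Prod>v\<in>B. h v (a v)) * ennreal (\<Prod>v\<in>B. h v (b v)) * indicator ?E (a, b) = (\<Prod>v\<in>B. pairw (m < lev r v) v (a v) (b v))" for a b
  proof -
    have "indicator ?E (a, b) = (\<Prod>v\<in>B. if m < lev r v \<and> a v = gs v \<and> b v = gs v then 0 else 1 :: ennreal)"
    proof (cases "(a, b) \<in> ?E")
      case True
      then have "(\<Prod>v\<in>B. if m < lev r v \<and> a v = gs v \<and> b v = gs v then 0 else 1 :: ennreal) = (\<Prod>v\<in>B. 1)"
        by (intro prod.cong) (auto simp: bad_def)
      then show ?thesis using True by simp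
    next
      case False
      then have "\<exists>v\<in>B. m < lev r v \<and> a v = gs v \<and> b v = gs v" by (auto simp: bad_def)
      then have "(\<Prod>v\<in>B. if m < lev r v \<and> a v = gs v \<and> b v = gs v then 0 else 1 :: ennreal) = 0"
        using finB by (intro prod_zero) auto
      then show ?thesis using False by simp
    qed
    then show ?thesis
      unfolding pairw_def prod.distrib using h_nonneg by (simp add: prod_ennreal)
  qed
  have "emeasure (pair_pmf q1 q2) ?E = (\<integral>\<^sup>+x. ennreal (pmf (pair_pmf q1 q2) x) * indicator ?E x \<partial>count_space UNIV)"
    unfolding nn_integral_pmf[symmetric] by (subst nn_integral_count_space_indicator) auto
  also have "\<dots> = (\<integral>\<^sup>+a. \<integral>\<^sup>+b. ennreal (pmf q1 a * pmf q2 b) * indicator ?E (a, b) \<partial>count_space UNIV \<partial>count_space UNIV)"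
    unfolding nn_integral_fst_count_space[symmetric] pmf_pair ..
  also have "\<dots> \<le> (\<integral>\<^sup>+a. \<integral>\<^sup>+b. ennreal (K1 * K2) * ((\<Prod>v\<in>B. pairw (m < lev r v) v (a v) (b v)) * indicator ?C b) * indicator ?C a \<partial>count_space UNIV \<partial>count_space UNIV)"
  proof (intro nn_integral_mono)
    fix a b
    show "ennreal (pmf q1 a * pmf q2 b) * indicator ?E (a, b) \<le> ennreal (K1 * K2) * ((\<Prod>v\<in>B. pairw (m < lev r v) v (a v) (b v)) * indicator ?C b) * indicator ?C a"
    proof (cases "a \<in> ?C \<and> b \<in> ?C")
      case True
      have "pmf q1 a * pmf q2 b \<le> (K1 * (\<Prod>v\<in>B. h v (a v))) * (K2 * (\<Prod>v\<in>B. h v (b v)))"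
        using q1[of a] q2[of b] True K h_nonneg by (intro mult_mono) (auto intro!: mult_nonneg_nonneg prod_nonneg)
      then have "ennreal (pmf q1 a * pmf q2 b) \<le> ennreal (K1 * K2) * (ennreal (\<Prod>v\<in>B. h v (a v)) * ennreal (\<Prod>v\<in>B. h v (b v)))"
        using K h_nonneg by (simp add: ennreal_mult[symmetric] prod_nonneg mult_ac ennreal_leI)
      then have "ennreal (pmf q1 a * pmf q2 b) * indicator ?E (a, b) \<le>
         ennreal (K1 * K2) * (ennreal (\<Prod>v\<in>B. h v (a v)) * ennreal (\<Prod>v\<in>B. h v (b v))) * indicator ?E (a, b)"
        by (rule mult_right_mono) simp
      then show ?thesis using True unfolding pw[symmetric] by (simp add: mult.assoc)
    next
      case False
      then have "pmf q1 a = 0 \<or> pmf q2 b = 0"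
        using q1[of a] q2[of b] pmf_nonneg[of q1 a] pmf_nonneg[of q2 b] by (auto split: if_splits intro: antisym)
      then show ?thesis by auto
    qed
  qed
  also have "\<dots> = ennreal (K1 * K2) * (\<integral>\<^sup>+a. \<integral>\<^sup>+b. (\<Prod>v\<in>B. pairw (m < lev r v) v (a v) (b v)) \<partial>count_space ?C \<partial>count_space ?C)"
  proof -
    let ?P = "\<lambda>a b. \<Prod>v\<in>B. pairw (m < lev r v) v (a v) (b v)"
    have "(\<integral>\<^sup>+b. ennreal (K1 * K2) * (?P a b * indicator ?C b) * indicator ?C a \<partial>count_space UNIV) =
       ennreal (K1 * K2) * ((\<integral>\<^sup>+b. ?P a b * indicator ?C b \<partial>count_space UNIV) * indicator ?C a)" for a
      by (subst nn_integral_multc, simp, subst nn_integral_cmult, simp, rule mult.assoc)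
    then show ?thesis
      unfolding nn_integral_count_space_indicator[of ?C, unfolded NO_MATCH_def, OF TrueI]
      by (simp add: nn_integral_cmult)
  qed
  also have "(\<integral>\<^sup>+a. \<integral>\<^sup>+b. (\<Prod>v\<in>B. pairw (m < lev r v) v (a v) (b v)) \<partial>count_space ?C \<partial>count_space ?C) =
     (\<integral>\<^sup>+a. (\<Prod>v\<in>B. \<integral>\<^sup>+c. pairw (m < lev r v) v (a v) c \<partial>count_space S) \<partial>count_space ?C)"
    by (intro nn_integral_cong nn_integral_cfgs_prod finB)
  also have "\<dots> = (\<Prod>v\<in>B. \<integral>\<^sup>+b. \<integral>\<^sup>+c. pairw (m < lev r v) v b c \<partial>count_space S \<partial>count_space S)"
    by (rule nn_integral_cfgs_prod[OF finB])
  also have "\<dots> \<le> (\<Prod>v\<in>B. ennreal (if m < lev r v then \<kappa> else (1 + \<delta>)\<^sup>2))"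
    by (intro prod_mono_ennreal pairw_sum)
  also have "\<dots> = ennreal (\<Prod>v\<in>B. if m < lev r v then \<kappa> else (1 + \<delta>)\<^sup>2)"
    using \<delta>_nonneg by (intro prod_ennreal) auto
  also have "(\<Prod>v\<in>B. if m < lev r v then \<kappa> else (1 + \<delta>)\<^sup>2) = (\<Prod>k\<in>{..n}. if m < k then \<kappa> else (1 + \<delta>)\<^sup>2)"
    using anc_lev_image[of r u] anc_inj_lev[of r u] unfolding B(1) B(2)[symmetric]
    by (metis (no_types, lifting) prod.reindex_cong)
  also have "\<dots> = (\<Prod>k\<in>{..m} \<union> {m<..n}. if m < k then \<kappa> else (1 + \<delta>)\<^sup>2)"
    using B(3) by (intro prod.cong) auto
  also have "\<dots> = (\<Prod>k\<in>{..m}. if m < k then \<kappa> else (1 + \<delta>)\<^sup>2) * (\<Prod>k\<in>{m<..n}. if m < k then \<kappa> else (1 + \<delta>)\<^sup>2)"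
    by (intro prod.union_disjoint) auto
  also have "\<dots> = (\<Prod>k\<in>{..m}. (1 + \<delta>)\<^sup>2) * (\<Prod>k\<in>{m<..n}. \<kappa>)"
    by (intro arg_cong2[where f = "(*)"] prod.cong) auto
  also have "\<dots> = (1 + \<delta>)\<^sup>2 ^ Suc m * \<kappa> ^ (n - m)" by simp
  finally have "emeasure (pair_pmf q1 q2) ?E \<le> ennreal (K1 * K2) * ennreal ((1 + \<delta>)\<^sup>2 ^ Suc m * \<kappa> ^ (n - m))"
    by this (rule mult_left_mono, assumption, simp)
  then have "ennreal (measure (pair_pmf q1 q2) ?E) \<le> ennreal (K1 * K2 * ((1 + \<delta>)\<^sup>2 ^ Suc m * \<kappa> ^ (n - m)))"
    using K \<delta>_nonneg by (simp add: measure_pmf.emeasure_eq_measure ennreal_mult[symmetric])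
  then show ?thesis
    using K \<delta>_nonneg by (subst (asm) ennreal_le_iff) (auto intro!: mult_nonneg_nonneg zero_le_power)
qed

end

context ground
begin

lemma pmf_window_sub:
  assumes p: "\<And>A. measure (measure_pmf p) A = measure \<mu> {\<sigma> \<in> Om. res W gs \<sigma> \<in> A}" and "B \<subseteq> W"
  shows "pmf (map_pmf (res B gs) p) a = (if a \<in> cfgs S B gs then measure \<mu> (Om \<inter> agree B a) else 0)"
proof (rule pmf_window)
  fix A
  have "res B gs (res W gs \<sigma>) = res B gs \<sigma>" for \<sigma> using assms(2) by (auto simp: res_def fun_eq_iff)
  then show "measure (map_pmf (res B gs) p) A = measure \<mu> {\<sigma> \<in> Om. res B gs \<sigma> \<in> A}"
    by (simp add: p measure_map_pmf)
qed

text \<open>Disagreement percolation: two Gibbs measures can differ near the root only if a chain of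
  disagreements with the ground state, in one copy or the other, reaches far away.\<close>
lemma gibbs_unique:
  assumes g: "gibbs \<mu>1" "gibbs \<mu>2" and K: "0 \<le> K1" "0 \<le> K2"
    and b1: "\<And>u a. a \<in> Om \<Longrightarrow> measure \<mu>1 (Om \<inter> agree (anc r u) a) \<le> K1 * (\<Prod>v\<in>anc r u. h v (a v))"
    and b2: "\<And>u a. a \<in> Om \<Longrightarrow> measure \<mu>2 (Om \<inter> agree (anc r u) a) \<le> K2 * (\<Prod>v\<in>anc r u. h v (a v))"
  shows "\<mu>1 = \<mu>2"
proof (rule measure_eq_of_cyls)
  show sets: "sets \<mu>1 = sets (cfg_space S)" "sets \<mu>2 = sets (cfg_space S)"
    and ps: "prob_space \<mu>1" "prob_space \<mu>2"
    using g by (auto simp: is_gibbs_def)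
  fix Y assume "Y \<in> cyls"
  then obtain J E where J: "finite J" and Y: "Y = {\<sigma> \<in> Om. \<forall>j\<in>J. \<sigma> j \<in> E j}" by (rule cylsE)
  obtain m where m: "J \<subseteq> ball r m" using finite_subset_ball[OF J] by blast
  define A where "A = {a. \<forall>j\<in>J. a j \<in> E j}"
  \<comment> \<open>The part of the final bound that depends on \<open>m\<close> only; the rest is a
    power of \<open>Suc d * \<kappa>\<close>, which is below 1 by
    \<open>\<delta>_small\<close>.\<close>
  define c where "c = K1 * K2 * (1 + \<delta>)\<^sup>2 ^ Suc m * real (Suc d) ^ m"
  have bound: "\<bar>measure \<mu>1 Y - measure \<mu>2 Y\<bar> \<le> c * (real (Suc d) * \<kappa>) ^ Suc j" for j
  proof -
    define n where "n = Suc m + j"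
    \<comment> \<open>One level more than the volume, so that the window contains the closure of
      \<open>ball r n\<close>.\<close>
    define W where "W = ball r (Suc n)"
    have finW: "finite W" by (simp add: W_def)
    have mn: "m < n" by (simp add: n_def)
    obtain p1 where p1: "\<And>A. measure (measure_pmf p1) A = measure \<mu>1 {\<sigma> \<in> Om. res W gs \<sigma> \<in> A}"
      using window_pmf[OF sets(1) ps(1) finW, of gs] by blast
    obtain p2 where p2: "\<And>A. measure (measure_pmf p2) A = measure \<mu>2 {\<sigma> \<in> Om. res W gs \<sigma> \<in> A}"
      using window_pmf[OF sets(2) ps(2) finW, of gs] by blast
    let ?PP = "pair_pmf p1 p2" and ?\<Lambda> = "ball r n"
    have JW: "J \<subseteq> W" using m ball_mono[of m "Suc n" r] mn by (auto simp: W_def)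
    have "{\<sigma> \<in> Om. res W gs \<sigma> \<in> A} = Y" using JW by (auto simp: A_def Y res_def)
    then have Y1: "measure \<mu>1 Y = measure p1 A" and Y2: "measure \<mu>2 Y = measure p2 A"
      using p1[of A] p2[of A] by auto
    have P1: "measure p1 A = measure ?PP {x. fst x \<in> A}"
      using arg_cong[OF map_fst_pair_pmf[of p1 p2], of "\<lambda>p. measure p A"] by (simp add: measure_map_pmf vimage_def)
    have P2: "measure p2 A = measure ?PP {x. snd x \<in> A}"
      using arg_cong[OF map_snd_pair_pmf[of p1 p2], of "\<lambda>p. measure p A"] by (simp add: measure_map_pmf vimage_def)
    \<comment> \<open>Off this event, \<open>swap\<close> exchanges all spins on
      \<open>ball r m\<close>, and with them the event \<open>A\<close> for the first copy and for
      the second. The two probabilities thus differ by at most that of \<open>N\<close>.\<close>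
    define N where "N = {x. \<not> ball r m \<subseteq> core (bad x) ?\<Lambda>}"
    have "measure ?PP ({x. fst x \<in> A} - N) = measure (map_pmf (swap ?\<Lambda>) ?PP) ({x. fst x \<in> A} - N)"
      using swap_invariant[OF g W_def p1 p2] by simp
    also have "\<dots> = measure ?PP (swap ?\<Lambda> -` ({x. fst x \<in> A} - N))"
      by (simp add: measure_map_pmf)
    also have "swap ?\<Lambda> -` ({x. fst x \<in> A} - N) = {x. snd x \<in> A} - N"
    proof -
      have "fst (swap ?\<Lambda> x) \<in> A \<longleftrightarrow> snd x \<in> A" if "x \<notin> N" for x
      proof -
        have "fst (swap ?\<Lambda> x) j = snd x j" if "j \<in> J" for j
          using \<open>x \<notin> N\<close> m that by (auto simp: N_def swap_def)
        then show ?thesis by (simp add: A_def)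
      qed
      moreover have "swap ?\<Lambda> x \<in> N \<longleftrightarrow> x \<in> N" for x by (simp add: N_def)
      ultimately show ?thesis by blast
    qed
    finally have eq: "measure ?PP ({x. fst x \<in> A} - N) = measure ?PP ({x. snd x \<in> A} - N)" .
    have le: "measure ?PP X - measure ?PP N \<le> measure ?PP (X - N)" "measure ?PP (X - N) \<le> measure ?PP X" for X
    proof -
      have "measure ?PP X \<le> measure ?PP ((X - N) \<union> N)" by (intro measure_pmf.finite_measure_mono) auto
      also have "\<dots> \<le> measure ?PP (X - N) + measure ?PP N" by (rule measure_Un_le) auto
      finally show "measure ?PP X - measure ?PP N \<le> measure ?PP (X - N)" by simp
      show "measure ?PP (X - N) \<le> measure ?PP X" by (intro measure_pmf.finite_measure_mono) auto
    qed
    have "\<bar>measure \<mu>1 Y - measure \<mu>2 Y\<bar> \<le> measure ?PP N"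
      unfolding Y1 Y2 P1 P2 using le[of "{x. fst x \<in> A}"] le[of "{x. snd x \<in> A}"] eq by linarith
    also have "\<dots> \<le> (\<Sum>u | lev r u = n. measure ?PP {x. \<forall>v\<in>anc r u. m < lev r v \<longrightarrow> bad x v})"
    proof -
      have "N \<subseteq> (\<Union>u\<in>{u. lev r u = n}. {x. \<forall>v\<in>anc r u. m < lev r v \<longrightarrow> bad x v})"
        using not_core_chain[OF _ mn, of r] unfolding N_def by blast
      then have "measure ?PP N \<le> measure ?PP (\<Union>u\<in>{u. lev r u = n}. {x. \<forall>v\<in>anc r u. m < lev r v \<longrightarrow> bad x v})"
        by (intro measure_pmf.finite_measure_mono) auto
      also have "\<dots> \<le> (\<Sum>u | lev r u = n. measure ?PP {x. \<forall>v\<in>anc r u. m < lev r v \<longrightarrow> bad x v})"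
        using sphere_card[of r n] by (intro measure_UNION_le) auto
      finally show ?thesis .
    qed
    also have "\<dots> \<le> (\<Sum>u | lev r u = n. K1 * K2 * ((1 + \<delta>)\<^sup>2 ^ Suc m * \<kappa> ^ (n - m)))"
    proof (rule sum_mono)
      fix u assume "u \<in> {u. lev r u = n}"
      then have u: "lev r u = n" by simp
      let ?B = "anc r u"
      have BW: "?B \<subseteq> W" using anc_lev_le[of _ r u] u by (fastforce simp: W_def ball_def)
      let ?E = "{x. \<forall>v\<in>?B. m < lev r v \<longrightarrow> bad x v}"
      have "(\<lambda>(a, b). (res ?B gs a, res ?B gs b)) -` ?E = ?E" by (auto simp: bad_def res_def)
      then have "measure ?PP ?E = measure (map_pmf (\<lambda>(a, b). (res ?B gs a, res ?B gs b)) ?PP) ?E"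
        by (simp add: measure_map_pmf)
      also have "\<dots> = measure (pair_pmf (map_pmf (res ?B gs) p1) (map_pmf (res ?B gs) p2)) ?E"
        by (simp only: map_pair)
      also have "\<dots> \<le> K1 * K2 * ((1 + \<delta>)\<^sup>2 ^ Suc m * \<kappa> ^ (n - m))"
      proof (rule bad_chain_prob[OF refl u mn _ _ K])
        fix a
        show "pmf (map_pmf (res ?B gs) p1) a \<le> (if a \<in> cfgs S ?B gs then K1 * (\<Prod>v\<in>?B. h v (a v)) else 0)"
          unfolding pmf_window_sub[OF p1 BW] using b1[of a u] cfgs_Om[OF gs_Om, of ?B] by auto
        show "pmf (map_pmf (res ?B gs) p2) a \<le> (if a \<in> cfgs S ?B gs then K2 * (\<Prod>v\<in>?B. h v (a v)) else 0)"
          unfolding pmf_window_sub[OF p2 BW] using b2[of a u] cfgs_Om[OF gs_Om, of ?B] by auto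
      qed
      finally show "measure ?PP ?E \<le> K1 * K2 * ((1 + \<delta>)\<^sup>2 ^ Suc m * \<kappa> ^ (n - m))" .
    qed
    also have "\<dots> = real (card {u. lev r u = n}) * (K1 * K2 * ((1 + \<delta>)\<^sup>2 ^ Suc m * \<kappa> ^ (n - m)))"
      by simp
    also have "\<dots> \<le> real (Suc d ^ n) * (K1 * K2 * ((1 + \<delta>)\<^sup>2 ^ Suc m * \<kappa> ^ (n - m)))"
    proof (rule mult_right_mono)
      show "real (card {u. lev r u = n}) \<le> real (Suc d ^ n)"
        using sphere_card[of r n] by (simp only: of_nat_le_iff)
      show "0 \<le> K1 * K2 * ((1 + \<delta>)\<^sup>2 ^ Suc m * \<kappa> ^ (n - m))"
        using K \<delta>_nonneg by (intro mult_nonneg_nonneg zero_le_power) auto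
    qed
    also have "\<dots> = c * (real (Suc d) * \<kappa>) ^ Suc j"
    proof -
      have "real (Suc d ^ n) = real (Suc d) ^ m * real (Suc d) ^ Suc j"
        by (simp only: n_def power_add[symmetric] of_nat_power) simp
      moreover have "n - m = Suc j" by (simp add: n_def)
      ultimately show ?thesis
        by (simp only: c_def power_mult_distrib) (simp only: mult_ac)
    qed
    finally show ?thesis .
  qed
  have "(\<lambda>j. (real (Suc d) * \<kappa>) ^ Suc j) \<longlonglongrightarrow> 0"
    using \<delta>_small \<delta>_nonneg by (intro LIMSEQ_Suc LIMSEQ_power_zero) (simp add: abs_mult)
  then have "(\<lambda>j. c * (real (Suc d) * \<kappa>) ^ Suc j) \<longlonglongrightarrow> c * 0"
    by (intro tendsto_mult tendsto_const)
  then have "\<bar>measure \<mu>1 Y - measure \<mu>2 Y\<bar> \<le> c * 0"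
    using bound by (intro LIMSEQ_le_const) auto
  then show "measure \<mu>1 Y = measure \<mu>2 Y" by simp
qed

text \<open>The constants \<open>K1\<close> and \<open>K2\<close> of \<open>gibbs_unique\<close> are
  made for this use: the components inherit the path bound with the factors \<open>1 / t\<close> and
  \<open>1 / (1 - t)\<close>.\<close>

lemma extremalI:
  assumes "gibbs \<mu>"
    and b: "\<And>u a. a \<in> Om \<Longrightarrow> measure \<mu> (Om \<inter> agree (anc r u) a) \<le> (\<Prod>v\<in>anc r u. h v (a v))"
  shows "extremal_gibbs S adj \<Phi> \<Psi> \<beta> \<mu>"
  unfolding extremal_gibbs_def
proof (intro conjI allI impI)
  show "gibbs \<mu>" by fact
  fix \<mu>1 \<mu>2 t
  assume "0 < t \<and> t < 1 \<and> gibbs \<mu>1 \<and> gibbs \<mu>2 \<and> (\<forall>A\<in>sets \<mu>. measure \<mu> A = t * measure \<mu>1 A + (1 - t) * measure \<mu>2 A)"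
  then have t: "0 < t" "t < 1" and g: "gibbs \<mu>1" "gibbs \<mu>2"
    and mix: "\<And>A. A \<in> sets \<mu> \<Longrightarrow> measure \<mu> A = t * measure \<mu>1 A + (1 - t) * measure \<mu>2 A" by auto
  have sets: "sets \<mu> = sets (cfg_space S)" using assms(1) by (auto simp: is_gibbs_def)
  have atom: "Om \<inter> agree (anc r u) a \<in> sets \<mu>" for u a using sets_agree[of "anc r u" a] sets by simp
  have "\<mu>1 = \<mu>2"
  proof (rule gibbs_unique[OF g, of "1 / t" "1 / (1 - t)" r])
    fix u a assume a: "a \<in> Om"
    note * = mix[OF atom[of u a]] b[OF a, of u]
    have nn: "0 \<le> (1 - t) * measure \<mu>2 (Om \<inter> agree (anc r u) a)" "0 \<le> t * measure \<mu>1 (Om \<inter> agree (anc r u) a)" using t by auto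
    have "t * measure \<mu>1 (Om \<inter> agree (anc r u) a) \<le> (\<Prod>v\<in>anc r u. h v (a v))"
      using * nn by linarith
    then show "measure \<mu>1 (Om \<inter> agree (anc r u) a) \<le> 1 / t * (\<Prod>v\<in>anc r u. h v (a v))"
      using t by (simp add: field_simps)
    have "(1 - t) * measure \<mu>2 (Om \<inter> agree (anc r u) a) \<le> (\<Prod>v\<in>anc r u. h v (a v))"
      using * nn by linarith
    then show "measure \<mu>2 (Om \<inter> agree (anc r u) a) \<le> 1 / (1 - t) * (\<Prod>v\<in>anc r u. h v (a v))"
      using t by (simp add: field_simps)
  qed (use t in auto)
  then show "\<forall>A\<in>sets \<mu>. measure \<mu>1 A = measure \<mu>2 A" by simp
qed

end

section \<open>Infinite-volume limits\<close>

lemma bounded_sequence_limit_filter: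
  fixes X :: "nat \<Rightarrow> 'b \<Rightarrow> real"
  assumes "\<And>n b. X n b \<in> {0..1}"
  shows "\<exists>F m. F \<noteq> bot \<and> F \<le> sequentially \<and> (\<forall>b. ((\<lambda>n. X n b) \<longlongrightarrow> m b) F)"
proof -
  let ?U = "\<Pi>\<^sub>E b\<in>(UNIV :: 'b set). {0..1 :: real}"
  have "compact ?U"
    unfolding compactin_euclidean_iff[symmetric] euclidean_product_topology[symmetric]
    by (subst compactin_PiE) (auto simp: compactin_euclidean_iff)
  moreover have "filtermap X sequentially \<noteq> bot" by (simp add: filtermap_bot_iff)
  moreover have "eventually (\<lambda>x. x \<in> ?U) (filtermap X sequentially)"
    unfolding eventually_filtermap using assms by (intro always_eventually) (auto simp: PiE_def Pi_def)
  ultimately obtain x where x: "inf (nhds x) (filtermap X sequentially) \<noteq> bot"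
    unfolding compact_filter by blast
  \<comment> \<open>The large indices whose values are close to the cluster point; clustering is
    what keeps this filter proper.\<close>
  define F where "F = inf (filtercomap X (nhds x)) sequentially"
  have "F \<noteq> bot"
  proof
    assume "F = bot"
    then have "eventually (\<lambda>_. False) F" by simp
    then obtain P Q where PQ: "eventually P (filtercomap X (nhds x))" "eventually Q sequentially" "\<And>n. \<not> (P n \<and> Q n)"
      unfolding F_def eventually_inf by blast
    then obtain R where R: "eventually R (nhds x)" "\<And>n. R (X n) \<Longrightarrow> P n"
      unfolding eventually_filtercomap by blast
    have "eventually (\<lambda>y. \<not> R y) (filtermap X sequentially)"
      unfolding eventually_filtermap using PQ(2) by (rule eventually_mono) (use PQ(3) R(2) in blast)
    then have "eventually (\<lambda>_. False) (inf (nhds x) (filtermap X sequentially))"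
      unfolding eventually_inf using R(1) by blast
    then show False using x by (simp add: eventually_False)
  qed
  moreover have "F \<le> sequentially" by (simp add: F_def)
  moreover have "((\<lambda>n. X n b) \<longlongrightarrow> x b) F" for b
  proof -
    have "filterlim X (nhds x) F"
      unfolding filterlim_def F_def by (meson filtermap_filtercomap filtermap_mono inf.cobounded1 order_trans)
    moreover have "continuous_on UNIV (\<lambda>y :: 'b \<Rightarrow> real. y b)" by (rule continuous_on_product_coordinates)
    then have "eventually (\<lambda>y. y \<in> (\<lambda>y. y b) -` U) (nhds x)" if "open U" "x b \<in> U" for U
      using that by (intro eventually_nhds_in_open open_vimage) auto
    ultimately show ?thesis
      by (intro topological_tendstoI) (auto simp: filterlim_iff)
  qed
  ultimately show ?thesis by blast
qed

text \<open>Tightness turns a finitely additive limit of discrete distributions into a discrete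
  distribution.\<close>
lemma limit_pmf:
  fixes p :: "nat \<Rightarrow> 'b pmf"
  assumes F: "F \<noteq> bot" and lim: "\<And>A. ((\<lambda>n. measure (p n) A) \<longlongrightarrow> m A) F"
    and tight: "\<And>\<epsilon>. \<epsilon> > 0 \<Longrightarrow> \<exists>K. finite K \<and> eventually (\<lambda>n. measure (p n) (- K) \<le> \<epsilon>) F"
  shows "\<exists>q. \<forall>A. measure (measure_pmf q) A = m A"
proof -
  have m_eq: "m A = c" if "((\<lambda>n. measure (p n) A) \<longlongrightarrow> c) F" for A c
    using tendsto_unique[OF F lim that] .
  have m_nonneg: "0 \<le> m A" for A
    by (rule tendsto_lowerbound[OF lim[of A] _ F]) simp
  have m_union: "m (A \<union> B) = m A + m B" if "A \<inter> B = {}" for A B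
  proof (rule m_eq)
    have "measure (p n) (A \<union> B) = measure (p n) A + measure (p n) B" for n
      using that by (intro measure_pmf.finite_measure_Union) auto
    then show "((\<lambda>n. measure (p n) (A \<union> B)) \<longlongrightarrow> m A + m B) F"
      using tendsto_add[OF lim lim] by simp
  qed
  have m_empty: "m {} = 0" by (rule m_eq) simp
  have m_UNIV: "m UNIV = 1" by (rule m_eq) simp
  have m_compl: "m (- A) = 1 - m A" for A
    using m_union[of A "- A"] m_UNIV by simp
  have m_mono: "m A \<le> m B" if "A \<subseteq> B" for A B
    using m_union[of A "B - A"] m_nonneg[of "B - A"] that by (simp add: Un_absorb1)
  have m_fin: "m K = (\<Sum>x\<in>K. m {x})" if "finite K" for K
    using that
  proof (induction K)
    case (insert x K)
    then show ?case using m_union[of "{x}" K] by simp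
  qed (simp add: m_empty)
  have tight': "\<exists>K. finite K \<and> m (- K) \<le> \<epsilon>" if "\<epsilon> > 0" for \<epsilon>
  proof -
    from tight[OF that] obtain K where K: "finite K" "eventually (\<lambda>n. measure (p n) (- K) \<le> \<epsilon>) F" by blast
    then show ?thesis using tendsto_upperbound[OF lim _ F] by blast
  qed
  define f where "f x = m {x}" for x
  have f_nn: "0 \<le> f x" for x by (simp add: f_def m_nonneg)
  have f_fin: "(\<integral>\<^sup>+x. ennreal (f x) \<partial>count_space K) = ennreal (m K)" if "finite K" for K
    using that m_nonneg by (simp add: nn_integral_count_space_finite m_fin[OF that] f_def sum_ennreal)
  have "(\<integral>\<^sup>+x. ennreal (f x) \<partial>count_space UNIV) \<le> 1"
  proof -
    have fle: "sum f K \<le> 1" if "finite K" for K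
      using m_fin[OF that] m_mono[of K UNIV] m_UNIV by (simp add: f_def)
    have "f summable_on UNIV"
      using fle m_nonneg by (intro nonneg_bdd_above_summable_on bdd_aboveI2[of _ _ 1]) (auto simp: f_def)
    then have int: "integrable (count_space UNIV) f"
      using abs_summable_equivalent[of f UNIV] f_nn by (simp add: abs_summable_on_def)
    have "(\<integral>\<^sup>+x. ennreal (f x) \<partial>count_space UNIV) = ennreal (integral\<^sup>L (count_space UNIV) f)"
      using int f_nn by (intro nn_integral_eq_integral) auto
    also have "integral\<^sup>L (count_space UNIV) f = infsum f UNIV"
      using infsetsum_infsum[of f UNIV] int by (simp add: abs_summable_on_def infsetsum_def)
    also have "infsum f UNIV \<le> 1"
      using \<open>f summable_on UNIV\<close> fle by (intro infsum_le_finite_sums) auto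
    finally show ?thesis by (simp add: ennreal_leI)
  qed
  \<comment> \<open>No mass escapes: by tightness, all but \<open>\<epsilon>\<close> of it sits on a
    finite set, where additivity is at hand.\<close>
  moreover have "1 \<le> (\<integral>\<^sup>+x. ennreal (f x) \<partial>count_space UNIV)"
  proof (rule ennreal_le_epsilon)
    fix \<epsilon> :: real assume \<epsilon>: "0 < \<epsilon>"
    obtain K where K: "finite K" "m (- K) \<le> \<epsilon>" using tight'[OF \<epsilon>] by blast
    have "ennreal (m K) \<le> (\<integral>\<^sup>+x. ennreal (f x) \<partial>count_space UNIV)"
      unfolding f_fin[OF K(1), symmetric] nn_integral_count_space_indicator[of K, unfolded NO_MATCH_def, OF TrueI]
      by (intro nn_integral_mono) (auto split: split_indicator)
    moreover have "1 \<le> m K + \<epsilon>" using m_compl[of K] K(2) by simp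
    then have "1 \<le> ennreal (m K) + ennreal \<epsilon>"
      using \<epsilon> m_nonneg[of K] by (simp add: ennreal_plus[symmetric] del: ennreal_plus)
    ultimately show "1 \<le> (\<integral>\<^sup>+x. ennreal (f x) \<partial>count_space UNIV) + ennreal \<epsilon>"
      by (meson add_right_mono order_trans)
  qed
  ultimately have pmf: "pmf (embed_pmf f) x = f x" for x
    using m_nonneg by (intro pmf_embed_pmf) (auto simp: f_def)
  let ?q = "embed_pmf f"
  have q_fin: "measure ?q K = m K" if "finite K" for K
    unfolding m_fin[OF that] using that by (simp add: measure_measure_pmf_finite pmf f_def)
  \<comment> \<open>An inequality for all sets suffices: applied to the complement too, it becomes
    an equality, since both total masses are 1.\<close>
  have ge: "m A \<le> measure ?q A" for A
  proof (rule field_le_epsilon)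
    fix \<epsilon> :: real assume "0 < \<epsilon>"
    then obtain K where K: "finite K" "m (- K) \<le> \<epsilon>" using tight' by blast
    have "m A = m (A \<inter> K) + m (A - K)" using m_union[of "A \<inter> K" "A - K"] by (simp add: Int_Diff_Un Int_Diff_disjoint)
    also have "\<dots> \<le> measure ?q (A \<inter> K) + m (- K)"
      using q_fin[of "A \<inter> K"] K(1) m_mono[of "A - K" "- K"] by auto
    also have "\<dots> \<le> measure ?q A + \<epsilon>"
      using K(2) by (intro add_mono measure_pmf.finite_measure_mono) auto
    finally show "m A \<le> measure ?q A + \<epsilon>" .
  qed
  have "measure ?q A = m A" for A
    using ge[of A] ge[of "- A"] m_compl[of A] measure_pmf.prob_compl[of A ?q]
    by (simp add: Compl_eq_Diff_UNIV)
  then show ?thesis by blast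
qed

lemma nn_integral_count_space_tail:
  fixes f :: "'b \<Rightarrow> real"
  assumes nn: "\<And>x. 0 \<le> f x" and fin: "(\<integral>\<^sup>+x. ennreal (f x) \<partial>count_space A) < \<infinity>" and \<epsilon>: "0 < \<epsilon>"
  shows "\<exists>T. finite T \<and> T \<subseteq> A \<and> (\<integral>\<^sup>+x. ennreal (f x) \<partial>count_space (A - T)) \<le> ennreal \<epsilon>"
proof -
  have int: "integrable (count_space A) f"
    using assms by (intro integrableI_nonneg) auto
  then have summ: "f summable_on A"
    using abs_summable_equivalent[of f A] nn by (simp add: abs_summable_on_def)
  obtain T where T: "finite T" "T \<subseteq> A" "dist (sum f T) (infsum f A) \<le> \<epsilon>"
    using infsum_finite_approximation[OF summ \<epsilon>] by blast
  let ?I = "\<lambda>B. \<integral>\<^sup>+x. ennreal (f x) \<partial>count_space B"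
  have "?I A = (\<integral>\<^sup>+x. ennreal (f x) * indicator T x + ennreal (f x) * indicator (A - T) x \<partial>count_space A)"
    by (intro nn_integral_cong) (auto split: split_indicator)
  also have "\<dots> = (\<integral>\<^sup>+x. ennreal (f x) * indicator T x \<partial>count_space A) + (\<integral>\<^sup>+x. ennreal (f x) * indicator (A - T) x \<partial>count_space A)"
    by (rule nn_integral_add) auto
  also have "(\<integral>\<^sup>+x. ennreal (f x) * indicator T x \<partial>count_space A) = ?I T"
    using T(2) by (auto simp: nn_integral_count_space_indicator intro!: nn_integral_cong split: split_indicator)
  also have "(\<integral>\<^sup>+x. ennreal (f x) * indicator (A - T) x \<partial>count_space A) = ?I (A - T)"
    by (auto simp: nn_integral_count_space_indicator intro!: nn_integral_cong split: split_indicator)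
  finally have split: "?I A = ?I T + ?I (A - T)" .
  have IT: "?I T = ennreal (sum f T)" using T(1) nn by (simp add: nn_integral_count_space_finite sum_ennreal)
  have "infsum f A = enn2real (?I A)" using nn fin by (intro infsum_eq_nn_integral) auto
  then have IA: "?I A = ennreal (infsum f A)" using fin by simp
  have "?I (A - T) < \<infinity>" using fin split by (metis ennreal_add_less_top infinity_ennreal_def)
  then obtain c where c: "?I (A - T) = ennreal c" "0 \<le> c" by (cases "?I (A - T)") auto
  have nnI: "0 \<le> infsum f A" using nn by (intro infsum_nonneg) auto
  have "ennreal (infsum f A) = ennreal (sum f T + c)"
    using split IT IA c nn by (simp add: sum_nonneg)
  then have "infsum f A = sum f T + c"
    using nnI c nn by (subst (asm) ennreal_inj) (auto intro!: add_nonneg_nonneg sum_nonneg)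
  then have "c \<le> \<epsilon>" using T(3) by (simp add: dist_real_def)
  then show ?thesis using T c by (intro exI[of _ T]) (simp add: ennreal_leI)
qed

lemma finite_cfgs:
  assumes "finite J" "\<And>v. finite (T v)"
  shows "finite {a. (\<forall>v\<in>J. a v \<in> T v) \<and> (\<forall>v. v \<notin> J \<longrightarrow> a v = \<tau> v)}"
proof -
  have "{a. (\<forall>v\<in>J. a v \<in> T v) \<and> (\<forall>v. v \<notin> J \<longrightarrow> a v = \<tau> v)} \<subseteq> (\<lambda>f v. if v \<in> J then f v else \<tau> v) ` (PiE J T)"
  proof
    fix a assume a: "a \<in> {a. (\<forall>v\<in>J. a v \<in> T v) \<and> (\<forall>v. v \<notin> J \<longrightarrow> a v = \<tau> v)}"
    then have "a = (\<lambda>v. if v \<in> J then restrict a J v else \<tau> v)" by (auto simp: fun_eq_iff)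
    moreover have "restrict a J \<in> PiE J T" using a by auto
    ultimately show "a \<in> (\<lambda>f v. if v \<in> J then f v else \<tau> v) ` (PiE J T)" by blast
  qed
  then show ?thesis using assms by (meson finite_PiE finite_imageI finite_subset)
qed

section \<open>Bounds uniform in the volume, and tightness\<close>

context ground
begin

lemma chain_bound_anc:
  assumes "lev r u \<le> n" "a \<in> Om"
  shows "measure (gam (ball r n) gs) (agree (anc r u) a) \<le> (\<Prod>v\<in>anc r u. h v (a v))"
proof (rule chain_bound[where r = r])
  show "anc r u \<subseteq> ball r n" using anc_lev_le[of _ r u] assms(1) by (fastforce simp: ball_def)
  show "par r v \<in> ball r n" if "v \<in> ball r n" for v
    using that lev_par[of r v] by (auto simp: ball_def)
qed (use assms(2) anc_root anc_par anc_inj_lev in auto)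

text \<open>Here \<open>v\<close> itself is the root, so that the one-point set is closed under
  parents. The ball around \<open>r\<close> is still closed under parents by
  \<open>ball_par_closed\<close>.\<close>

lemma site_bound:
  assumes "lev r v \<le> n" "a \<in> Om"
  shows "measure (gam (ball r n) gs) (agree {v} a) \<le> h v (a v)"
proof -
  have v: "v \<in> ball r n" using assms(1) by (simp add: ball_def)
  have "measure (gam (ball r n) gs) (agree {v} a) \<le> (\<Prod>w\<in>{v}. h w (a w))"
    by (rule chain_bound[where r = v]) (use v assms(2) ball_par_closed in auto)
  then show ?thesis by simp
qed

lemma h_finite: "(\<integral>\<^sup>+b. ennreal (h v b) \<partial>count_space S) < \<infinity>"
  using h_total[of v] by (rule le_less_trans) simp

lemma gam_tight:
  assumes "finite J" "0 < \<epsilon>"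
  shows "\<exists>K. finite K \<and> eventually (\<lambda>n. measure (map_pmf (res J gs) (gam (ball r n) gs)) (- K) \<le> \<epsilon>) sequentially"
proof -
  \<comment> \<open>The summand 1 keeps the denominator positive for empty \<open>J\<close>.\<close>
  define e where "e = \<epsilon> / (real (card J) + 1)"
  have e: "0 < e" using assms by (simp add: e_def)
  have "\<exists>T. finite T \<and> T \<subseteq> S \<and> (\<integral>\<^sup>+b. ennreal (h v b) \<partial>count_space (S - T)) \<le> ennreal e" for v
    using h_nonneg h_finite e by (rule nn_integral_count_space_tail)
  then obtain T where T: "\<And>v. finite (T v)" "\<And>v. T v \<subseteq> S"
      "\<And>v. (\<integral>\<^sup>+b. ennreal (h v b) \<partial>count_space (S - T v)) \<le> ennreal e"
    by metis
  define K where "K = {a. (\<forall>v\<in>J. a v \<in> T v) \<and> (\<forall>v. v \<notin> J \<longrightarrow> a v = gs v)}"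
  have finK: "finite K" unfolding K_def using assms(1) T(1) by (rule finite_cfgs)
  obtain n0 where n0: "J \<subseteq> ball r n0" using finite_subset_ball[OF assms(1)] by blast
  have "measure (map_pmf (res J gs) (gam (ball r n) gs)) (- K) \<le> \<epsilon>" if n: "n0 \<le> n" for n
  proof -
    let ?P = "gam (ball r n) gs"
    have one: "measure ?P {\<sigma>. \<sigma> v \<notin> T v} \<le> e" if v: "v \<in> J" for v
    proof -
      have lv: "lev r v \<le> n" using v n0 n by (auto simp: ball_def)
      have "measure ?P {\<sigma>. \<sigma> v \<notin> T v} = measure ?P (Om \<inter> {\<sigma>. \<sigma> v \<notin> T v})"
        by (simp add: measure_gam_Om)
      also have "\<dots> \<le> measure ?P (\<Union>b\<in>S - T v. {\<sigma>. \<sigma> v = b})"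
        by (intro measure_pmf.finite_measure_mono) (auto simp: Om_def)
      finally have "emeasure ?P {\<sigma>. \<sigma> v \<notin> T v} \<le> emeasure ?P (\<Union>b\<in>S - T v. {\<sigma>. \<sigma> v = b})"
        by (simp add: measure_pmf.emeasure_eq_measure ennreal_leI)
      also have "\<dots> = (\<integral>\<^sup>+b. emeasure ?P {\<sigma>. \<sigma> v = b} \<partial>count_space (S - T v))"
        using countable_S by (intro emeasure_UN_countable) (auto simp: disjoint_family_on_def)
      also have "\<dots> \<le> (\<integral>\<^sup>+b. ennreal (h v b) \<partial>count_space (S - T v))"
      proof (intro nn_integral_mono)
        fix b assume "b \<in> space (count_space (S - T v))"
        then have "gs(v := b) \<in> Om" using gs_mem by (auto simp: Om_def)
        from site_bound[OF lv this] have "measure ?P {\<sigma>. \<sigma> v = b} \<le> h v b"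
          by (simp add: agree_def)
        then show "emeasure ?P {\<sigma>. \<sigma> v = b} \<le> ennreal (h v b)"
          by (simp add: measure_pmf.emeasure_eq_measure ennreal_leI)
      qed
      also have "\<dots> \<le> ennreal e" by (rule T(3))
      finally show ?thesis using e by (simp add: measure_pmf.emeasure_eq_measure)
    qed
    have "measure (map_pmf (res J gs) ?P) (- K) \<le> measure ?P (\<Union>v\<in>J. {\<sigma>. \<sigma> v \<notin> T v})"
      unfolding measure_map_pmf by (intro measure_pmf.finite_measure_mono) (auto simp: K_def res_def)
    also have "\<dots> \<le> (\<Sum>v\<in>J. measure ?P {\<sigma>. \<sigma> v \<notin> T v})"
      using assms(1) by (intro measure_UNION_le) auto
    also have "\<dots> \<le> (\<Sum>v\<in>J. e)" by (intro sum_mono one)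
    also have "\<dots> \<le> \<epsilon>" using assms(2) by (simp add: e_def field_simps)
    finally show ?thesis .
  qed
  then show ?thesis using finK eventually_sequentially by blast
qed

end

text \<open>The spins are coded as real numbers, where Kolmogorov's extension theorem is available.\<close>
lemma (in spin) extension_from_windows:
  fixes pw :: "'v set \<Rightarrow> ('v \<Rightarrow> 'a) pmf"
  assumes gs: "gs \<in> Om"
    and proj: "\<And>J H A. J \<subseteq> H \<Longrightarrow> finite H \<Longrightarrow> measure (pw J) A = measure (measure_pmf (pw H)) {\<sigma>. res J gs \<sigma> \<in> A}"
    and supp: "\<And>J. finite J \<Longrightarrow> measure (measure_pmf (pw J)) Om = 1"
  shows "\<exists>\<mu>. sets \<mu> = sets (cfg_space S) \<and> prob_space \<mu> \<and>
    (\<forall>J a. finite J \<longrightarrow> a \<in> Om \<longrightarrow> measure \<mu> (Om \<inter> agree J a) = measure (measure_pmf (pw J)) (agree J a))"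
proof -
  define code where "code b = real (to_nat_on S b)" for b
  \<comment> \<open>Reals that code no spin are sent to a fixed element of \<open>S\<close>, which
    makes \<open>dec\<close> a total measurable map into \<open>S\<close>.\<close>
  define dec where "dec x = (if x \<in> code ` S then inv_into S code x else gs undefined)" for x
  have inj: "inj_on code S"
    using countable_S by (auto simp: inj_on_def code_def)
  have dec_code: "dec (code b) = b" if "b \<in> S" for b
    using that inj by (simp add: dec_def inv_into_f_f)
  have dec_S: "dec x \<in> S" for x
    using Om_mem[OF gs] by (auto simp: dec_def inv_into_into)
  have dec_meas: "dec \<in> measurable borel (count_space S)"
  proof (subst measurable_count_space_eq_countable[OF countable_S], intro conjI ballI)
    show "dec \<in> space borel \<rightarrow> S" using dec_S by auto
    fix b assume b: "b \<in> S"
    have eq: "dec x = b \<longleftrightarrow> x = code b \<or> (x \<notin> code ` S \<and> b = gs undefined)" for x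
      using b inj dec_code by (auto simp: dec_def)
    have cS: "code ` S \<in> sets borel"
      by (rule sets.countable) (use countable_S in auto)
    have "dec -` {b} \<inter> space borel = {code b} \<union> (if b = gs undefined then - (code ` S) else {})"
      using eq by auto
    also have "\<dots> \<in> sets borel" using cS borel_comp[OF cS] by auto
    finally show "dec -` {b} \<inter> space borel \<in> sets borel" .
  qed
  let ?c = "\<lambda>J \<sigma>. \<lambda>v\<in>J. code (\<sigma> v)"
  define P where "P J = distr (measure_pmf (pw J)) (PiM J (\<lambda>_ :: 'v. borel :: real measure)) (?c J)" for J
  have c_meas: "?c J \<in> measurable (measure_pmf (pw H)) (PiM J (\<lambda>_. borel))" for J H
    by (simp add: measurable_def space_PiM)
  have map: "pw J = map_pmf (res J gs) (pw H)" if "J \<subseteq> H" "finite H" for J H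
  proof (rule pmf_eqI)
    fix a
    have "pmf (pw J) a = measure (pw J) {a}" by (simp add: measure_pmf_single)
    also have "\<dots> = measure (pw H) (res J gs -` {a})" using proj[OF that, of "{a}"] by (simp add: vimage_def)
    finally show "pmf (pw J) a = pmf (map_pmf (res J gs) (pw H)) a" by (simp add: pmf_map)
  qed
  interpret polish_projective UNIV P
  proof (rule polish_projective.intro, rule projective_family.intro)
    fix J H :: "'v set" assume JH: "J \<subseteq> H" "finite H" "H \<subseteq> UNIV"
    have "P J = distr (distr (measure_pmf (pw H)) (count_space UNIV) (res J gs)) (PiM J (\<lambda>_. borel)) (?c J)"
      unfolding P_def map[OF JH(1,2)] map_pmf_rep_eq ..
    also have "\<dots> = distr (measure_pmf (pw H)) (PiM J (\<lambda>_. borel)) (?c J \<circ> res J gs)"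
      by (rule distr_distr) (auto simp: measurable_def space_PiM)
    also have "?c J \<circ> res J gs = (\<lambda>\<sigma>. restrict (?c H \<sigma>) J)"
      using JH(1) by (auto simp: fun_eq_iff res_def restrict_def)
    also have "distr (measure_pmf (pw H)) (PiM J (\<lambda>_. borel)) (\<lambda>\<sigma>. restrict (?c H \<sigma>) J) =
        distr (P H) (PiM J (\<lambda>_. borel)) (\<lambda>f. restrict f J)"
      unfolding P_def using JH(1)
      by (subst distr_distr[OF measurable_restrict_subset c_meas]) (auto simp: comp_def)
    finally show "P J = distr (P H) (PiM J (\<lambda>_. borel)) (\<lambda>f. restrict f J)" .
  next
    fix J :: "'v set" assume "finite J" "J \<subseteq> UNIV"
    show "prob_space (P J)" unfolding P_def by (rule measure_pmf.prob_space_distr[OF c_meas])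
  qed
  let ?D = "\<lambda>\<omega> v. dec (\<omega> v)"
  have D_meas: "?D \<in> measurable lim (cfg_space S)"
    unfolding cfg_space_def
  proof (rule measurable_PiM_single')
    fix v :: 'v
    have "(\<lambda>\<omega>. \<omega> v) \<in> measurable (PiM UNIV (\<lambda>_. borel)) borel" by measurable
    then have "(\<lambda>\<omega>. \<omega> v) \<in> measurable lim borel" by (simp add: measurable_cong_sets[OF sets_lim refl])
    then show "(\<lambda>\<omega>. dec (\<omega> v)) \<in> measurable lim (count_space S)"
      using dec_meas by (rule measurable_compose)
  qed (auto simp: dec_S PiE_def Pi_def)
  define \<mu> where "\<mu> = distr lim (cfg_space S) ?D"
  have "prob_space \<mu>" unfolding \<mu>_def by (rule P.prob_space_distr[OF D_meas])
  moreover have "sets \<mu> = sets (cfg_space S)" by (simp add: \<mu>_def)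
  moreover have "measure \<mu> (Om \<inter> agree J a) = measure (pw J) (agree J a)" if J: "finite J" and a: "a \<in> Om" for J a
  proof -
    define X where "X = {f \<in> space (PiM J (\<lambda>_. borel :: real measure)). \<forall>v\<in>J. dec (f v) = a v}"
    have X: "X \<in> sets (PiM J (\<lambda>_. borel))"
      unfolding X_def using J
    proof (intro sets.sets_Collect_finite_All)
      fix v assume v: "v \<in> J"
      have "(\<lambda>f. dec (f v)) \<in> measurable (PiM J (\<lambda>_. borel)) (count_space S)"
        using v dec_meas by (intro measurable_compose[OF measurable_component_singleton]) auto
      then have "(\<lambda>f. dec (f v)) -` {a v} \<inter> space (PiM J (\<lambda>_. borel)) \<in> sets (PiM J (\<lambda>_. borel))"
        using Om_mem[OF a] by (intro measurable_sets) auto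
      then show "{f \<in> space (PiM J (\<lambda>_. borel)). dec (f v) = a v} \<in> sets (PiM J (\<lambda>_. borel))"
        by (simp add: vimage_def Int_def conj_commute)
    qed (use J in auto)
    have "measure \<mu> (Om \<inter> agree J a) = measure lim (?D -` (Om \<inter> agree J a) \<inter> space lim)"
      unfolding \<mu>_def using sets_agree[OF J] by (rule measure_distr[OF D_meas])
    also have "?D -` (Om \<inter> agree J a) \<inter> space lim = prod_emb UNIV (\<lambda>_. borel) J X"
      using dec_S by (auto simp: Om_def agree_def prod_emb_def X_def space_PiM)
    also have "measure lim (prod_emb UNIV (\<lambda>_. borel) J X) = measure (P J) X"
      using J X by (intro measure_lim_emb) auto
    also have "\<dots> = measure (pw J) (?c J -` X)"
      unfolding P_def using measure_distr[OF c_meas X] by simp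
    also have "\<dots> = measure (pw J) (agree J a)"
    proof (rule measure_pmf.finite_measure_eq_AE)
      have "AE \<sigma> in pw J. \<sigma> \<in> Om"
        using supp[OF J] by (intro measure_pmf.AE_prob_1)
      then show "AE \<sigma> in pw J. (\<sigma> \<in> ?c J -` X) = (\<sigma> \<in> agree J a)"
        by eventually_elim (auto simp: X_def agree_def space_PiM dec_code Om_mem)
    qed auto
    finally show ?thesis .
  qed
  ultimately show ?thesis by blast
qed

context ground
begin

text \<open>Along \<open>F\<close> the probabilities of all sets converge at once, so identities and
  bounds valid for large volumes pass to the window atoms of \<open>\<mu>\<close>. In this way
  \<open>gam_consistent\<close> yields the hypothesis of \<open>gibbsI\<close>, and
  \<open>chain_bound_anc\<close> that of \<open>extremalI\<close>.\<close>

lemma gibbs_exists: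
  "\<exists>\<mu>. extremal_gibbs S adj \<Phi> \<Psi> \<beta> \<mu> \<and> (\<forall>v. \<forall>b\<in>S. measure \<mu> {\<sigma> \<in> Om. \<sigma> v = b} \<le> h v b)"
proof -
  fix r :: 'v
  let ?P = "\<lambda>n. gam (ball r n) gs"
  have "\<exists>F m. F \<noteq> bot \<and> F \<le> sequentially \<and> (\<forall>A. ((\<lambda>n. measure (?P n) A) \<longlongrightarrow> m A) F)"
    by (rule bounded_sequence_limit_filter) simp
  then obtain F m where F: "F \<noteq> bot" "F \<le> sequentially" and lim: "\<And>A. ((\<lambda>n. measure (?P n) A) \<longlongrightarrow> m A) F"
    by blast
  have ev: "eventually Q F" if "eventually Q sequentially" for Q
    using F(2) that by (rule filter_leD)
  have "\<exists>q :: ('v \<Rightarrow> 'a) pmf. \<forall>A. measure q A = m {\<sigma>. res J gs \<sigma> \<in> A}" if J: "finite J" for J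
  proof (rule limit_pmf[OF F(1)])
    fix A
    show "((\<lambda>n. measure (map_pmf (res J gs) (?P n)) A) \<longlongrightarrow> m {\<sigma>. res J gs \<sigma> \<in> A}) F"
      using lim[of "{\<sigma>. res J gs \<sigma> \<in> A}"] by (simp add: measure_map_pmf vimage_def)
  next
    fix \<epsilon> :: real assume "0 < \<epsilon>"
    from gam_tight[OF J this, of r] ev
    show "\<exists>K. finite K \<and> eventually (\<lambda>n. measure (map_pmf (res J gs) (?P n)) (- K) \<le> \<epsilon>) F"
      by blast
  qed
  then have "\<exists>pw :: 'v set \<Rightarrow> ('v \<Rightarrow> 'a) pmf. \<forall>J. finite J \<longrightarrow> (\<forall>A. measure (pw J) A = m {\<sigma>. res J gs \<sigma> \<in> A})"
    by (intro choice) blast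
  then obtain pw :: "'v set \<Rightarrow> ('v \<Rightarrow> 'a) pmf" where pw: "\<And>J A. finite J \<Longrightarrow> measure (pw J) A = m {\<sigma>. res J gs \<sigma> \<in> A}"
    by blast
  have "\<exists>\<mu>. sets \<mu> = sets (cfg_space S) \<and> prob_space \<mu> \<and>
    (\<forall>J a. finite J \<longrightarrow> a \<in> Om \<longrightarrow> measure \<mu> (Om \<inter> agree J a) = measure (measure_pmf (pw J)) (agree J a))"
  proof (rule extension_from_windows[OF gs_Om])
    fix J H :: "'v set" and A assume JH: "J \<subseteq> H" "finite H"
    then have "finite J" by (rule finite_subset)
    moreover have "res J gs (res H gs \<sigma>) = res J gs \<sigma>" for \<sigma> using JH by (auto simp: res_def fun_eq_iff)
    ultimately show "measure (pw J) A = measure (pw H) {\<sigma>. res J gs \<sigma> \<in> A}"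
      using JH by (simp add: pw)
  next
    fix J :: "'v set" assume J: "finite J"
    have "((\<lambda>n. measure (?P n) {\<sigma>. res J gs \<sigma> \<in> Om}) \<longlongrightarrow> 1) F"
    proof -
      have "measure (?P n) {\<sigma>. res J gs \<sigma> \<in> Om} = 1" for n
        using set_gam[of "ball r n" gs] cfgs_Om[OF gs_Om, of J] res_in_cfgs[of _ J gs]
        by (intro measure_pmf.prob_eq_1[THEN iffD2]) (auto simp: AE_measure_pmf_iff)
      then show ?thesis by simp
    qed
    then show "measure (pw J) Om = 1"
      using tendsto_unique[OF F(1) lim] by (simp add: pw[OF J])
  qed
  then obtain \<mu> where \<mu>: "sets \<mu> = sets (cfg_space S)" "prob_space \<mu>"
    and \<mu>_pw: "\<And>J a. finite J \<Longrightarrow> a \<in> Om \<Longrightarrow> measure \<mu> (Om \<inter> agree J a) = measure (pw J) (agree J a)"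
    by blast
  have atom: "measure \<mu> (Om \<inter> agree J a) = m (agree J a)" if "finite J" "a \<in> Om" for J a
  proof -
    have "{\<sigma>. res J gs \<sigma> \<in> agree J a} = agree J a" by (auto simp: res_def agree_def)
    then show ?thesis using that by (simp add: \<mu>_pw pw)
  qed
  have le: "measure \<mu> (Om \<inter> agree J a) \<le> c" if "finite J" "a \<in> Om" "\<And>n. n \<ge> n0 \<Longrightarrow> measure (?P n) (agree J a) \<le> c" for J a c n0
    unfolding atom[OF that(1,2)]
    using that(3) by (intro tendsto_upperbound[OF lim _ F(1)] ev) (auto simp: eventually_sequentially)
  have gibbs: "gibbs \<mu>"
  proof (rule gibbsI[OF \<mu>])
    fix \<Lambda> W a assume *: "finite \<Lambda>" "finite W" "clos \<Lambda> \<subseteq> W" "a \<in> Om"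
    obtain n0 where n0: "\<Lambda> \<subseteq> ball r n0" using finite_subset_ball[OF *(1)] by blast
    have "eventually (\<lambda>n. measure (?P n) (agree W a) = cond \<Lambda> a * measure (?P n) (agree (W - \<Lambda>) a)) sequentially"
      unfolding eventually_sequentially
    proof (intro exI[of _ n0] allI impI)
      fix n assume "n0 \<le> n"
      then show "measure (?P n) (agree W a) = cond \<Lambda> a * measure (?P n) (agree (W - \<Lambda>) a)"
        using n0 ball_mono[of n0 n r] * by (intro gam_consistent) auto
    qed
    from ev[OF this] have "((\<lambda>n. measure (?P n) (agree W a)) \<longlongrightarrow> cond \<Lambda> a * m (agree (W - \<Lambda>) a)) F"
      using tendsto_mult[OF tendsto_const lim[of "agree (W - \<Lambda>) a"], of "cond \<Lambda> a"]
      by (simp add: tendsto_cong)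
    then show "measure \<mu> (Om \<inter> agree W a) = cond \<Lambda> a * measure \<mu> (Om \<inter> agree (W - \<Lambda>) a)"
      using tendsto_unique[OF F(1) lim] * by (simp add: atom)
  qed
  have "extremal_gibbs S adj \<Phi> \<Psi> \<beta> \<mu>"
  proof (rule extremalI[OF gibbs])
    fix u a assume "a \<in> Om"
    then show "measure \<mu> (Om \<inter> agree (anc r u) a) \<le> (\<Prod>v\<in>anc r u. h v (a v))"
      using chain_bound_anc by (intro le) auto
  qed
  moreover have "measure \<mu> {\<sigma> \<in> Om. \<sigma> v = b} \<le> h v b" if b: "b \<in> S" for v b
  proof -
    have a: "gs(v := b) \<in> Om" using b gs_mem by (auto simp: Om_def)
    have "measure \<mu> (Om \<inter> agree {v} (gs(v := b))) \<le> h v ((gs(v := b)) v)"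
      using site_bound[of r v, OF _ a] by (intro le[OF _ a]) auto
    moreover have "Om \<inter> agree {v} (gs(v := b)) = {\<sigma> \<in> Om. \<sigma> v = b}" by (auto simp: agree_def)
    ultimately show ?thesis by simp
  qed
  ultimately show ?thesis by blast
qed

lemma concentration:
  assumes "gibbs \<mu>" "\<And>b. b \<in> S \<Longrightarrow> measure \<mu> {\<sigma> \<in> Om. \<sigma> v = b} \<le> h v b"
  shows "1 - \<delta> \<le> measure \<mu> {\<sigma> \<in> Om. \<sigma> v = gs v}"
proof -
  have sets: "sets \<mu> = sets (cfg_space S)" and "prob_space \<mu>" using assms(1) by (auto simp: is_gibbs_def)
  interpret prob_space \<mu> by fact
  have sp: "space \<mu> = Om" using sets_eq_imp_space_eq[OF sets] by simp
  have m: "{\<sigma> \<in> Om. \<sigma> v = b} \<in> sets \<mu>" for b using sets_coord sets by simp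
  have U: "Om - {\<sigma> \<in> Om. \<sigma> v = gs v} = (\<Union>b\<in>S - {gs v}. {\<sigma> \<in> Om. \<sigma> v = b})" by (auto simp: Om_def)
  have "emeasure \<mu> (Om - {\<sigma> \<in> Om. \<sigma> v = gs v}) = (\<integral>\<^sup>+b. emeasure \<mu> {\<sigma> \<in> Om. \<sigma> v = b} \<partial>count_space (S - {gs v}))"
    unfolding U using countable_S m by (intro emeasure_UN_countable) (auto simp: disjoint_family_on_def)
  also have "\<dots> \<le> (\<integral>\<^sup>+b. ennreal (h v b) \<partial>count_space (S - {gs v}))"
    using assms(2) by (intro nn_integral_mono) (auto simp: emeasure_eq_measure intro!: ennreal_leI)
  also have "\<dots> \<le> ennreal \<delta>" by (rule h_sum)
  finally have "measure \<mu> (Om - {\<sigma> \<in> Om. \<sigma> v = gs v}) \<le> \<delta>"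
    using \<delta>_nonneg by (simp add: emeasure_eq_measure)
  then show ?thesis using prob_compl[OF m[of "gs v"]] sp by simp
qed

lemma \<delta>_less_half: "\<delta> < 1 / 2"
proof -
  have "2 * \<delta> \<le> \<delta> * (2 + \<delta>)" using \<delta>_nonneg by (simp add: distrib_left)
  then have "2 * (2 * \<delta>) \<le> real (Suc d) * (\<delta> * (2 + \<delta>))"
    using d_pos \<delta>_nonneg by (intro mult_mono[of 2 "real (Suc d)"]) (simp_all del: mult_le_cancel_left_pos)
  then show ?thesis using \<delta>_small by simp
qed

end

section \<open>Energy estimates\<close>

text \<open>If two ground states that differ at \<open>v\<close> shared their measure, this measure
  would have two disjoint events of probability at least \<open>1 - \<delta>\<close>, more than one
  half each.\<close>

lemma ground_family:
  assumes "\<And>gs. gs \<in> C \<Longrightarrow> ground adj d S \<Phi> \<Psi> \<beta> gs (rr gs) (g gs) (h gs) \<delta>"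
  shows "\<exists>\<mu>. (\<forall>gs\<in>C. extremal_gibbs S adj \<Phi> \<Psi> \<beta> (\<mu> gs)) \<and> inj_on \<mu> C \<and>
    (\<forall>gs\<in>C. \<forall>v. \<forall>b\<in>S. measure (\<mu> gs) {\<sigma> \<in> space (\<mu> gs). \<sigma> v = b} \<le> h gs v b) \<and>
    (\<forall>gs\<in>C. \<forall>v. 1 - \<delta> \<le> measure (\<mu> gs) {\<sigma> \<in> space (\<mu> gs). \<sigma> v = gs v})"
proof -
  define R where "R gs \<mu> \<longleftrightarrow> extremal_gibbs S adj \<Phi> \<Psi> \<beta> \<mu> \<and>
     (\<forall>v. \<forall>b\<in>S. measure \<mu> {\<sigma> \<in> space \<mu>. \<sigma> v = b} \<le> h gs v b) \<and>
     (\<forall>v. 1 - \<delta> \<le> measure \<mu> {\<sigma> \<in> space \<mu>. \<sigma> v = gs v})" for gs \<mu>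
  have "\<exists>\<mu>. R gs \<mu>" if "gs \<in> C" for gs
  proof -
    interpret ground adj d S \<Phi> \<Psi> \<beta> gs "rr gs" "g gs" "h gs" \<delta> using assms[OF that] .
    from gibbs_exists obtain \<mu> where \<mu>: "extremal_gibbs S adj \<Phi> \<Psi> \<beta> \<mu>"
      "\<forall>v. \<forall>b\<in>S. measure \<mu> {\<sigma> \<in> Om. \<sigma> v = b} \<le> h gs v b" by (elim exE conjE)
    have g: "gibbs \<mu>" using \<mu>(1) unfolding extremal_gibbs_def by (rule conjunct1)
    then have "sets \<mu> = sets (cfg_space S)" unfolding is_gibbs_def by (rule conjunct1)
    from sets_eq_imp_space_eq[OF this] have sp: "space \<mu> = Om" by simp
    have conc: "1 - \<delta> \<le> measure \<mu> {\<sigma> \<in> Om. \<sigma> v = gs v}" for v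
      using \<mu>(2) by (intro concentration[OF g]) blast
    have "R gs \<mu>" unfolding R_def sp by (intro conjI \<mu> allI[of "\<lambda>v. 1 - \<delta> \<le> _ v"] conc)
    then show ?thesis by (rule exI)
  qed
  then have "\<exists>\<mu>. \<forall>gs\<in>C. R gs (\<mu> gs)" by (intro bchoice ballI)
  then obtain \<mu> where R: "\<forall>gs\<in>C. R gs (\<mu> gs)" by (rule exE)
  have \<mu>: "extremal_gibbs S adj \<Phi> \<Psi> \<beta> (\<mu> gs)"
     "\<forall>v. \<forall>b\<in>S. measure (\<mu> gs) {\<sigma> \<in> space (\<mu> gs). \<sigma> v = b} \<le> h gs v b"
     "\<forall>v. 1 - \<delta> \<le> measure (\<mu> gs) {\<sigma> \<in> space (\<mu> gs). \<sigma> v = gs v}" if "gs \<in> C" for gs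
    using bspec[OF R that] unfolding R_def by simp_all
  have "inj_on \<mu> C"
  proof (rule inj_onI, rule ccontr)
    fix gs gs' assume C: "gs \<in> C" "gs' \<in> C" and eq: "\<mu> gs = \<mu> gs'" and "gs \<noteq> gs'"
    then obtain v where v: "gs v \<noteq> gs' v" by auto
    interpret ground adj d S \<Phi> \<Psi> \<beta> gs "rr gs" "g gs" "h gs" \<delta> using assms[OF C(1)] .
    have g: "gibbs (\<mu> gs)" using \<mu>(1)[OF C(1)] unfolding extremal_gibbs_def by (rule conjunct1)
    have sets: "sets (\<mu> gs) = sets (cfg_space S)" and "prob_space (\<mu> gs)"
      using g unfolding is_gibbs_def by simp_all
    interpret prob_space "\<mu> gs" by fact
    have sp: "space (\<mu> gs) = Om" using sets_eq_imp_space_eq[OF sets] by simp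
    let ?A = "\<lambda>b. {\<sigma> \<in> Om. \<sigma> v = b}"
    have "measure (\<mu> gs) (?A (gs v)) + measure (\<mu> gs) (?A (gs' v)) = measure (\<mu> gs) (?A (gs v) \<union> ?A (gs' v))"
      using v sets_coord sets by (intro finite_measure_Union[symmetric]) auto
    also have "\<dots> \<le> 1" by (rule prob_le_1)
    finally have "(1 - \<delta>) + (1 - \<delta>) \<le> 1"
      using spec[OF \<mu>(3)[OF C(1)], of v] spec[OF \<mu>(3)[OF C(2)], of v]
      unfolding eq[symmetric] sp by linarith
    then show False using \<delta>_less_half by simp
  qed
  then show ?thesis by (intro exI[of _ \<mu>] conjI ballI \<mu>)
qed

text \<open>The energy estimates common to both models. Writing \<open>e v a\<close> for the excess of \<open>a\<close> at \<open>v\<close>, every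
  unbroken edge gains \<open>A\<close> per unit of excess and every broken edge costs at most \<open>B\<close>; the entropy
  of each summation is \<open>ln L\<close>.\<close>
lemma groundI_energy:
  fixes e :: "'v \<Rightarrow> 'a \<Rightarrow> real"
  assumes "spin adj d S \<Phi> \<Psi> \<beta>" and \<beta>: "0 < \<beta>"
    and gs: "\<And>v. gs v \<in> S" and broken: "\<And>v. broken_deg adj gs v \<le> dmax"
    and e0: "\<And>v. e v (gs v) = 0" and e1: "\<And>v a. a \<noteq> gs v \<Longrightarrow> 1 \<le> e v a"
    and nonneg: "0 \<le> A" "0 \<le> B" "0 \<le> eps" "1 \<le> L"
    and osc: "\<And>v a b. a \<in> S \<Longrightarrow> b \<in> S \<Longrightarrow> \<bar>\<Psi> v a - \<Psi> v b\<bar> \<le> eps"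
    and edge: "\<And>v w. adj v w \<Longrightarrow> exp (- \<beta> * (B * of_bool (gs v \<noteq> gs w))) \<le> exp (- \<beta> * ((\<Phi> (gs v) (gs w) + \<Phi> (gs w) (gs v)) / 2))"
    and message: "\<And>v w c. adj v w \<Longrightarrow> c \<in> S \<Longrightarrow>
      (\<integral>\<^sup>+b. ennreal (exp (- \<beta> * ((\<Phi> c b + \<Phi> b c) / 2)) * exp (- \<beta> * R * e w b)) \<partial>count_space S) \<le>
        ennreal (L * exp (\<beta> * (B * of_bool (gs v \<noteq> gs w) - A * e v c)) * exp (- \<beta> * ((\<Phi> (gs v) (gs w) + \<Phi> (gs w) (gs v)) / 2)))"
    and c1: "R \<le> d * A - dmax * B - eps - (real d + 1) * ln L / \<beta>"
    and c2: "\<eta> \<le> (real d - 1) * A - dmax * B - eps - (real d + 1) * ln L / \<beta>"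
    and \<delta>: "0 \<le> \<delta>" "real (Suc d) * (\<delta> * (2 + \<delta>)) < 1"
      "\<And>v. (\<integral>\<^sup>+b. ennreal (exp (- \<beta> * \<eta> * e v b)) \<partial>count_space (S - {gs v})) \<le> ennreal \<delta>"
  shows "ground adj d S \<Phi> \<Psi> \<beta> gs (\<lambda>v a. exp (- \<beta> * R * e v a))
    (\<lambda>v w c. L * exp (\<beta> * (B * of_bool (gs v \<noteq> gs w) - A * e v c))) (\<lambda>v a. exp (- \<beta> * \<eta> * e v a)) \<delta>"
proof -
  interpret spin adj d S \<Phi> \<Psi> \<beta> by fact
  let ?g = "\<lambda>v w c. L * exp (\<beta> * (B * of_bool (gs v \<noteq> gs w) - A * e v c))"
  let ?br = "\<lambda>v X. {w \<in> X. gs v \<noteq> gs w}"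
  have L: "0 < L" "0 \<le> ln L" using nonneg by auto
  have prod_g: "(\<Prod>w\<in>X. ?g v w a) = exp (card X * ln L + \<beta> * (card (?br v X) * B - card X * A * e v a))" if "finite X" for v X a
  proof -
    have "(\<Prod>w\<in>X. ?g v w a) = (\<Prod>w\<in>X. exp (ln L + \<beta> * (B * of_bool (gs v \<noteq> gs w) - A * e v a)))"
      using L by (simp add: exp_add)
    also have "\<dots> = exp (\<Sum>w\<in>X. ln L + \<beta> * (B * of_bool (gs v \<noteq> gs w) - A * e v a))"
      using that by (simp add: exp_sum)
    also have "(\<Sum>w\<in>X. ln L + \<beta> * (B * of_bool (gs v \<noteq> gs w) - A * e v a)) =
        card X * ln L + \<beta> * (B * (\<Sum>w\<in>X. of_bool (gs v \<noteq> gs w)) - card X * A * e v a)"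
      by (simp add: sum.distrib sum_subtractf sum_distrib_left[symmetric] algebra_simps)
    also have "(\<Sum>w\<in>X. of_bool (gs v \<noteq> gs w) :: real) = card (?br v X)"
      using that by (simp add: of_bool_def sum.If_cases Int_def)
    finally show ?thesis by (simp add: mult.commute)
  qed
  have ratio: "psi v a / psi v (gs v) \<le> exp (\<beta> * eps)" if "a \<in> S" for v a
  proof -
    have "\<beta> * (\<Psi> v (gs v) - \<Psi> v a) \<le> \<beta> * eps"
      using osc[OF gs that, of v v] \<beta> by (intro mult_left_mono) auto
    then show ?thesis by (simp add: psi_def exp_diff[symmetric] algebra_simps)
  qed
  have br_nbr: "card (?br v (nbr v)) \<le> dmax" for v
    using broken[of v] by (simp add: broken_deg_def)
  show ?thesis
  proof (unfold_locales)
    fix v a x assume a: "a \<in> S" "a \<noteq> gs v" and x: "adj v x"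
    let ?X = "nbr v - {x}"
    have card: "card ?X = d" using x card_nbr[of v] by simp
    have br: "real (card (?br v ?X)) * B \<le> dmax * B"
    proof -
      have "card (?br v ?X) \<le> card (?br v (nbr v))" 
        by (intro card_mono finite_subset[OF _ finite_nbr[of v]]) auto
      then show ?thesis using br_nbr[of v] nonneg by (intro mult_right_mono) linarith+
    qed
    have "psi v a / psi v (gs v) * (\<Prod>w\<in>?X. ?g v w a) \<le> exp (\<beta> * eps) * exp (d * ln L + \<beta> * (card (?br v ?X) * B - d * A * e v a))"
      unfolding prod_g[OF finite_Diff[OF finite_nbr]] card
      by (rule mult_right_mono[OF ratio[OF a(1)]]) simp
    also have "\<dots> = exp (\<beta> * (eps + card (?br v ?X) * B + d * ln L / \<beta> - d * A * e v a))"
      using \<beta> by (simp add: mult_exp_exp algebra_simps)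
    also have "\<dots> \<le> exp (\<beta> * (- R * e v a))"
    proof -
      let ?D = "dmax * B + eps + (real d + 1) * ln L / \<beta>"
      have "0 \<le> ?D" using nonneg L \<beta> by (intro add_nonneg_nonneg) auto
      \<comment> \<open>An off-ground spin has excess at least 1, so the fixed costs of broken
        edges, field and entropy may be charged to every unit of excess.\<close>
      then have "1 * ?D \<le> e v a * ?D" using e1[OF a(2)] by (intro mult_right_mono) auto
      also have "\<dots> \<le> e v a * (d * A - R)" using e1[OF a(2)] c1 by (intro mult_left_mono) linarith+
      finally have "?D \<le> d * A * e v a - R * e v a" by (simp add: algebra_simps)
      moreover have "d * ln L / \<beta> \<le> (real d + 1) * ln L / \<beta>" using L \<beta> by (intro divide_right_mono mult_right_mono) auto
      ultimately have "eps + card (?br v ?X) * B + d * ln L / \<beta> - d * A * e v a \<le> - R * e v a"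
        using br unfolding mult_minus_left by linarith
      then show ?thesis
        using \<beta> by (simp only: exp_le_cancel_iff mult_left_mono less_imp_le)
    qed
    finally show "psi v a / psi v (gs v) * (\<Prod>w\<in>?X. ?g v w a) \<le> exp (- \<beta> * R * e v a)" by (simp add: mult.assoc)
  next
    fix v a X assume a: "a \<in> S" "a \<noteq> gs v" and X: "X \<subseteq> nbr v" "card X \<le> 2"
    let ?Y = "nbr v - X"
    have finX: "finite X" using X(1) finite_nbr finite_subset by blast
    have "card ?Y = Suc d - card X" using X card_nbr[of v] finX by (simp add: card_Diff_subset)
    \<comment> \<open>The smaller count, for two path neighbours, governs the gain; the larger one,
      for empty \<open>X\<close>, governs the entropy.\<close>
    then have card: "d - 1 \<le> card ?Y" "card ?Y \<le> d + 1" using X(2) by auto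
    \<comment> \<open>The broken edges at \<open>v\<close> are shared out: those outside
      \<open>X\<close> weaken messages, those in \<open>X\<close> pay for the ground-state weights
      of path edges. Together they cost at most \<open>dmax * B\<close>.\<close>
    have "?br v (nbr v) = ?br v ?Y \<union> ?br v X" using X by auto
    moreover have "card (?br v ?Y \<union> ?br v X) = card (?br v ?Y) + card (?br v X)"
      using finX by (intro card_Un_disjoint finite_subset[of "?br v ?Y" "nbr v"]) auto
    ultimately have "card (?br v (nbr v)) = card (?br v ?Y) + card (?br v X)" by (simp only:)
    then have "real (card (?br v ?Y)) + card (?br v X) \<le> dmax" using br_nbr[of v] by linarith
    then have br: "card (?br v ?Y) * B + card (?br v X) * B \<le> dmax * B"
      using nonneg by (simp add: distrib_right[symmetric] mult_right_mono)
    have QX: "exp (- \<beta> * (card (?br v X) * B)) \<le> (\<Prod>x\<in>X. Q (gs v) (gs x))"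
    proof -
      have "exp (- \<beta> * (card (?br v X) * B)) = exp (\<Sum>x\<in>X. - \<beta> * (B * of_bool (gs v \<noteq> gs x)))"
        using finX by (simp add: sum_distrib_left[symmetric] of_bool_def sum.If_cases Int_def mult.commute sum_negf)
      also have "\<dots> = (\<Prod>x\<in>X. exp (- \<beta> * (B * of_bool (gs v \<noteq> gs x))))" using finX by (simp add: exp_sum)
      also have "\<dots> \<le> (\<Prod>x\<in>X. Q (gs v) (gs x))"
      proof (intro prod_mono conjI)
        fix x assume "x \<in> X"
        then have "adj v x" using X(1) by auto
        then show "exp (- \<beta> * (B * of_bool (gs v \<noteq> gs x))) \<le> Q (gs v) (gs x)"
          unfolding Q_def by (rule edge)
      qed simp
      finally show ?thesis .
    qed
    have "psi v a / psi v (gs v) * (\<Prod>w\<in>?Y. ?g v w a) \<le> exp (\<beta> * eps) * exp (card ?Y * ln L + \<beta> * (card (?br v ?Y) * B - card ?Y * A * e v a))"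
      unfolding prod_g[OF finite_Diff[OF finite_nbr]]
      by (rule mult_right_mono[OF ratio[OF a(1)]]) simp
    also have "\<dots> = exp (\<beta> * (eps + card (?br v ?Y) * B + card ?Y * ln L / \<beta> - card ?Y * A * e v a))"
      using \<beta> by (simp add: mult_exp_exp algebra_simps)
    also have "\<dots> \<le> exp (\<beta> * (- \<eta> * e v a - card (?br v X) * B))"
    proof -
      let ?D = "dmax * B + eps + (real d + 1) * ln L / \<beta>"
      have "0 \<le> ?D" using nonneg L \<beta> by (intro add_nonneg_nonneg) auto
      then have "1 * ?D \<le> e v a * ?D" using e1[OF a(2)] by (intro mult_right_mono) auto
      also have "\<dots> \<le> e v a * ((real d - 1) * A - \<eta>)" using e1[OF a(2)] c2 by (intro mult_left_mono) linarith+
      also have "\<dots> \<le> e v a * (card ?Y * A - \<eta>)"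
        using e1[OF a(2)] nonneg card by (intro mult_left_mono diff_right_mono mult_right_mono) auto
      finally have "?D \<le> card ?Y * A * e v a - \<eta> * e v a" by (simp add: algebra_simps)
      moreover have "card ?Y * ln L / \<beta> \<le> (real d + 1) * ln L / \<beta>"
        using L \<beta> card(2) by (intro divide_right_mono mult_right_mono) auto
      ultimately have "eps + card (?br v ?Y) * B + card ?Y * ln L / \<beta> - card ?Y * A * e v a \<le> - \<eta> * e v a - card (?br v X) * B"
        using br unfolding mult_minus_left by linarith
      then show ?thesis
        using \<beta> by (simp only: exp_le_cancel_iff mult_left_mono less_imp_le)
    qed
    also have "\<dots> = exp (- \<beta> * \<eta> * e v a) * exp (- \<beta> * (card (?br v X) * B))"
      by (simp add: mult_exp_exp algebra_simps)
    also have "\<dots> \<le> exp (- \<beta> * \<eta> * e v a) * (\<Prod>x\<in>X. Q (gs v) (gs x))"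
      using QX by (intro mult_left_mono) auto
    finally show "psi v a / psi v (gs v) * (\<Prod>w\<in>?Y. ?g v w a) \<le> exp (- \<beta> * \<eta> * e v a) * (\<Prod>x\<in>X. Q (gs v) (gs x))" .
  next
    fix v w c assume "adj v w" "c \<in> S"
    then show "(\<integral>\<^sup>+b. ennreal (Q c b * exp (- \<beta> * R * e w b)) \<partial>count_space S) \<le> ennreal (?g v w c * Q (gs v) (gs w))"
      unfolding Q_def by (rule message)
  qed (use gs L e0 \<delta> in auto)
qed

section \<open>The p-SOS interaction and its partition sums\<close>

lemma c_p_pos: "0 < c_p p" and c_p_le_1: "c_p p \<le> 1"
  by (auto simp: c_p_def)

text \<open>For \<open>p \<le> 1\<close>, a number in the unit interval is at most its
  \<open>p\<close>-th power, applied to the shares of \<open>x\<close> and \<open>y\<close> in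
  \<open>x + y\<close>. For larger \<open>p\<close>, convexity at the midpoint gives the factor
  \<open>2 powr (1 - p)\<close>.\<close>

lemma powr_quasi_triangle:
  fixes x y :: real
  assumes p: "0 < p" and xy: "0 \<le> x" "0 \<le> y"
  shows "c_p p * (x + y) powr p \<le> x powr p + y powr p"
proof (cases "x = 0 \<or> y = 0")
  case True
  have "c_p p * z powr p \<le> z powr p" for z :: real
    using mult_right_mono[OF c_p_le_1, of "z powr p" p] by simp
  then show ?thesis using True by auto
next
  case False
  then have pos: "0 < x" "0 < y" using xy by auto
  show ?thesis
  proof (cases "p \<le> 1")
    case True
    have part: "(x + y) powr p * (z / (x + y)) \<le> z powr p" if "0 < z" "z \<le> x + y" for z
    proof -
      have "(z / (x + y)) powr 1 \<le> (z / (x + y)) powr p"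
        using True that pos by (intro powr_mono') auto
      then have "(x + y) powr p * (z / (x + y)) \<le> (x + y) powr p * (z / (x + y)) powr p"
        using that pos by (intro mult_left_mono) auto
      also have "\<dots> = z powr p" using that pos by (simp add: powr_mult[symmetric])
      finally show ?thesis .
    qed
    have "(x + y) powr p = (x + y) powr p * (x / (x + y)) + (x + y) powr p * (y / (x + y))"
      using pos by (simp add: distrib_left[symmetric] add_divide_distrib[symmetric])
    also have "\<dots> \<le> x powr p + y powr p" using part[of x] part[of y] pos by simp
    finally have "1 * (x + y) powr p \<le> x powr p + y powr p" by simp
    then show ?thesis
      using mult_right_mono[OF c_p_le_1, of "(x + y) powr p" p] by simp
  next
    case False
    have "((1 - 1/2) *\<^sub>R x + (1/2) *\<^sub>R y) powr p \<le> (1 - 1/2) * x powr p + (1/2) * y powr p"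
      using False pos by (intro convex_onD[OF powr_convex]) auto
    then have half: "((x + y) / 2) powr p \<le> (x powr p + y powr p) / 2" by (simp add: field_simps)
    have "c_p p * (x + y) powr p \<le> 2 powr (1 - p) * (x + y) powr p"
      by (intro mult_right_mono) (auto simp: c_p_def)
    also have "\<dots> = 2 * ((x + y) / 2) powr p"
      using pos by (simp add: powr_divide powr_diff)
    also have "\<dots> \<le> x powr p + y powr p" using half by simp
    finally show ?thesis .
  qed
qed

definition sos :: "real \<Rightarrow> int \<Rightarrow> real" where "sos p k = \<bar>real_of_int k\<bar> powr p"

lemma sos_nonneg [simp]: "0 \<le> sos p k"
  by (simp add: sos_def)

lemma sos_minus: "sos p (a - b) = sos p (b - a)"
  by (simp add: sos_def abs_minus_commute)

lemma sos_0 [simp]: "sos p 0 = 0"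
  by (simp add: sos_def)

lemma sos_ge_1: "0 < p \<Longrightarrow> k \<noteq> 0 \<Longrightarrow> 1 \<le> sos p k"
  unfolding sos_def by (intro ge_one_powr_ge_zero) (linarith | simp)+

lemma sos_triangle:
  assumes "0 < p"
  shows "c_p p * sos p (a - c) \<le> sos p (a - b) + sos p (b - c)"
proof -
  have "sos p (a - c) \<le> (\<bar>real_of_int (a - b)\<bar> + \<bar>real_of_int (b - c)\<bar>) powr p"
    unfolding sos_def using assms by (intro powr_mono2) auto
  then have "c_p p * sos p (a - c) \<le> c_p p * (\<bar>real_of_int (a - b)\<bar> + \<bar>real_of_int (b - c)\<bar>) powr p"
    using c_p_pos[of p] by (intro mult_left_mono) auto
  also have "\<dots> \<le> sos p (a - b) + sos p (b - c)"
    unfolding sos_def using assms by (intro powr_quasi_triangle) auto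
  finally show ?thesis .
qed

text \<open>Raising \<open>z \<le> exp z\<close> to a power \<open>m\<close> with
  \<open>2 \<le> p * m\<close> dominates the terms by a multiple of the inverse squares.\<close>

lemma summable_exp_powr:
  assumes p: "0 < p" and c: "0 < c"
  shows "summable (\<lambda>n. exp (- c * real n powr p))"
proof -
  obtain m :: nat where m: "2 / p \<le> real m" using real_arch_simple by blast
  then have mp: "2 \<le> p * m" using p by (simp add: field_simps)
  then have m0: "0 < m" by (cases m) auto
  have bound: "exp (- c * real n powr p) \<le> (m / c) ^ m * inverse (real n ^ 2)" if n: "1 \<le> n" for n
  proof -
    define z where "z = c * real n powr p / m"
    have z: "0 < z" using c n m0 by (simp add: z_def)
    have "z \<le> exp z" using exp_ge_add_one_self[of z] by linarith
    then have "z ^ m \<le> exp z ^ m" using z by (intro power_mono) auto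
    also have "\<dots> = exp (c * real n powr p)"
      using m0 by (simp add: exp_of_nat_mult[symmetric] z_def)
    finally have "inverse (exp (c * real n powr p)) \<le> inverse (z ^ m)"
      using z by (intro le_imp_inverse_le) auto
    then have "exp (- c * real n powr p) \<le> inverse (z ^ m)" by (simp add: exp_minus)
    also have "inverse (z ^ m) = (m / c) ^ m * inverse ((real n powr p) ^ m)"
      by (simp add: z_def power_mult_distrib power_divide field_simps)
    also have "(real n powr p) ^ m = real n powr (p * m)"
      using n by (simp add: powr_powr[symmetric] powr_realpow)
    also have "(m / c) ^ m * inverse (real n powr (p * m)) \<le> (m / c) ^ m * inverse (real n ^ 2)"
    proof (intro mult_left_mono le_imp_inverse_le)
      have "real n ^ 2 = real n powr 2" using n by (simp add: powr_numeral)
      also have "\<dots> \<le> real n powr (p * m)" using n mp by (intro powr_mono) auto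
      finally show "real n ^ 2 \<le> real n powr (p * m)" .
    qed (use n c in auto)
    finally show ?thesis .
  qed
  show ?thesis
  proof (rule summable_comparison_test)
    show "\<exists>N. \<forall>n\<ge>N. norm (exp (- c * real n powr p)) \<le> (m / c) ^ m * inverse (real n ^ 2)"
      using bound by (intro exI[of _ 1]) auto
    show "summable (\<lambda>n. (m / c) ^ m * inverse (real n ^ 2))"
      by (intro summable_mult inverse_power_summable) auto
  qed
qed

text \<open>The integers are covered by two copies of the naturals; 0 is counted twice, which an
  upper bound allows.\<close>

lemma nn_integral_exp_sos_finite:
  assumes p: "0 < p" and c: "0 < c"
  shows "(\<integral>\<^sup>+k. ennreal (exp (- c * sos p k)) \<partial>count_space UNIV) < \<infinity>"
proof -
  let ?f = "\<lambda>k. ennreal (exp (- c * sos p k))"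
  have nat: "(\<integral>\<^sup>+n. ?f (i n) \<partial>count_space UNIV) = ennreal (\<Sum>n. exp (- c * real n powr p))"
    if "\<And>n :: nat. \<bar>i n\<bar> = int n" for i
  proof -
    have "sos p (i n) = real n powr p" for n
      unfolding sos_def using that[of n] by (metis of_int_abs of_int_of_nat_eq)
    then show ?thesis
      using summable_exp_powr[OF p c] by (simp add: nn_integral_count_space_nat suminf_ennreal2)
  qed
  have range: "(\<integral>\<^sup>+k. ?f k * indicator (range i) k \<partial>count_space UNIV) = (\<integral>\<^sup>+n. ?f (i n) \<partial>count_space UNIV)"
    if "inj i" for i :: "nat \<Rightarrow> int"
  proof -
    have "(\<integral>\<^sup>+n. ?f (i n) \<partial>count_space UNIV) = (\<integral>\<^sup>+k. ?f k \<partial>count_space (range i))"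
      using that by (intro nn_integral_bij_count_space) (auto simp: bij_betw_def)
    then show ?thesis by (simp add: nn_integral_count_space_indicator[of "range i", unfolded NO_MATCH_def, OF TrueI])
  qed
  have "(\<integral>\<^sup>+k. ?f k \<partial>count_space UNIV) \<le>
      (\<integral>\<^sup>+k. ?f k * indicator (range int) k + ?f k * indicator (range (\<lambda>n. - int n)) k \<partial>count_space UNIV)"
  proof (intro nn_integral_mono)
    fix k :: int
    have "k \<in> range int \<or> k \<in> range (\<lambda>n. - int n)"
    proof (cases "0 \<le> k")
      case True
      then show ?thesis using nonneg_int_cases[of k] by blast
    next
      case False
      then have "k = - int (nat (- k))" by simp
      then show ?thesis by blast
    qed
    then show "?f k \<le> ?f k * indicator (range int) k + ?f k * indicator (range (\<lambda>n. - int n)) k"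
      by (auto split: split_indicator)
  qed
  also have "\<dots> = (\<integral>\<^sup>+k. ?f k * indicator (range int) k \<partial>count_space UNIV) +
      (\<integral>\<^sup>+k. ?f k * indicator (range (\<lambda>n. - int n)) k \<partial>count_space UNIV)"
    by (rule nn_integral_add) auto
  also have "\<dots> = ennreal (\<Sum>n. exp (- c * real n powr p)) + ennreal (\<Sum>n. exp (- c * real n powr p))"
    by (intro arg_cong2[where f = "(+)"] trans[OF range nat]) (auto simp: inj_on_def)
  also have "\<dots> < \<infinity>" by simp
  finally show ?thesis .
qed

lemma nn_integral_exp_sos_shift:
  "(\<integral>\<^sup>+b. ennreal (exp (- c * sos p (b - a))) \<partial>count_space UNIV) = (\<integral>\<^sup>+k. ennreal (exp (- c * sos p k)) \<partial>count_space UNIV)"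
proof -
  have "bij (\<lambda>b :: int. b - a)" by (rule bij_betw_byWitness[where f' = "\<lambda>b. b + a"]) auto
  then show ?thesis by (rule nn_integral_bij_count_space)
qed

text \<open>Translation invariance gives one constant for all centres \<open>a\<close>. The term at
  the centre equals 1, which makes the entropy \<open>ln L\<close> nonnegative.\<close>

lemma sos_partition:
  assumes "0 < p" "0 < c"
  obtains L where "1 \<le> L" "\<And>a. (\<integral>\<^sup>+b. ennreal (exp (- c * sos p (b - a))) \<partial>count_space UNIV) = ennreal L"
proof -
  let ?I = "\<integral>\<^sup>+k. ennreal (exp (- c * sos p k)) \<partial>count_space UNIV"
  have "ennreal (exp (- c * sos p 0)) \<le> ?I" by (rule nn_integral_count_space_mem_le) simp
  then have "1 \<le> ?I" by simp
  moreover obtain L where "?I = ennreal L" "0 \<le> L"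
    using nn_integral_exp_sos_finite[OF assms] by (cases ?I) auto
  ultimately show ?thesis using that[of L] nn_integral_exp_sos_shift by (simp add: ennreal_ge_1)
qed

text \<open>With \<open>\<delta> = 1 / (4 * Suc d)\<close> the left-hand side equals
  \<open>(2 + \<delta>) / 4\<close>.\<close>

lemma quarter_small: "real (Suc d) * (1 / (4 * real (Suc d)) * (2 + 1 / (4 * real (Suc d)))) < 1"
proof -
  have *: "x * (1 / (4 * x) * y) = y / 4" if "0 < x" for x y :: real
    using that by simp
  have "(2 + t) / 4 < 1" if "t \<le> 1" for t :: real using that by simp
  moreover have "1 / (4 * real (Suc d)) \<le> 1" by (simp add: field_simps)
  ultimately have "(2 + 1 / (4 * real (Suc d))) / 4 < 1" by blast
  then show ?thesis by (subst *) (simp_all only: of_nat_0_less_iff zero_less_Suc)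
qed

lemma exp_minus_le_inverse: "0 < t \<Longrightarrow> exp (- t) \<le> 1 / (t :: real)"
proof -
  assume t: "0 < t"
  have "t \<le> exp t" using exp_ge_add_one_self[of t] by linarith
  then have "inverse (exp t) \<le> inverse t" using t by (intro le_imp_inverse_le)
  then show ?thesis by (simp add: exp_minus inverse_eq_divide)
qed

section \<open>The two models\<close>

lemma sos_gibbs_measures:
  fixes adj :: "'v \<Rightarrow> 'v \<Rightarrow> bool" and p :: real and M dmax :: nat
  assumes tree: "cayley_tree d adj" and p: "0 < p" and d: "int d \<ge> d_bound p M dmax"
  shows "\<exists>eps > 0. \<forall>\<Psi> :: 'v \<Rightarrow> int \<Rightarrow> real.
         (\<forall>v k l. \<bar>\<Psi> v k - \<Psi> v l\<bar> \<le> eps) \<longrightarrow>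
         (\<exists>\<beta>0 c C. 0 < c \<and> 0 < C \<and>
            (\<forall>\<beta> \<ge> \<beta>0. \<exists>\<mu> :: ('v \<Rightarrow> int) \<Rightarrow> ('v \<Rightarrow> int) measure.
               (\<forall>\<omega>0 \<in> gs_sos adj dmax M.
                  extremal_gibbs UNIV adj (\<lambda>a b. \<bar>real_of_int (a - b)\<bar> powr p) \<Psi> \<beta> (\<mu> \<omega>0)) \<and>
               inj_on \<mu> (gs_sos adj dmax M) \<and>
               (\<forall>\<omega>0 \<in> gs_sos adj dmax M. \<forall>v k.
                  measure (\<mu> \<omega>0) {\<sigma> \<in> space (\<mu> \<omega>0). \<sigma> v - \<omega>0 v = k}
                    \<le> C * exp (- c * \<beta> * \<bar>real_of_int k\<bar> powr p))))"
    (is "\<exists>eps>0. \<forall>\<Psi>. ?osc eps \<Psi> \<longrightarrow> (\<exists>\<beta>0 c C. 0 < c \<and> 0 < C \<and> (\<forall>\<beta>\<ge>\<beta>0. ?family \<Psi> c C \<beta>))")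
proof -
  define cp where "cp = c_p p"
  define m where "m = real M powr p"
  have cp: "0 < cp" "cp \<le> 1" using c_p_pos[of p] c_p_le_1[of p] by (auto simp: cp_def)
  have m: "0 \<le> m" by (simp add: m_def)
  \<comment> \<open>This is \<open>cp\<^sup>2\<close> times the surplus of \<open>d\<close> over the
    number inside the floor of \<open>d_bound\<close>. It is positive because 1 plus the floor
    exceeds that number. It is the energy budget, shared out in quarters below.\<close>
  define \<eta>0 where "\<eta>0 = d * cp\<^sup>2 - 1 - (1 + cp) * (dmax * m)"
  have \<eta>0: "0 < \<eta>0"
  proof -
    have "1 / cp ^ 2 + (1 / cp + 1 / cp ^ 2) * dmax * m < real d"
      using d unfolding d_bound_def cp_def[symmetric] m_def[symmetric] by linarith
    then have "cp\<^sup>2 * (1 / cp ^ 2 + (1 / cp + 1 / cp ^ 2) * dmax * m) < cp\<^sup>2 * d"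
      using cp by (intro mult_strict_left_mono) auto
    also have "cp\<^sup>2 * (1 / cp ^ 2 + (1 / cp + 1 / cp ^ 2) * dmax * m) = 1 + (1 + cp) * (dmax * m)"
      using cp by (simp add: field_simps power2_eq_square)
    finally show ?thesis by (simp add: \<eta>0_def mult.commute)
  qed
  have d_pos: "1 \<le> d"
  proof (rule ccontr)
    assume "\<not> 1 \<le> d"
    moreover have "0 \<le> (1 + cp) * (dmax * m)" using cp m by (intro mult_nonneg_nonneg) auto
    ultimately have "\<eta>0 \<le> 0" by (simp add: \<eta>0_def not_le)
    then show False using \<eta>0 by simp
  qed
  \<comment> \<open>A fraction \<open>\<theta>\<close> of the edge energy is set aside to make the
    sum over an unbounded spin converge. Its size is such that \<open>d\<close> messages lose
    \<open>\<eta>0 / 4\<close> in total.\<close>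
  define \<theta> where "\<theta> = \<eta>0 / (4 * d * cp\<^sup>2)"
  have dcp: "0 < d * cp\<^sup>2" using d_pos cp by simp
  have "0 \<le> (1 + cp) * (dmax * m)" using cp m by (intro mult_nonneg_nonneg) auto
  then have "\<eta>0 \<le> d * cp\<^sup>2" unfolding \<eta>0_def by linarith
  then have \<theta>: "0 < \<theta>" "\<theta> < 1" using \<eta>0 dcp by (auto simp: \<theta>_def divide_simps)
  have \<theta>d: "d * cp\<^sup>2 * \<theta> = \<eta>0 / 4" using d_pos cp by (simp add: \<theta>_def)
  \<comment> \<open>A broken edge costs its own energy, at most \<open>m\<close>, and
    \<open>cp\<close> times that once more in the second triangle inequality; hence
    \<open>B\<close>.\<close>
  define A B \<eta> where "A = (1 - \<theta>) * cp\<^sup>2" and "B = (1 + cp) * m" and "\<eta> = \<eta>0 / 4"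
  have AB: "0 \<le> A" "0 \<le> B" using \<theta> cp m by (auto simp: A_def B_def)
  have \<eta>: "0 < \<eta>" using \<eta>0 by (simp add: \<eta>_def)
  have A_le_1: "A \<le> 1"
    unfolding A_def using \<theta> cp by (intro mult_le_one) (auto simp: power_le_one)
  have dA: "d * A = d * cp\<^sup>2 - \<eta>0 / 4"
    using \<theta>d by (simp add: A_def algebra_simps)
  have "dmax * B = (1 + cp) * (dmax * m)" by (simp add: B_def)
  then have dAB: "d * A - dmax * B = 1 + 3 * \<eta>0 / 4" using dA \<eta>0_def by linarith
  obtain L where L: "1 \<le> L" "\<And>a. (\<integral>\<^sup>+b. ennreal (exp (- \<theta> * sos p (b - a))) \<partial>count_space UNIV) = ennreal L"
    by (rule sos_partition[OF p \<theta>(1)]) (rule that)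
  obtain S1 where S1: "1 \<le> S1" "\<And>a. (\<integral>\<^sup>+b. ennreal (exp (- \<eta> * sos p (b - a))) \<partial>count_space UNIV) = ennreal S1"
    by (rule sos_partition[OF p \<eta>]) (rule that)
  define \<delta> where "\<delta> = 1 / (4 * real (Suc d))"
  have \<delta>: "0 < \<delta>" by (simp add: \<delta>_def)
  \<comment> \<open>The summands secure, in turn, \<open>1 \<le> \<beta>\<close>, total weight at
    most \<open>\<delta>\<close> off the ground state, and entropy at most
    \<open>\<eta>0 / 4\<close>. The threshold is fixed before the field appears and does not depend
    on it.\<close>
  define \<beta>0 where "\<beta>0 = 1 + S1 / (\<delta> * \<eta>) + 4 * (real d + 1) * ln L / \<eta>0"
  show ?thesis
  proof (rule exI[of _ "\<eta>0 / 4"], intro conjI allI impI)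
    show "0 < \<eta>0 / 4" using \<eta>0 by simp
    fix \<Psi> :: "'v \<Rightarrow> int \<Rightarrow> real" assume osc: "?osc (\<eta>0 / 4) \<Psi>"
    show "\<exists>\<beta>0 c C. 0 < c \<and> 0 < C \<and> (\<forall>\<beta>\<ge>\<beta>0. ?family \<Psi> c C \<beta>)"
    proof (rule exI[of _ \<beta>0], rule exI[of _ \<eta>], rule exI[of _ "1 :: real"], intro conjI allI impI)
      fix \<beta> assume \<beta>0: "\<beta>0 \<le> \<beta>"
      let ?\<Phi> = "\<lambda>a b. sos p (a - b)"
      have pos: "0 \<le> S1 / (\<delta> * \<eta>)" "0 \<le> 4 * (real d + 1) * ln L / \<eta>0"
        using S1(1) \<delta> \<eta> L(1) \<eta>0 by auto
      have \<beta>: "1 \<le> \<beta>" using \<beta>0 pos unfolding \<beta>0_def by linarith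
      have entropy: "(real d + 1) * ln L / \<beta> \<le> \<eta>0 / 4"
      proof -
        have "4 * (real d + 1) * ln L / \<eta>0 \<le> \<beta>" using \<beta>0 pos unfolding \<beta>0_def by linarith
        then show ?thesis using \<eta>0 \<beta> by (simp add: field_simps)
      qed
      have spin: "spin adj d UNIV ?\<Phi> \<Psi> \<beta>"
      proof (unfold_locales)
        fix u :: 'v
        define K where "K = exp (\<beta> * (\<eta>0 / 4 - \<Psi> u 0))"
        have "(\<integral>\<^sup>+b. ennreal (exp (- \<beta> * ((sos p (b - c) + sos p (c - b)) / 2)) * exp (- \<beta> * \<Psi> u b)) \<partial>count_space UNIV)
          \<le> ennreal (K * L)" for c
        proof -
          have "(\<integral>\<^sup>+b. ennreal (exp (- \<beta> * ((sos p (b - c) + sos p (c - b)) / 2)) * exp (- \<beta> * \<Psi> u b)) \<partial>count_space UNIV)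
            \<le> (\<integral>\<^sup>+b. ennreal K * ennreal (exp (- \<theta> * sos p (b - c))) \<partial>count_space UNIV)"
          proof (intro nn_integral_mono)
            fix b
            have "\<theta> * sos p (b - c) \<le> \<beta> * sos p (b - c)" using \<theta> \<beta> by (intro mult_right_mono) auto
            moreover have "\<beta> * (\<Psi> u 0 - \<eta>0 / 4) \<le> \<beta> * \<Psi> u b"
              using spec[OF spec[OF spec[OF osc, of u], of 0], of b] \<beta> by (intro mult_left_mono) linarith+
            ultimately have "exp (- \<beta> * ((sos p (b - c) + sos p (c - b)) / 2)) * exp (- \<beta> * \<Psi> u b) \<le> K * exp (- \<theta> * sos p (b - c))"
              unfolding K_def sos_minus[of p c b] by (simp add: mult_exp_exp algebra_simps)
            then show "ennreal (exp (- \<beta> * ((sos p (b - c) + sos p (c - b)) / 2)) * exp (- \<beta> * \<Psi> u b)) \<le> ennreal K * ennreal (exp (- \<theta> * sos p (b - c)))"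
              by (simp add: ennreal_mult'[symmetric] ennreal_leI K_def)
          qed
          also have "\<dots> = ennreal (K * L)" using L by (simp add: nn_integral_cmult ennreal_mult K_def)
          finally show ?thesis .
        qed
        then show "\<exists>K<\<infinity>. \<forall>c\<in>UNIV. (\<integral>\<^sup>+b. ennreal (exp (- \<beta> * ((sos p (b - c) + sos p (c - b)) / 2)) * exp (- \<beta> * \<Psi> u b)) \<partial>count_space UNIV) \<le> K"
          by (intro exI[of _ "ennreal (K * L)"]) auto
      qed (use tree d_pos \<beta> in auto)
      have ground: "ground adj d UNIV ?\<Phi> \<Psi> \<beta> gs (\<lambda>v a. exp (- \<beta> * 1 * sos p (a - gs v)))
          (\<lambda>v w c. L * exp (\<beta> * (B * of_bool (gs v \<noteq> gs w) - A * sos p (c - gs v))))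
          (\<lambda>v a. exp (- \<beta> * \<eta> * sos p (a - gs v))) \<delta>" if gs: "gs \<in> gs_sos adj dmax M" for gs
      proof (rule groundI_energy[OF spin, where dmax = dmax and eps = "\<eta>0 / 4"])
        have Nvw: "sos p (gs v - gs w) \<le> m * of_bool (gs v \<noteq> gs w)" if "adj v w" for v w
        proof (cases "gs v = gs w")
          case False
          have "\<bar>gs v - gs w\<bar> \<le> int M" using gs that by (auto simp: gs_sos_def)
          then have "sos p (gs v - gs w) \<le> m" unfolding sos_def m_def using p by (intro powr_mono2) linarith+
          then show ?thesis using False by simp
        qed (use m in simp)
        have Nvw_B: "(1 + cp) * sos p (gs v - gs w) \<le> B * of_bool (gs v \<noteq> gs w)" if "adj v w" for v w
          using mult_left_mono[OF Nvw[OF that], of "1 + cp"] cp by (simp add: B_def mult.assoc)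
        show "broken_deg adj gs v \<le> dmax" for v using gs by (auto simp: gs_sos_def)
        show "exp (- \<beta> * (B * of_bool (gs v \<noteq> gs w))) \<le> exp (- \<beta> * ((sos p (gs v - gs w) + sos p (gs w - gs v)) / 2))" if "adj v w" for v w
        proof -
          have "sos p (gs v - gs w) \<le> (1 + cp) * sos p (gs v - gs w)"
            using cp mult_right_mono[of 1 "1 + cp" "sos p (gs v - gs w)"] by simp
          then have "sos p (gs v - gs w) \<le> B * of_bool (gs v \<noteq> gs w)" using Nvw_B[OF that] by linarith
          then show ?thesis using \<beta> unfolding sos_minus[of p "gs w"] by (simp add: mult_left_mono)
        qed
        show "(\<integral>\<^sup>+b. ennreal (exp (- \<beta> * ((sos p (c - b) + sos p (b - c)) / 2)) * exp (- \<beta> * 1 * sos p (b - gs w))) \<partial>count_space UNIV) \<le>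
          ennreal (L * exp (\<beta> * (B * of_bool (gs v \<noteq> gs w) - A * sos p (c - gs v))) * exp (- \<beta> * ((sos p (gs v - gs w) + sos p (gs w - gs v)) / 2)))"
          if vw: "adj v w" for v w c
        proof -
          define E where "E = exp (\<beta> * (B * of_bool (gs v \<noteq> gs w) - A * sos p (c - gs v))) * exp (- \<beta> * ((sos p (gs v - gs w) + sos p (gs w - gs v)) / 2))"
          have "(\<integral>\<^sup>+b. ennreal (exp (- \<beta> * ((sos p (c - b) + sos p (b - c)) / 2)) * exp (- \<beta> * 1 * sos p (b - gs w))) \<partial>count_space UNIV) \<le>
            (\<integral>\<^sup>+b. ennreal E * ennreal (exp (- \<theta> * sos p (b - c))) \<partial>count_space UNIV)"
          proof (intro nn_integral_mono)
            fix b
            let ?x = "sos p (c - b)" and ?y = "sos p (b - gs w)" and ?z = "sos p (c - gs v)" and ?n = "sos p (gs v - gs w)"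
            \<comment> \<open>The first comparison passes through the summed spin \<open>b\<close>,
              the second through \<open>gs w\<close>. Each brings a factor \<open>cp\<close>, which
              is the origin of the square in \<open>A\<close>.\<close>
            have t1: "cp * sos p (c - gs w) \<le> ?x + ?y" unfolding cp_def by (rule sos_triangle[OF p])
            have t2: "cp * ?z \<le> sos p (c - gs w) + ?n"
              using sos_triangle[OF p, of c "gs v" "gs w"] unfolding cp_def sos_minus[of p "gs v" "gs w"] .
            have "A * ?z - cp * ?n \<le> (1 - \<theta>) * (cp * (cp * ?z - ?n))"
            proof -
              have "0 \<le> \<theta> * (cp * ?n)" using \<theta> cp by (intro mult_nonneg_nonneg) auto
              then show ?thesis by (simp add: A_def power2_eq_square algebra_simps)
            qed
            also have "\<dots> \<le> (1 - \<theta>) * (cp * sos p (c - gs w))"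
              using t2 \<theta> cp by (intro mult_left_mono) auto
            also have "\<dots> \<le> (1 - \<theta>) * (?x + ?y)" using t1 \<theta> by (intro mult_left_mono) auto
            also have "\<dots> \<le> ?x + ?y - \<theta> * ?x" using \<theta> by (simp add: algebra_simps)
            finally have "\<theta> * ?x + A * ?z + ?n - B * of_bool (gs v \<noteq> gs w) \<le> ?x + ?y"
              using Nvw_B[OF vw] by (simp add: algebra_simps)
            then have "\<beta> * (\<theta> * ?x + A * ?z + ?n - B * of_bool (gs v \<noteq> gs w)) \<le> \<beta> * (?x + ?y)"
              using \<beta> by (intro mult_left_mono) auto
            moreover have "\<theta> * ?x \<le> \<beta> * (\<theta> * ?x)" using \<theta> \<beta> mult_right_mono[of 1 \<beta> "\<theta> * ?x"] by simp
            ultimately have "- \<beta> * (?x + ?y) \<le> \<beta> * (B * of_bool (gs v \<noteq> gs w) - A * ?z) - \<beta> * ?n - \<theta> * ?x"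
              by (simp add: algebra_simps)
            then have "exp (- \<beta> * (?x + ?y)) \<le> exp (\<beta> * (B * of_bool (gs v \<noteq> gs w) - A * ?z) - \<beta> * ?n - \<theta> * ?x)"
              by simp
            then have "exp (- \<beta> * ((sos p (c - b) + sos p (b - c)) / 2)) * exp (- \<beta> * 1 * sos p (b - gs w)) \<le> E * exp (- \<theta> * sos p (b - c))"
              unfolding E_def sos_minus[of p b c] sos_minus[of p "gs w" "gs v"]
              by (simp add: mult_exp_exp algebra_simps)
            then show "ennreal (exp (- \<beta> * ((sos p (c - b) + sos p (b - c)) / 2)) * exp (- \<beta> * 1 * sos p (b - gs w))) \<le> ennreal E * ennreal (exp (- \<theta> * sos p (b - c)))"
              by (simp add: ennreal_mult'[symmetric] ennreal_leI E_def)
          qed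
          also have "\<dots> = ennreal E * ennreal L" by (simp only: nn_integral_cmult borel_measurable_count_space L(2))
          also have "\<dots> = ennreal (L * E)" using L(1) by (subst ennreal_mult[symmetric]) (auto simp: E_def mult.commute)
          finally show ?thesis unfolding E_def by (simp only: mult.assoc)
        qed
        \<comment> \<open>Of the surplus \<open>3 * \<eta>0 / 4\<close> in \<open>dAB\<close>, field
          and entropy take a quarter of \<open>\<eta>0\<close> each. The bound for
          \<open>\<eta>\<close> below loses one more \<open>A\<close>, at most 1, and is left with
          \<open>\<eta>0 / 4\<close>.\<close>
        show "1 \<le> d * A - dmax * B - \<eta>0 / 4 - (real d + 1) * ln L / \<beta>"
        proof -
          show ?thesis using dAB entropy \<eta>0 by linarith
        qed
        show "\<eta> \<le> (real d - 1) * A - dmax * B - \<eta>0 / 4 - (real d + 1) * ln L / \<beta>"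
        proof -
          have "(real d - 1) * A = d * A - A" by (simp add: algebra_simps)
          then show ?thesis using dAB entropy A_le_1 unfolding \<eta>_def by linarith
        qed
        show "(\<integral>\<^sup>+b. ennreal (exp (- \<beta> * \<eta> * sos p (b - gs v))) \<partial>count_space (UNIV - {gs v})) \<le> ennreal \<delta>" for v
        proof -
          \<comment> \<open>One unit of \<open>\<beta>\<close> is kept for the convergence of the
            sum. The remaining \<open>\<beta> - 1\<close> gives a small factor, because off-ground
            spins have excess at least 1.\<close>
          define E where "E = exp (- ((\<beta> - 1) * \<eta>))"
          have "(\<integral>\<^sup>+b. ennreal (exp (- \<beta> * \<eta> * sos p (b - gs v))) \<partial>count_space (UNIV - {gs v})) \<le>
             (\<integral>\<^sup>+b. ennreal E * ennreal (exp (- \<eta> * sos p (b - gs v))) \<partial>count_space UNIV)"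
            unfolding nn_integral_count_space_indicator[of "UNIV - {gs v}", unfolded NO_MATCH_def, OF TrueI]
          proof (intro nn_integral_mono)
            fix b
            show "ennreal (exp (- \<beta> * \<eta> * sos p (b - gs v))) * indicator (UNIV - {gs v}) b \<le> ennreal E * ennreal (exp (- \<eta> * sos p (b - gs v)))"
            proof (cases "b = gs v")
              case False
              then have "(\<beta> - 1) * \<eta> * 1 \<le> (\<beta> - 1) * \<eta> * sos p (b - gs v)"
                using \<beta> \<eta> sos_ge_1[OF p, of "b - gs v"] by (intro mult_left_mono) auto
              then have "exp (- \<beta> * \<eta> * sos p (b - gs v)) \<le> E * exp (- \<eta> * sos p (b - gs v))"
                by (simp add: E_def mult_exp_exp algebra_simps)
              then show ?thesis using False by (simp add: ennreal_mult'[symmetric] ennreal_leI E_def)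
            qed simp
          qed
          also have "\<dots> = ennreal (E * S1)" using S1 by (simp add: nn_integral_cmult ennreal_mult E_def)
          also have "E * S1 \<le> \<delta>"
          proof -
            have ge: "S1 / (\<delta> * \<eta>) \<le> \<beta> - 1" using \<beta>0 pos unfolding \<beta>0_def by linarith
            have "0 < S1 / (\<delta> * \<eta>)" using S1(1) \<delta> \<eta> by simp
            then have b1: "0 < \<beta> - 1" using ge by linarith
            have "E * S1 \<le> 1 / ((\<beta> - 1) * \<eta>) * S1"
              unfolding E_def using S1(1) b1 \<eta> by (intro mult_right_mono exp_minus_le_inverse) auto
            also have "\<dots> \<le> \<delta>"
              using ge b1 \<eta> \<delta> by (simp add: field_simps)
            finally show ?thesis .
          qed
          finally show ?thesis by (simp add: ennreal_leI)
        qed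
        show "real (Suc d) * (\<delta> * (2 + \<delta>)) < 1" unfolding \<delta>_def by (rule quarter_small)
        show "1 \<le> sos p (a - gs v)" if "a \<noteq> gs v" for a v using sos_ge_1[OF p, of "a - gs v"] that by simp
      qed (use \<beta> AB L \<eta>0 \<delta> osc in auto)
      obtain \<mu> where \<mu>: "\<forall>gs\<in>gs_sos adj dmax M. extremal_gibbs UNIV adj ?\<Phi> \<Psi> \<beta> (\<mu> gs)"
        "inj_on \<mu> (gs_sos adj dmax M)"
        "\<forall>gs\<in>gs_sos adj dmax M. \<forall>v. \<forall>b\<in>UNIV. measure (\<mu> gs) {\<sigma> \<in> space (\<mu> gs). \<sigma> v = b} \<le> exp (- \<beta> * \<eta> * sos p (b - gs v))"
        by (rule exE[OF ground_family[where C = "gs_sos adj dmax M", OF ground]]) (assumption, elim conjE, rule that)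
      have "measure (\<mu> \<omega>0) {\<sigma> \<in> space (\<mu> \<omega>0). \<sigma> v - \<omega>0 v = k} \<le> 1 * exp (- \<eta> * \<beta> * \<bar>real_of_int k\<bar> powr p)"
        if "\<omega>0 \<in> gs_sos adj dmax M" for \<omega>0 v k
      proof -
        have "{\<sigma> \<in> space (\<mu> \<omega>0). \<sigma> v - \<omega>0 v = k} = {\<sigma> \<in> space (\<mu> \<omega>0). \<sigma> v = \<omega>0 v + k}" by auto
        moreover have "measure (\<mu> \<omega>0) {\<sigma> \<in> space (\<mu> \<omega>0). \<sigma> v = \<omega>0 v + k} \<le> exp (- \<beta> * \<eta> * sos p ((\<omega>0 v + k) - \<omega>0 v))"
          using \<mu>(3) that by blast
        ultimately show ?thesis by (simp add: sos_def mult.commute)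
      qed
      then show "?family \<Psi> \<eta> 1 \<beta>"
        using \<mu>(1,2) unfolding sos_def by (intro exI[of _ \<mu>] conjI ballI allI) simp_all
    qed (use \<eta> in auto)
  qed
qed

lemma potts_gibbs_measures:
  fixes adj :: "'v \<Rightarrow> 'v \<Rightarrow> bool" and u :: "nat \<Rightarrow> nat \<Rightarrow> real" and q dmax :: nat
  assumes tree: "cayley_tree d adj" and q: "2 \<le> q"
    and u_nonneg: "\<forall>k<q. \<forall>l<q. 0 \<le> u k l" and u_diag: "\<forall>k<q. u k k = 0"
    and gap: "(real d - 1) * Min {u k l | k l. k < q \<and> l < q \<and> k \<noteq> l}
        > real dmax * (Max {u k l | k l. k < q \<and> l < q} + Min {u k l | k l. k < q \<and> l < q \<and> k \<noteq> l})"
  shows "\<exists>eps > 0. \<forall>\<Psi> :: 'v \<Rightarrow> nat \<Rightarrow> real.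
         (\<forall>v. \<forall>k<q. \<forall>l<q. \<bar>\<Psi> v k - \<Psi> v l\<bar> \<le> eps) \<longrightarrow>
         (\<exists>\<beta>0 c C. 0 < c \<and> 0 < C \<and>
            (\<forall>\<beta> \<ge> \<beta>0. \<exists>\<mu> :: ('v \<Rightarrow> nat) \<Rightarrow> ('v \<Rightarrow> nat) measure.
               (\<forall>\<omega>0 \<in> gs_q adj q dmax. extremal_gibbs {0..<q} adj u \<Psi> \<beta> (\<mu> \<omega>0)) \<and>
               inj_on \<mu> (gs_q adj q dmax) \<and>
               (\<forall>\<omega>0 \<in> gs_q adj q dmax. \<forall>v.
                  measure (\<mu> \<omega>0) {\<sigma> \<in> space (\<mu> \<omega>0). \<sigma> v = \<omega>0 v}
                    \<ge> 1 - C * exp (- c * \<beta>))))"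
    (is "\<exists>eps>0. \<forall>\<Psi>. ?osc eps \<Psi> \<longrightarrow> (\<exists>\<beta>0 c C. 0 < c \<and> 0 < C \<and> (\<forall>\<beta>\<ge>\<beta>0. ?family \<Psi> c C \<beta>))")
proof -
  define um where "um = Min {u k l | k l. k < q \<and> l < q \<and> k \<noteq> l}"
  define UM where "UM = Max {u k l | k l. k < q \<and> l < q}"
  have fin: "finite {u k l | k l. k < q \<and> l < q}"
    by (rule finite_subset[of _ "(\<lambda>(k, l). u k l) ` ({..<q} \<times> {..<q})"]) auto
  have fin': "finite {u k l | k l. k < q \<and> l < q \<and> k \<noteq> l}" by (rule finite_subset[OF _ fin]) auto
  have um_le: "um \<le> u k l" if "k < q" "l < q" "k \<noteq> l" for k l
    unfolding um_def using fin' that by (intro Min_le) auto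
  have le_UM: "u k l \<le> UM" if "k < q" "l < q" for k l
    unfolding UM_def using fin that by (intro Max_ge) auto
  have "u 0 1 \<in> {u k l | k l. k < q \<and> l < q \<and> k \<noteq> l}"
    using q by (intro CollectI exI[of _ 0] exI[of _ 1]) auto
  then have "um \<in> {u k l | k l. k < q \<and> l < q \<and> k \<noteq> l}"
    unfolding um_def by (intro Min_in fin') blast
  then have um: "0 \<le> um" using u_nonneg by auto
  have "0 \<le> u 0 0" "u 0 0 \<le> UM" using q u_nonneg le_UM[of 0 0] by auto
  then have UM: "0 \<le> UM" by linarith
  define \<eta>0 where "\<eta>0 = (real d - 1) * um - dmax * (UM + um)"
  have \<eta>0: "0 < \<eta>0" using gap unfolding \<eta>0_def um_def UM_def by linarith
  have d_pos: "1 \<le> d"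
  proof (rule ccontr)
    assume "\<not> 1 \<le> d"
    then have "d = 0" by simp
    moreover have "0 \<le> dmax * (UM + um)" using um UM by simp
    ultimately have "\<eta>0 \<le> 0" using um by (simp add: \<eta>0_def)
    then show False using \<eta>0 by simp
  qed
  define \<eta> where "\<eta> = \<eta>0 / 4"
  have \<eta>: "0 < \<eta>" using \<eta>0 by (simp add: \<eta>_def)
  define \<delta>0 where "\<delta>0 = 1 / (4 * real (Suc d))"
  have \<delta>0: "0 < \<delta>0" by (simp add: \<delta>0_def)
  define \<beta>0 where "\<beta>0 = 1 + q / (\<delta>0 * \<eta>) + 4 * (real d + 1) * ln q / \<eta>0"
  show ?thesis
  proof (rule exI[of _ "\<eta>0 / 4"], intro conjI allI impI)
    show "0 < \<eta>0 / 4" using \<eta>0 by simp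
    fix \<Psi> :: "'v \<Rightarrow> nat \<Rightarrow> real" assume osc: "?osc (\<eta>0 / 4) \<Psi>"
    show "\<exists>\<beta>0 c C. 0 < c \<and> 0 < C \<and> (\<forall>\<beta>\<ge>\<beta>0. ?family \<Psi> c C \<beta>)"
    proof (rule exI[of _ \<beta>0], rule exI[of _ \<eta>], rule exI[of _ "real q"], intro conjI allI impI)
      fix \<beta> assume \<beta>0: "\<beta>0 \<le> \<beta>"
      let ?S = "{0..<q}"
      have pos: "0 \<le> q / (\<delta>0 * \<eta>)" "0 \<le> 4 * (real d + 1) * ln q / \<eta>0"
        using q \<delta>0 \<eta> \<eta>0 by auto
      have \<beta>: "1 \<le> \<beta>" using \<beta>0 pos unfolding \<beta>0_def by linarith
      have entropy: "(real d + 1) * ln q / \<beta> \<le> \<eta>0 / 4"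
      proof -
        have "4 * (real d + 1) * ln q / \<eta>0 \<le> \<beta>" using \<beta>0 pos unfolding \<beta>0_def by linarith
        then show ?thesis using \<eta>0 \<beta> by (simp add: field_simps)
      qed
      \<comment> \<open>Unlike in the p-SOS case, \<open>\<delta>\<close> varies with
        \<open>\<beta>\<close>: the claimed concentration is \<open>1 - \<delta>\<close> itself and
        must be exponentially good. \<open>\<beta>0\<close> only brings \<open>\<delta>\<close>
        below the fixed \<open>\<delta>0\<close>.\<close>
      define \<delta> where "\<delta> = real q * exp (- \<eta> * \<beta>)"
      have \<delta>: "0 \<le> \<delta>" "\<delta> \<le> \<delta>0"
      proof -
        show "0 \<le> \<delta>" by (simp add: \<delta>_def)
        have ge: "q / (\<delta>0 * \<eta>) \<le> \<beta>" using \<beta>0 pos unfolding \<beta>0_def by linarith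
        have "\<delta> \<le> q * (1 / (\<eta> * \<beta>))"
          unfolding \<delta>_def mult_minus_left using \<eta> \<beta> by (intro mult_left_mono exp_minus_le_inverse) auto
        also have "\<dots> \<le> \<delta>0" using ge \<eta> \<delta>0 \<beta> by (simp add: field_simps)
        finally show "\<delta> \<le> \<delta>0" .
      qed
      have small: "real (Suc d) * (\<delta> * (2 + \<delta>)) < 1"
      proof -
        have "real (Suc d) * (\<delta> * (2 + \<delta>)) \<le> real (Suc d) * (\<delta>0 * (2 + \<delta>0))"
          using \<delta> \<delta>0 by (intro mult_left_mono mult_mono) auto
        also have "\<dots> < 1" unfolding \<delta>0_def by (rule quarter_small)
        finally show ?thesis .
      qed
      have spin: "spin adj d ?S u \<Psi> \<beta>"
      proof (unfold_locales)
        fix w :: 'v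
        define K where "K = (\<Sum>b\<in>?S. \<Sum>c\<in>?S. ennreal (exp (- \<beta> * ((u b c + u c b) / 2)) * exp (- \<beta> * \<Psi> w b)))"
        show "\<exists>K<\<infinity>. \<forall>c\<in>?S. (\<integral>\<^sup>+b. ennreal (exp (- \<beta> * ((u b c + u c b) / 2)) * exp (- \<beta> * \<Psi> w b)) \<partial>count_space ?S) \<le> K"
        proof (intro exI[of _ K] conjI ballI)
          show "K < \<infinity>" by (simp add: K_def)
          fix c assume c: "c \<in> ?S"
          have "(\<Sum>b\<in>?S. ennreal (exp (- \<beta> * ((u b c + u c b) / 2)) * exp (- \<beta> * \<Psi> w b))) \<le> K"
            unfolding K_def by (intro sum_mono member_le_sum[OF c]) auto
          then show "(\<integral>\<^sup>+b. ennreal (exp (- \<beta> * ((u b c + u c b) / 2)) * exp (- \<beta> * \<Psi> w b)) \<partial>count_space ?S) \<le> K"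
            by (simp add: nn_integral_count_space_finite)
        qed
      qed (use tree d_pos \<beta> u_nonneg in auto)
      have avg: "um \<le> (u k l + u l k) / 2" if "k < q" "l < q" "k \<noteq> l" for k l
        using um_le[OF that] um_le[of l k] that by simp
      have avg_UM: "(u k l + u l k) / 2 \<le> UM" if "k < q" "l < q" for k l
        using le_UM[OF that] le_UM[of l k] that by simp
      have avg_nonneg: "0 \<le> (u k l + u l k) / 2" if "k < q" "l < q" for k l
        using u_nonneg that by simp
      let ?e = "\<lambda>gs v a. of_bool (a \<noteq> gs v) :: real"
      \<comment> \<open>The excess is the indicator of disagreement; the gain \<open>A\<close> and
        the rate \<open>R\<close> both equal \<open>um\<close>, a broken edge costs
        \<open>UM + um\<close>, and the entropy is \<open>ln q\<close>.\<close>
      have ground: "ground adj d ?S u \<Psi> \<beta> gs (\<lambda>v a. exp (- \<beta> * um * ?e gs v a))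
          (\<lambda>v w c. real q * exp (\<beta> * ((UM + um) * of_bool (gs v \<noteq> gs w) - um * ?e gs v c)))
          (\<lambda>v a. exp (- \<beta> * \<eta> * ?e gs v a)) \<delta>" if gs: "gs \<in> gs_q adj q dmax" for gs
      proof (rule groundI_energy[OF spin, where dmax = dmax and eps = "\<eta>0 / 4"])
        have gq: "gs v < q" for v using gs by (auto simp: gs_q_def)
        show "gs v \<in> ?S" for v using gq by simp
        show "broken_deg adj gs v \<le> dmax" for v using gs by (auto simp: gs_q_def)
        have edge: "(u (gs v) (gs w) + u (gs w) (gs v)) / 2 \<le> UM * of_bool (gs v \<noteq> gs w)" for v w
          using avg_UM[OF gq gq, of v w] u_diag gq by (cases "gs v = gs w") auto
        show "exp (- \<beta> * ((UM + um) * of_bool (gs v \<noteq> gs w))) \<le> exp (- \<beta> * ((u (gs v) (gs w) + u (gs w) (gs v)) / 2))" for v w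
        proof -
          have "UM * of_bool (gs v \<noteq> gs w) \<le> (UM + um) * of_bool (gs v \<noteq> gs w)"
            using um by (intro mult_right_mono) auto
          then have "\<beta> * ((u (gs v) (gs w) + u (gs w) (gs v)) / 2) \<le> \<beta> * ((UM + um) * of_bool (gs v \<noteq> gs w))"
            using edge[of v w] \<beta> by (intro mult_left_mono) linarith+
          then show ?thesis by simp
        qed
        show "(\<integral>\<^sup>+b. ennreal (exp (- \<beta> * ((u c b + u b c) / 2)) * exp (- \<beta> * um * ?e gs w b)) \<partial>count_space ?S) \<le>
          ennreal (real q * exp (\<beta> * ((UM + um) * of_bool (gs v \<noteq> gs w) - um * ?e gs v c)) * exp (- \<beta> * ((u (gs v) (gs w) + u (gs w) (gs v)) / 2)))"
          if c: "c \<in> ?S" for v w c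
        proof -
          define E where "E = exp (\<beta> * ((UM + um) * of_bool (gs v \<noteq> gs w) - um * ?e gs v c)) * exp (- \<beta> * ((u (gs v) (gs w) + u (gs w) (gs v)) / 2))"
          have "exp (- \<beta> * ((u c b + u b c) / 2)) * exp (- \<beta> * um * ?e gs w b) \<le> E" if b: "b \<in> ?S" for b
          proof -
            have cb: "0 \<le> (u c b + u b c) / 2" using avg_nonneg[of c b] b c by simp
            \<comment> \<open>On an unbroken edge with \<open>c\<close> off the ground state, either
              \<open>b\<close> is off it too and the sender's bound supplies \<open>um\<close>, or
              \<open>b\<close> differs from \<open>c\<close> and the edge supplies it. On a broken
              edge, \<open>UM + um\<close> covers the ground-state energy and the gain
              claimed.\<close>
            have "(u (gs v) (gs w) + u (gs w) (gs v)) / 2 - (UM + um) * of_bool (gs v \<noteq> gs w) + um * ?e gs v c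
                \<le> (u c b + u b c) / 2 + um * ?e gs w b"
            proof (cases "gs v = gs w")
              case True
              then have "(u (gs v) (gs w) + u (gs w) (gs v)) / 2 = 0" using u_diag gq by simp
              moreover have "um * ?e gs v c \<le> (u c b + u b c) / 2 + um * ?e gs w b"
                using True avg[of c b] b c cb um by (cases "c = gs v"; cases "b = gs w") auto
              ultimately show ?thesis using True by simp
            next
              case False
              then have one: "of_bool (gs v \<noteq> gs w) = (1 :: real)" by simp
              have "um * ?e gs v c \<le> um" "0 \<le> um * ?e gs w b" using um by simp_all
              moreover have "x - (UM + um) * 1 + y \<le> z + t" if "y \<le> um" "0 \<le> t" "x \<le> UM * 1" "0 \<le> z" for x y z t
                using that unfolding mult_1_right by linarith
              ultimately show ?thesis using edge[of v w] cb unfolding one by blast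
            qed
            then have "\<beta> * ((u (gs v) (gs w) + u (gs w) (gs v)) / 2 - (UM + um) * of_bool (gs v \<noteq> gs w) + um * ?e gs v c)
                \<le> \<beta> * ((u c b + u b c) / 2 + um * ?e gs w b)"
              by (rule mult_left_mono) (use \<beta> in simp)
            moreover have "- \<beta> * P + - \<beta> * um * F \<le> \<beta> * (Y - um * G) + - \<beta> * X"
              if "\<beta> * (X - Y + um * G) \<le> \<beta> * (P + um * F)" for P F Y G X
              using that by (simp add: algebra_simps)
            ultimately have "- \<beta> * ((u c b + u b c) / 2) + - \<beta> * um * ?e gs w b \<le>
              \<beta> * ((UM + um) * of_bool (gs v \<noteq> gs w) - um * ?e gs v c) + - \<beta> * ((u (gs v) (gs w) + u (gs w) (gs v)) / 2)"
              by blast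
            then show ?thesis unfolding E_def mult_exp_exp by (simp only: exp_le_cancel_iff)
          qed
          then have "(\<Sum>b\<in>?S. ennreal (exp (- \<beta> * ((u c b + u b c) / 2)) * exp (- \<beta> * um * ?e gs w b))) \<le> (\<Sum>b\<in>?S. ennreal E)"
            by (intro sum_mono ennreal_leI)
          also have "\<dots> = ennreal (real q * E)"
            by (simp add: ennreal_mult' ennreal_of_nat_eq_real_of_nat)
          finally show ?thesis
            unfolding E_def by (simp only: nn_integral_count_space_finite finite_atLeastLessThan mult.assoc)
        qed
        show "um \<le> d * um - dmax * (UM + um) - \<eta>0 / 4 - (real d + 1) * ln (real q) / \<beta>"
        proof -
          have "(real d - 1) * um = d * um - um" by (simp add: algebra_simps)
          then show ?thesis using entropy \<eta>0 \<eta>0_def by linarith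
        qed
        show "\<eta> \<le> (real d - 1) * um - dmax * (UM + um) - \<eta>0 / 4 - (real d + 1) * ln (real q) / \<beta>"
          using entropy \<eta>0 unfolding \<eta>_def \<eta>0_def[symmetric] by linarith
        show "(\<integral>\<^sup>+b. ennreal (exp (- \<beta> * \<eta> * ?e gs v b)) \<partial>count_space (?S - {gs v})) \<le> ennreal \<delta>" for v
        proof -
          have "(\<integral>\<^sup>+b. ennreal (exp (- \<beta> * \<eta> * ?e gs v b)) \<partial>count_space (?S - {gs v})) =
             (\<Sum>b\<in>?S - {gs v}. ennreal (exp (- \<beta> * \<eta> * ?e gs v b)))"
            by (simp add: nn_integral_count_space_finite)
          also have "\<dots> = (\<Sum>b\<in>?S - {gs v}. ennreal (exp (- \<eta> * \<beta>)))"
            by (intro sum.cong) (auto simp: mult.commute)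
          also have "\<dots> \<le> (\<Sum>b\<in>?S. ennreal (exp (- \<eta> * \<beta>)))"
            by (intro sum_mono2) auto
          also have "\<dots> = ennreal \<delta>"
            unfolding \<delta>_def by (simp add: ennreal_mult' ennreal_of_nat_eq_real_of_nat)
          finally show ?thesis .
        qed
        show "real (Suc d) * (\<delta> * (2 + \<delta>)) < 1" by (rule small)
      qed (use \<beta> um UM q \<eta>0 \<delta> osc in auto)
      obtain \<mu> where \<mu>: "\<forall>gs\<in>gs_q adj q dmax. extremal_gibbs ?S adj u \<Psi> \<beta> (\<mu> gs)"
        "inj_on \<mu> (gs_q adj q dmax)"
        "\<forall>gs\<in>gs_q adj q dmax. \<forall>v. 1 - \<delta> \<le> measure (\<mu> gs) {\<sigma> \<in> space (\<mu> gs). \<sigma> v = gs v}"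
        by (rule exE[OF ground_family[where C = "gs_q adj q dmax", OF ground]]) (assumption, elim conjE, rule that)
      then show "?family \<Psi> \<eta> (real q) \<beta>"
        unfolding \<delta>_def by (intro exI[of _ \<mu>] conjI)
    qed (use \<eta> q in auto)
  qed
qed

theorem theorem7:
  fixes adj :: "'v \<Rightarrow> 'v \<Rightarrow> bool" and d :: nat
  assumes tree: "cayley_tree d adj"
  shows
  \<comment> \<open>case (a): Z-valued p-SOS model\<close>
  "(\<forall>(p::real) (M::nat) (dmax::nat).
      0 < p \<longrightarrow> int d \<ge> d_bound p M dmax \<longrightarrow>
      (\<exists>eps > 0. \<forall>\<Psi> :: 'v \<Rightarrow> int \<Rightarrow> real.
         (\<forall>v k l. \<bar>\<Psi> v k - \<Psi> v l\<bar> \<le> eps) \<longrightarrow>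
         (\<exists>\<beta>0 c C. 0 < c \<and> 0 < C \<and>
            (\<forall>\<beta> \<ge> \<beta>0. \<exists>\<mu> :: ('v \<Rightarrow> int) \<Rightarrow> ('v \<Rightarrow> int) measure.
               (\<forall>\<omega>0 \<in> gs_sos adj dmax M.
                  extremal_gibbs UNIV adj (\<lambda>a b. \<bar>real_of_int (a - b)\<bar> powr p) \<Psi> \<beta> (\<mu> \<omega>0)) \<and>
               inj_on \<mu> (gs_sos adj dmax M) \<and>
               (\<forall>\<omega>0 \<in> gs_sos adj dmax M. \<forall>v k.
                  measure (\<mu> \<omega>0) {\<sigma> \<in> space (\<mu> \<omega>0). \<sigma> v - \<omega>0 v = k}
                    \<le> C * exp (- c * \<beta> * \<bar>real_of_int k\<bar> powr p))))))
   \<and>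
  \<comment> \<open>case (b): Z_q-valued finite-spin model, Z_q = {0..<q}\<close>
   (\<forall>(q::nat) (u :: nat \<Rightarrow> nat \<Rightarrow> real) (dmax::nat).
      2 \<le> q \<longrightarrow> (\<forall>k<q. \<forall>l<q. 0 \<le> u k l) \<longrightarrow> (\<forall>k<q. u k k = 0) \<longrightarrow>
      (real d - 1) * Min {u k l | k l. k < q \<and> l < q \<and> k \<noteq> l}
        > real dmax * (Max {u k l | k l. k < q \<and> l < q} + Min {u k l | k l. k < q \<and> l < q \<and> k \<noteq> l})
      \<longrightarrow>
      (\<exists>eps > 0. \<forall>\<Psi> :: 'v \<Rightarrow> nat \<Rightarrow> real.
         (\<forall>v. \<forall>k<q. \<forall>l<q. \<bar>\<Psi> v k - \<Psi> v l\<bar> \<le> eps) \<longrightarrow>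
         (\<exists>\<beta>0 c C. 0 < c \<and> 0 < C \<and>
            (\<forall>\<beta> \<ge> \<beta>0. \<exists>\<mu> :: ('v \<Rightarrow> nat) \<Rightarrow> ('v \<Rightarrow> nat) measure.
               (\<forall>\<omega>0 \<in> gs_q adj q dmax. extremal_gibbs {0..<q} adj u \<Psi> \<beta> (\<mu> \<omega>0)) \<and>
               inj_on \<mu> (gs_q adj q dmax) \<and>
               (\<forall>\<omega>0 \<in> gs_q adj q dmax. \<forall>v.
                  measure (\<mu> \<omega>0) {\<sigma> \<in> space (\<mu> \<omega>0). \<sigma> v = \<omega>0 v}
                    \<ge> 1 - C * exp (- c * \<beta>))))))"
  by (rule conjI; intro allI impI;
      rule sos_gibbs_measures[OF tree] potts_gibbs_measures[OF tree]; assumption)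

end
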